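(* For every sentence $\varphi\in\mathrm{EMSO}^2[\to,\lhd,\le]$ over $P$ and $\Sigma$, one can effectively construct a CFM $\mathcal A_\varphi$ over $P$ and $\Sigma$ with $2^{2^{\mathcal O(|\varphi|+|P|\log|P|)}}$ states per process such that $L(\mathcal A_\varphi)=L(\varphi)$.
   Context: Fix a finite set $P$ of processes and a finite alphabet $\Sigma$. A message sequence chart (MSC) over $P$ and $\Sigma$ is $M=((w_p)_{p\in P},\lhd)$ with $w_p\in\Sigma^*$, at least one of them nonempty. Its events are $E=\bigcup_{p}E_p$ with $E_p=\{p\}\times\{1,\dots,|w_p|\}$; the process relation $\to$ is given by $(p,i)\to(p,i+1)$ for $1\le i<|w_p|$; the labelling is $\lambda(p,i)=(p,a)$ where $a$ is the $i$-th letter of $w_p$. The message relation $\lhd\subseteq\bigcup_{p\neq q}E_p\times E_q$ must satisfy: $\to\cup\lhd$ is acyclic; each event belongs to at most one pair of $\lhd$; (FIFO) for $p\neq q$ and $(e,f),(e',f')\in\lhd\cap(E_p\times E_q)$, $e\to^*e'$ iff $f\to^*f'$. Let $\le=(\to\cup\lhd)^*$. An event in no $\lhd$-pair is internal. A CFM over $P$ and $\Sigma$ is $\mathcal A=((\mathcal A_p)_{p\in P},\mathit{Msg},\mathit{Acc})$ where $\mathit{Msg}$ is a finite set of messages, $\mathcal A_p=(S_p,\iota_p,\Delta_p)$ with $S_p$ finite (its states; "number of states per process" refers to $|S_p|$), $\iota_p\in S_p$, $\Delta_p\subseteq S_p\times\mathit{Act}_p\times S_p$ where $\mathit{Act}_p=\Sigma\cup(\Sigma\times\{!,?\}\times\mathit{Msg}\times(P\setminus\{p\}))$,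 and $\mathit{Acc}\subseteq\prod_pS_p$. A transition with action $a\in\Sigma$ is internal; with $(a,!,m,q)$ it sends $m$ to $q$; with $(a,?,m,q)$ it receives $m$ from $q$; its label is $a$. A run on $M$ maps each $e\in E_p$ to $\rho(e)\in\Delta_p$ such that: the label of $\rho(e)$ is the $\Sigma$-component of $\lambda(e)$; $\rho((p,1))$ has source $\iota_p$ when $E_p\ne\emptyset$; if $e\to f$ then the target of $\rho(e)$ is the source of $\rho(f)$; internal events get internal transitions; for $(e,f)\in\lhd$, $e\in E_p$, $f\in E_q$, $\rho(e)$ has action $(a,!,m,q)$ and $\rho(f)$ has action $(b,?,m,p)$ with the same $m$. It is accepting if $(s_p)_p\in\mathit{Acc}$, where $s_p$ is the target of $\rho$ at the last event of $p$, or $\iota_p$ if $E_p=\emptyset$. $L(\mathcal A)$ is the set of MSCs with an accepting run. MSO formulas: $\varphi::=p(x)\mid a(x)\mid x\in X\mid x=y\mid x\to y\mid x\lhd y\mid x\le y\mid\varphi\vee\varphi\mid\neg\varphi\mid\exists x.\varphi\mid\exists X.\varphi$, with first-order variables ranging over events and second-order over sets of events; $p(x)$ means $x\in E_p$, $a(x)$ that the $\Sigma$-label of $x$ is $a$. $\mathrm{FO}^2$: no second-order quantification, only the two first-order variables $x,y$ (reusable). $\mathrm{EMSO}^2$: formulas $\exists X_1\cdots\exists X_n.\psi$ with $\psi\in\mathrm{FO}^2$; $[\to,\lhd,\le]$ lists allowed binary predicates (equality always allowed). $|\varphi|$ is the length of $\varphi$ as a string, and $L(\varphi)$ the set of MSCs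 satisfying the sentence $\varphi$. *)

theory Defs
  imports Complex_Main "HOL-Library.FuncSet" "HOL-Library.Nat_Bijection"
begin

section \<open>Message sequence charts\<close>

type_synonym 'p event = "'p \<times> nat"

record ('p, 'a) msc =
  word :: "'p \<Rightarrow> 'a list"
  msg :: "('p event \<times> 'p event) set"

definition events_of :: "('p, 'a, 'z) msc_scheme \<Rightarrow> 'p \<Rightarrow> 'p event set" where
  "events_of M p = {p} \<times> {1..length (word M p)}"

definition events :: "'p set \<Rightarrow> ('p, 'a, 'z) msc_scheme \<Rightarrow> 'p event set" where
  "events P M = (\<Union>p\<in>P. events_of M p)"

text \<open>Positions start at 1, list indices at 0.\<close>

definition letter :: "('p, 'a, 'z) msc_scheme \<Rightarrow> 'p event \<Rightarrow> 'a" where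
  "letter M e = word M (fst e) ! (snd e - 1)"

definition proc_rel :: "('p, 'a, 'z) msc_scheme \<Rightarrow> ('p event \<times> 'p event) set" where
  "proc_rel M = {((p, i), (p, i + 1)) | p i. 1 \<le> i \<and> i < length (word M p)}"

definition causal :: "('p, 'a, 'z) msc_scheme \<Rightarrow> ('p event \<times> 'p event) set" where
  "causal M = (proc_rel M \<union> msg M)\<^sup>*"

text \<open>
  Words are required to be empty outside of \<open>P\<close>, so that an element of this type satisfying
  the predicate is determined by its words at the processes in \<open>P\<close> and its message relation.
\<close>

definition is_msc :: "'p set \<Rightarrow> 'a set \<Rightarrow> ('p, 'a) msc \<Rightarrow> bool" where
  "is_msc P \<Sigma> M \<longleftrightarrow>
     (\<forall>p\<in>P. word M p \<in> lists \<Sigma>) \<and>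
     (\<forall>p. p \<notin> P \<longrightarrow> word M p = []) \<and>
     (\<exists>p\<in>P. word M p \<noteq> []) \<and>
     msg M \<subseteq> (\<Union>p\<in>P. \<Union>q\<in>P - {p}. events_of M p \<times> events_of M q) \<and>
     acyclic (proc_rel M \<union> msg M) \<and>
     (\<forall>(e, f)\<in>msg M. \<forall>(e', f')\<in>msg M. {e, f} \<inter> {e', f'} \<noteq> {} \<longrightarrow> (e, f) = (e', f')) \<and>
     (\<forall>p\<in>P. \<forall>q\<in>P - {p}.
        \<forall>(e, f)\<in>msg M \<inter> (events_of M p \<times> events_of M q).
        \<forall>(e', f')\<in>msg M \<inter> (events_of M p \<times> events_of M q).
          (e, e') \<in> (proc_rel M)\<^sup>* \<longleftrightarrow> (f, f') \<in> (proc_rel M)\<^sup>*)"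

definition internal_event :: "('p, 'a, 'z) msc_scheme \<Rightarrow> 'p event \<Rightarrow> bool" where
  "internal_event M e \<longleftrightarrow> e \<notin> Field (msg M)"


section \<open>Communicating finite-state machines\<close>

datatype ('p, 'a, 'm) action =
    Internal (label: 'a)
  | Send (label: 'a) 'm 'p
  | Receive (label: 'a) 'm 'p

type_synonym ('p, 'a, 's, 'm) transition = "'s \<times> ('p, 'a, 'm) action \<times> 's"

definition source :: "('p, 'a, 's, 'm) transition \<Rightarrow> 's" where
  "source t = fst t"

definition act :: "('p, 'a, 's, 'm) transition \<Rightarrow> ('p, 'a, 'm) action" where
  "act t = fst (snd t)"

definition target :: "('p, 'a, 's, 'm) transition \<Rightarrow> 's" where
  "target t = snd (snd t)"

record ('p, 'a, 's, 'm) cfm =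
  states :: "'p \<Rightarrow> 's set"
  init :: "'p \<Rightarrow> 's"
  trans :: "'p \<Rightarrow> ('p, 'a, 's, 'm) transition set"
  msgs :: "'m set"
  acc :: "('p \<Rightarrow> 's) set"

definition actions :: "'p set \<Rightarrow> 'a set \<Rightarrow> 'm set \<Rightarrow> 'p \<Rightarrow> ('p, 'a, 'm) action set" where
  "actions P \<Sigma> Ms p =
     Internal ` \<Sigma> \<union>
     {Send a m q | a m q. a \<in> \<Sigma> \<and> m \<in> Ms \<and> q \<in> P - {p}} \<union>
     {Receive a m q | a m q. a \<in> \<Sigma> \<and> m \<in> Ms \<and> q \<in> P - {p}}"

definition is_cfm :: "'p set \<Rightarrow> 'a set \<Rightarrow> ('p, 'a, 's, 'm) cfm \<Rightarrow> bool" where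
  "is_cfm P \<Sigma> A \<longleftrightarrow>
     finite (msgs A) \<and>
     (\<forall>p\<in>P. finite (states A p) \<and> init A p \<in> states A p \<and>
        trans A p \<subseteq> states A p \<times> actions P \<Sigma> (msgs A) p \<times> states A p) \<and>
     acc A \<subseteq> (\<Pi>\<^sub>E p\<in>P. states A p)"

definition is_run ::
  "'p set \<Rightarrow> ('p, 'a, 's, 'm) cfm \<Rightarrow> ('p, 'a) msc \<Rightarrow>
   ('p event \<Rightarrow> ('p, 'a, 's, 'm) transition) \<Rightarrow> bool" where
  "is_run P A M \<rho> \<longleftrightarrow>
     (\<forall>p\<in>P. \<forall>e\<in>events_of M p. \<rho> e \<in> trans A p \<and> label (act (\<rho> e)) = letter M e) \<and>
     (\<forall>p\<in>P. events_of M p \<noteq> {} \<longrightarrow> source (\<rho> (p, 1)) = init A p) \<and>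
     (\<forall>(e, f)\<in>proc_rel M. target (\<rho> e) = source (\<rho> f)) \<and>
     (\<forall>e\<in>events P M. internal_event M e \<longrightarrow> (\<exists>a. act (\<rho> e) = Internal a)) \<and>
     (\<forall>(e, f)\<in>msg M. \<exists>a b m. act (\<rho> e) = Send a m (fst f) \<and> act (\<rho> f) = Receive b m (fst e))"

definition final_state ::
  "('p, 'a, 's, 'm) cfm \<Rightarrow> ('p, 'a) msc \<Rightarrow>
   ('p event \<Rightarrow> ('p, 'a, 's, 'm) transition) \<Rightarrow> 'p \<Rightarrow> 's" where
  "final_state A M \<rho> p =
     (if events_of M p = {} then init A p else target (\<rho> (p, length (word M p))))"

definition cfm_lang :: "'p set \<Rightarrow> 'a set \<Rightarrow> ('p, 'a, 's, 'm) cfm \<Rightarrow> ('p, 'a) msc set" where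
  "cfm_lang P \<Sigma> A =
     {M. is_msc P \<Sigma> M \<and> (\<exists>\<rho>. is_run P A M \<rho> \<and> restrict (final_state A M \<rho>) P \<in> acc A)}"


section \<open>Monadic second-order logic over MSCs\<close>

text \<open>First-order and second-order variables are two separate copies of the naturals.\<close>

datatype (fprocs: 'p, fletters: 'a) fm =
    Proc 'p nat
  | Letter 'a nat
  | Mem nat nat
  | Eq nat nat
  | Succ nat nat
  | Msg nat nat
  | Le nat nat
  | Or "('p, 'a) fm" "('p, 'a) fm"
  | Neg "('p, 'a) fm"
  | Ex nat "('p, 'a) fm"
  | ExSet nat "('p, 'a) fm"

primrec sat ::
  "'p set \<Rightarrow> ('p, 'a) msc \<Rightarrow> (nat \<Rightarrow> 'p event) \<Rightarrow> (nat \<Rightarrow> 'p event set) \<Rightarrow>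
   ('p, 'a) fm \<Rightarrow> bool" where
  "sat P M \<nu> V (Proc p x) \<longleftrightarrow> \<nu> x \<in> events_of M p"
| "sat P M \<nu> V (Letter a x) \<longleftrightarrow> letter M (\<nu> x) = a"
| "sat P M \<nu> V (Mem x X) \<longleftrightarrow> \<nu> x \<in> V X"
| "sat P M \<nu> V (Eq x y) \<longleftrightarrow> \<nu> x = \<nu> y"
| "sat P M \<nu> V (Succ x y) \<longleftrightarrow> (\<nu> x, \<nu> y) \<in> proc_rel M"
| "sat P M \<nu> V (Msg x y) \<longleftrightarrow> (\<nu> x, \<nu> y) \<in> msg M"
| "sat P M \<nu> V (Le x y) \<longleftrightarrow> (\<nu> x, \<nu> y) \<in> causal M"
| "sat P M \<nu> V (Or \<phi> \<psi>) \<longleftrightarrow> sat P M \<nu> V \<phi> \<or> sat P M \<nu> V \<psi>"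
| "sat P M \<nu> V (Neg \<phi>) \<longleftrightarrow> \<not> sat P M \<nu> V \<phi>"
| "sat P M \<nu> V (Ex x \<phi>) \<longleftrightarrow> (\<exists>e\<in>events P M. sat P M (\<nu>(x := e)) V \<phi>)"
| "sat P M \<nu> V (ExSet X \<phi>) \<longleftrightarrow> (\<exists>U\<subseteq>events P M. sat P M \<nu> (V(X := U)) \<phi>)"

primrec free_fo :: "('p, 'a) fm \<Rightarrow> nat set" where
  "free_fo (Proc p x) = {x}"
| "free_fo (Letter a x) = {x}"
| "free_fo (Mem x X) = {x}"
| "free_fo (Eq x y) = {x, y}"
| "free_fo (Succ x y) = {x, y}"
| "free_fo (Msg x y) = {x, y}"
| "free_fo (Le x y) = {x, y}"
| "free_fo (Or \<phi> \<psi>) = free_fo \<phi> \<union> free_fo \<psi>"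
| "free_fo (Neg \<phi>) = free_fo \<phi>"
| "free_fo (Ex x \<phi>) = free_fo \<phi> - {x}"
| "free_fo (ExSet X \<phi>) = free_fo \<phi>"

primrec free_so :: "('p, 'a) fm \<Rightarrow> nat set" where
  "free_so (Proc p x) = {}"
| "free_so (Letter a x) = {}"
| "free_so (Mem x X) = {X}"
| "free_so (Eq x y) = {}"
| "free_so (Succ x y) = {}"
| "free_so (Msg x y) = {}"
| "free_so (Le x y) = {}"
| "free_so (Or \<phi> \<psi>) = free_so \<phi> \<union> free_so \<psi>"
| "free_so (Neg \<phi>) = free_so \<phi>"
| "free_so (Ex x \<phi>) = free_so \<phi>"
| "free_so (ExSet X \<phi>) = free_so \<phi> - {X}"

definition sentence :: "('p, 'a) fm \<Rightarrow> bool" where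
  "sentence \<phi> \<longleftrightarrow> free_fo \<phi> = {} \<and> free_so \<phi> = {}"

definition fm_over :: "'p set \<Rightarrow> 'a set \<Rightarrow> ('p, 'a) fm \<Rightarrow> bool" where
  "fm_over P \<Sigma> \<phi> \<longleftrightarrow> fprocs \<phi> \<subseteq> P \<and> fletters \<phi> \<subseteq> \<Sigma>"

text \<open>Only meant for sentences, whose truth does not depend on the assignments.\<close>

definition fm_lang :: "'p set \<Rightarrow> 'a set \<Rightarrow> ('p, 'a) fm \<Rightarrow> ('p, 'a) msc set" where
  "fm_lang P \<Sigma> \<phi> = {M. is_msc P \<Sigma> M \<and> (\<forall>\<nu> V. sat P M \<nu> V \<phi>)}"

text \<open>The two first-order variables \<open>x\<close> and \<open>y\<close> are 0 and 1; set variables may occur free.\<close>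

primrec fo2 :: "('p, 'a) fm \<Rightarrow> bool" where
  "fo2 (Proc p x) \<longleftrightarrow> x \<in> {0, 1}"
| "fo2 (Letter a x) \<longleftrightarrow> x \<in> {0, 1}"
| "fo2 (Mem x X) \<longleftrightarrow> x \<in> {0, 1}"
| "fo2 (Eq x y) \<longleftrightarrow> x \<in> {0, 1} \<and> y \<in> {0, 1}"
| "fo2 (Succ x y) \<longleftrightarrow> x \<in> {0, 1} \<and> y \<in> {0, 1}"
| "fo2 (Msg x y) \<longleftrightarrow> x \<in> {0, 1} \<and> y \<in> {0, 1}"
| "fo2 (Le x y) \<longleftrightarrow> x \<in> {0, 1} \<and> y \<in> {0, 1}"
| "fo2 (Or \<phi> \<psi>) \<longleftrightarrow> fo2 \<phi> \<and> fo2 \<psi>"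
| "fo2 (Neg \<phi>) \<longleftrightarrow> fo2 \<phi>"
| "fo2 (Ex x \<phi>) \<longleftrightarrow> x \<in> {0, 1} \<and> fo2 \<phi>"
| "fo2 (ExSet X \<phi>) \<longleftrightarrow> False"

inductive emso2 :: "('p, 'a) fm \<Rightarrow> bool" where
  matrix: "fo2 \<psi> \<Longrightarrow> emso2 \<psi>"
| ex_set: "emso2 \<phi> \<Longrightarrow> emso2 (ExSet X \<phi>)"

text \<open>
  Length of the formula written as a string, with disjunctions in parentheses. Every variable,
  process, letter, connective, parenthesis and dot counts as one symbol.
\<close>

primrec fm_length :: "('p, 'a) fm \<Rightarrow> nat" where
  "fm_length (Proc p x) = 4"
| "fm_length (Letter a x) = 4"
| "fm_length (Mem x X) = 3"
| "fm_length (Eq x y) = 3"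
| "fm_length (Succ x y) = 3"
| "fm_length (Msg x y) = 3"
| "fm_length (Le x y) = 3"
| "fm_length (Or \<phi> \<psi>) = fm_length \<phi> + fm_length \<psi> + 3"
| "fm_length (Neg \<phi>) = fm_length \<phi> + 1"
| "fm_length (Ex x \<phi>) = fm_length \<phi> + 3"
| "fm_length (ExSet X \<phi>) = fm_length \<phi> + 3"


section \<open>Effectivity\<close>

text \<open>
  The total recursive functions of each arity: initial functions, composition, primitive
  recursion, and minimization of regular functions. Only the values of an \<open>n\<close>-ary function
  on lists of length \<open>n\<close> are meaningful.
\<close>

inductive recursive :: "nat \<Rightarrow> (nat list \<Rightarrow> nat) \<Rightarrow> bool" where
  zero: "recursive n (\<lambda>xs. 0)"
| succ: "recursive 1 (\<lambda>xs. Suc (xs ! 0))"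
| proj: "i < n \<Longrightarrow> recursive n (\<lambda>xs. xs ! i)"
| comp: "recursive (length gs) f \<Longrightarrow> \<forall>g\<in>set gs. recursive n g \<Longrightarrow>
    recursive n (\<lambda>xs. f (map (\<lambda>g. g xs) gs))"
| prim_rec: "recursive n f \<Longrightarrow> recursive (n + 2) g \<Longrightarrow>
    recursive (n + 1) (\<lambda>xs. rec_nat (f (tl xs)) (\<lambda>k r. g (k # r # tl xs)) (hd xs))"
| minimize: "recursive (n + 1) f \<Longrightarrow> \<forall>xs. length xs = n \<longrightarrow> (\<exists>k. f (k # xs) = 0) \<Longrightarrow>
    recursive n (\<lambda>xs. LEAST k. f (k # xs) = 0)"

text \<open>
  For effectivity, processes, letters, states and messages are named by natural numbers, and
  finite objects are coded by means of the standard bijections \<^const>\<open>prod_encode\<close>,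
  \<^const>\<open>list_encode\<close> and (for finite sets) \<^const>\<open>set_encode\<close>.
\<close>

primrec fm_code :: "(nat, nat) fm \<Rightarrow> nat" where
  "fm_code (Proc p x) = list_encode [0, p, x]"
| "fm_code (Letter a x) = list_encode [1, a, x]"
| "fm_code (Mem x X) = list_encode [2, x, X]"
| "fm_code (Eq x y) = list_encode [3, x, y]"
| "fm_code (Succ x y) = list_encode [4, x, y]"
| "fm_code (Msg x y) = list_encode [5, x, y]"
| "fm_code (Le x y) = list_encode [6, x, y]"
| "fm_code (Or \<phi> \<psi>) = list_encode [7, fm_code \<phi>, fm_code \<psi>]"
| "fm_code (Neg \<phi>) = list_encode [8, fm_code \<phi>]"
| "fm_code (Ex x \<phi>) = list_encode [9, x, fm_code \<phi>]"
| "fm_code (ExSet X \<phi>) = list_encode [10, X, fm_code \<phi>]"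

lemma fm_code_inject: "fm_code \<phi> = fm_code \<psi> \<Longrightarrow> \<phi> = \<psi>"
  by (induction \<phi> arbitrary: \<psi>; case_tac \<psi>) auto

primrec action_code :: "(nat, nat, nat) action \<Rightarrow> nat" where
  "action_code (Internal a) = list_encode [0, a]"
| "action_code (Send a m q) = list_encode [1, a, m, q]"
| "action_code (Receive a m q) = list_encode [2, a, m, q]"

definition transition_code :: "(nat, nat, nat, nat) transition \<Rightarrow> nat" where
  "transition_code t = list_encode [source t, action_code (act t), target t]"

text \<open>Code of a function on a finite domain, as its graph.\<close>

definition fun_code :: "nat set \<Rightarrow> (nat \<Rightarrow> nat) \<Rightarrow> nat" where
  "fun_code P s = set_encode ((\<lambda>p. prod_encode (p, s p)) ` P)"

definition cfm_code :: "nat set \<Rightarrow> (nat, nat, nat, nat) cfm \<Rightarrow> nat" where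
  "cfm_code P A = list_encode
     [fun_code P (\<lambda>p. set_encode (states A p)),
      fun_code P (init A),
      fun_code P (\<lambda>p. set_encode (transition_code ` trans A p)),
      set_encode (msgs A),
      set_encode (fun_code P ` acc A)]"

text \<open>The code determines the machine, up to the irrelevant components outside of \<open>P\<close>.\<close>

lemma inj_action_code: "inj action_code"
proof (rule injI)
  fix x y :: "(nat, nat, nat) action"
  show "action_code x = action_code y \<Longrightarrow> x = y"
    by (cases x; cases y) auto
qed

lemma inj_transition_code: "inj transition_code"
  by (rule injI)
    (auto simp: transition_code_def source_def act_def target_def prod_eq_iff
      dest: injD[OF inj_action_code])

lemma fun_code_inject:
  assumes "finite P" "fun_code P s = fun_code P t" "p \<in> P"
  shows "s p = t p"
proof -
  have "(\<lambda>p. prod_encode (p, s p)) ` P = (\<lambda>p. prod_encode (p, t p)) ` P"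
    using assms(1,2) by (simp add: fun_code_def set_encode_eq)
  then have "prod_encode (p, s p) \<in> (\<lambda>p. prod_encode (p, t p)) ` P"
    using assms(3) by blast
  then show ?thesis by auto
qed

lemma finite_actions:
  assumes "finite P" "finite \<Sigma>" "finite Ms"
  shows "finite (actions P \<Sigma> Ms p)"
proof -
  have "actions P \<Sigma> Ms p \<subseteq> Internal ` \<Sigma> \<union>
      (\<lambda>(a, m, q). Send a m q) ` (\<Sigma> \<times> Ms \<times> P) \<union>
      (\<lambda>(a, m, q). Receive a m q) ` (\<Sigma> \<times> Ms \<times> P)"
    by (auto simp: actions_def image_iff)
  then show ?thesis
    by (rule finite_subset) (use assms in simp)
qed

lemma is_cfm_finite:
  assumes "is_cfm P \<Sigma> A" "finite P" "finite \<Sigma>"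
  shows "finite (msgs A)" "finite (acc A)"
    and "p \<in> P \<Longrightarrow> finite (states A p)" "p \<in> P \<Longrightarrow> finite (trans A p)"
proof -
  show "finite (msgs A)" "p \<in> P \<Longrightarrow> finite (states A p)"
    using assms by (auto simp: is_cfm_def)
  have "finite (\<Pi>\<^sub>E p\<in>P. states A p)"
    using assms by (intro finite_PiE) (auto simp: is_cfm_def)
  then show "finite (acc A)"
    using assms by (auto simp: is_cfm_def intro: finite_subset)
  assume "p \<in> P"
  then have "trans A p \<subseteq> states A p \<times> actions P \<Sigma> (msgs A) p \<times> states A p"
      "finite (states A p)" "finite (msgs A)"
    using assms by (auto simp: is_cfm_def)
  then show "finite (trans A p)"
    using finite_actions[OF assms(2,3)] by (meson finite_SigmaI finite_subset)
qed

lemma cfm_code_inject: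
  assumes fin: "finite P" "finite \<Sigma>"
    and A: "is_cfm P \<Sigma> A" and B: "is_cfm P \<Sigma> B"
    and eq: "cfm_code P A = cfm_code P B"
  shows "msgs A = msgs B" "acc A = acc B"
    and "p \<in> P \<Longrightarrow> states A p = states B p \<and> init A p = init B p \<and> trans A p = trans B p"
proof -
  note fA = is_cfm_finite[OF A fin] and fB = is_cfm_finite[OF B fin]
  have eqs: "fun_code P (\<lambda>p. set_encode (states A p)) = fun_code P (\<lambda>p. set_encode (states B p))"
      "fun_code P (init A) = fun_code P (init B)"
      "fun_code P (\<lambda>p. set_encode (transition_code ` trans A p)) =
       fun_code P (\<lambda>p. set_encode (transition_code ` trans B p))"
      "set_encode (msgs A) = set_encode (msgs B)"
      "set_encode (fun_code P ` acc A) = set_encode (fun_code P ` acc B)"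
    using eq by (auto simp: cfm_code_def)
  show "msgs A = msgs B"
    using eqs(4) fA(1) fB(1) by (simp add: set_encode_eq)
  have img: "fun_code P ` acc A = fun_code P ` acc B"
    using eqs(5) fA(2) fB(2) by (simp add: set_encode_eq)
  have ext: "acc A \<subseteq> extensional P" "acc B \<subseteq> extensional P"
    using A B by (auto simp: is_cfm_def PiE_def)
  have "inj_on (fun_code P) (extensional P)"
    by (rule inj_onI) (auto intro: extensionalityI fun_code_inject[OF fin(1)])
  then show "acc A = acc B"
    using img ext by (simp add: inj_on_image_eq_iff)
  assume p: "p \<in> P"
  have "states A p = states B p"
    using fun_code_inject[OF fin(1) eqs(1) p] fA(3)[OF p] fB(3)[OF p] by (simp add: set_encode_eq)
  moreover have "init A p = init B p"
    using fun_code_inject[OF fin(1) eqs(2) p] .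
  moreover have "trans A p = trans B p"
    using fun_code_inject[OF fin(1) eqs(3) p] fA(4)[OF p] fB(4)[OF p]
    by (simp add: set_encode_eq inj_image_eq_iff[OF inj_transition_code])
  ultimately show "states A p = states B p \<and> init A p = init B p \<and> trans A p = trans B p"
    by blast
qed

end

theory Submission
  imports Defs
begin

text \<open>
  Once the quantified sets are fixed, let the type of an event be the set of subformulas in one
  variable that hold there. Whether \<open>\<exists>x. \<psi>(x, y)\<close> holds at an event is determined by its type and
  by the pairs of a type and a relation (equal, next, message, other past, other future, parallel)
  realised by the other events. The machine guesses a label for each event that states its
  type and these pairs, and checks the labels for consistency along processes and messages. A send
  event also guesses the label of the corresponding receive event, so that statements about the
  future can be checked in the same way as statements about the past.

  The difficulty lies in parallel events. Let \<open>A\<close> be the set of events of some type on some process,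
  and consider the events \<open>e\<close> of another process that have elements of \<open>A\<close> both in their past and in
  their future. Those without a parallel event in \<open>A\<close> form a chain together with \<open>A\<close>, hence lie on a
  single path through \<open>A\<close>, and guessing such a path certifies them. For the others, there are elements
  of \<open>A\<close> strictly between the latest one in the past and the earliest one in the future of \<open>e\<close>. A
  colouring of \<open>A\<close> certifies this: tokens passed on along each sequence of distinct processes tell
  \<open>e\<close> the colours of the latest element reaching it along \<open>\<pi>\<close> and of the predecessor of the earliest
  element reached along \<open>\<pi>'\<close>, which must differ for all \<open>\<pi>\<close> and \<open>\<pi>'\<close>. As channels are FIFO,
  the two elements depend monotonically on \<open>e\<close>, so that three colours suffice for fixed
  \<open>\<pi>\<close> and \<open>\<pi>'\<close>.

  A state essentially is a pair of labels, and a label is a subset of a set of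
  \<open>2 powr O(|\<phi>| + |P| log |P|)\<close> statements.
\<close>

section \<open>Recursive functions on codes\<close>

text \<open>Parallelism is the one relation that local equations do not determine, as nothing flows
  between parallel events. Hence both its presence and its absence need a certificate that can be
  guessed. If all of \<open>A\<close> is comparable with an event e outside \<open>A\<close>, then
  the latest element f of \<open>A\<close> below e and the earliest element g above e are
  consecutive in \<open>A\<close>. The predecessor of g is then f itself, and no colouring tells the
  two apart, so a false claim of a parallel element is exposed on those sequences \<pi> and \<pi>'
  that really lead from f to e and from e to g. These are not known to the machine, which therefore
  tests all pairs. Each pair has its own colouring because the monotonicity behind the bound of
  three colours is available only for a fixed pair.

  A path is guessed for each process p separately: two events of different processes may both be
  comparable with all of \<open>A\<close> and yet be parallel to each other, so that no single path
  covers both.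

  The sequences have at most |P| entries, so there are at most (|P| + 1) |P|^|P| of them; this is
  the origin of the term |P| log |P| in the bound.\<close>

declare set_decode_0 [simp del] set_decode_Suc [simp del]

lemma recursive_comp1:
  assumes "recursive 1 (\<lambda>xs. f (xs ! 0))" "recursive n g"
  shows "recursive n (\<lambda>xs. f (g xs))"
  using recursive.comp[of "[g]" "\<lambda>xs. f (xs ! 0)" n] assms by simp

lemma recursive_comp2:
  assumes "recursive 2 (\<lambda>xs. h (xs ! 0) (xs ! 1))" "recursive n f" "recursive n g"
  shows "recursive n (\<lambda>xs. h (f xs) (g xs))"
  using recursive.comp[of "[f, g]" "\<lambda>xs. h (xs ! 0) (xs ! 1)" n] assms
  by (simp add: numeral_2_eq_2)

lemma recursive_Suc: "recursive n f \<Longrightarrow> recursive n (\<lambda>xs. Suc (f xs))"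
  using recursive_comp1[OF recursive.succ] .

lemma recursive_const: "recursive n (\<lambda>xs. c)"
  by (induction c) (auto intro: recursive.zero recursive_Suc)

text \<open>Composition with the two projections turns the \<open>hd\<close> and \<open>tl\<close>
  of the recursion scheme into indexing. The resulting functions then agree on all lists, not only
  on those of length 2.\<close>

lemma recursive_rec2:
  assumes "recursive 1 (\<lambda>xs. f (xs ! 0))" "recursive 3 (\<lambda>xs. g (xs ! 0) (xs ! 1) (xs ! 2))"
  shows "recursive 2 (\<lambda>xs. rec_nat (f (xs ! 1)) (\<lambda>k r. g k r (xs ! 1)) (xs ! 0))"
proof -
  have "recursive 2 (\<lambda>xs. rec_nat (f (tl xs ! 0))
      (\<lambda>k r. g ((k # r # tl xs) ! 0) ((k # r # tl xs) ! 1) ((k # r # tl xs) ! 2)) (hd xs))"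
    using recursive.prim_rec[of 1 "\<lambda>xs. f (xs ! 0)" "\<lambda>xs. g (xs ! 0) (xs ! 1) (xs ! 2)"] assms
    by (simp add: numeral_3_eq_3 numeral_2_eq_2)
  with recursive.comp[of "[\<lambda>xs. xs ! 0, \<lambda>xs. xs ! 1]"
      "\<lambda>xs. rec_nat (f (tl xs ! 0)) (\<lambda>k r. g k r (tl xs ! 0)) (hd xs)" 2]
  show ?thesis by (simp add: recursive.proj numeral_2_eq_2)
qed

lemma recursive_rec1:
  assumes "recursive 2 (\<lambda>xs. g (xs ! 0) (xs ! 1))"
  shows "recursive 1 (\<lambda>xs. rec_nat c g (xs ! 0))"
proof -
  have "recursive 2 (\<lambda>xs. rec_nat c (\<lambda>k r. g k r) (xs ! 0))"
    using recursive_rec2[of "\<lambda>_. c" "\<lambda>k r x. g k r"] assms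
    by (simp add: recursive_const recursive_comp2[OF assms] recursive.proj)
  from recursive_comp2[of "\<lambda>a b. rec_nat c g a", OF this, of 1 "\<lambda>xs. xs ! 0" "\<lambda>xs. xs ! 0"]
  show ?thesis by (simp add: recursive.proj)
qed

lemma recursive_pred: "recursive 1 (\<lambda>xs. xs ! 0 - 1)"
proof -
  have "rec_nat 0 (\<lambda>k r. k) n = n - 1" for n by (cases n) auto
  with recursive_rec1[of "\<lambda>k r. k" 0] show ?thesis by (simp add: recursive.proj)
qed

lemma recursive_add: "recursive 2 (\<lambda>xs. xs ! 0 + xs ! 1)"
proof -
  have "rec_nat m (\<lambda>k r. Suc r) n = n + m" for n m by (induction n) auto
  with recursive_rec2[of "\<lambda>m. m" "\<lambda>k r x. Suc r"] show ?thesis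
    by (simp add: recursive.proj recursive_Suc)
qed

lemma recursive_diff: "recursive 2 (\<lambda>xs. xs ! 0 - xs ! 1)"
proof -
  have *: "rec_nat m (\<lambda>k r. r - 1) n = m - n" for n m :: nat
    by (induction n) (simp_all del: One_nat_def)
  have "recursive 3 (\<lambda>xs. xs ! 1 - 1)"
    by (rule recursive_comp1[OF recursive_pred]) (simp add: recursive.proj)
  with recursive_rec2[of "\<lambda>m. m" "\<lambda>k r x. r - 1"]
  have "recursive 2 (\<lambda>xs. xs ! 1 - xs ! 0)"
    unfolding * by (simp add: recursive.proj)
  from recursive_comp2[of "\<lambda>a b. b - a", OF this, of 2 "\<lambda>xs. xs ! 1" "\<lambda>xs. xs ! 0"]
  show ?thesis by (simp add: recursive.proj)
qed

lemma recursive_triangle: "recursive 1 (\<lambda>xs. triangle (xs ! 0))"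
proof -
  have *: "rec_nat 0 (\<lambda>k r. r + Suc k) = triangle"
  proof
    show "rec_nat 0 (\<lambda>k r. r + Suc k) n = triangle n" for n by (induction n) auto
  qed
  have "recursive 2 (\<lambda>xs. xs ! 1 + Suc (xs ! 0))"
    by (intro recursive_comp2[OF recursive_add] recursive_Suc recursive.proj) auto
  from recursive_rec1[OF this, of 0] show ?thesis unfolding * .
qed

lemma recursive_prod_encode: "recursive 2 (\<lambda>xs. prod_encode (xs ! 0, xs ! 1))"
  unfolding prod_encode_def prod.case
  by (intro recursive_comp2[OF recursive_add] recursive_comp1[OF recursive_triangle] recursive.proj)
    auto

definition pfst :: "nat \<Rightarrow> nat" where "pfst n = fst (prod_decode n)"
definition psnd :: "nat \<Rightarrow> nat" where "psnd n = snd (prod_decode n)"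

lemma pfst_encode [simp]: "pfst (prod_encode (a, b)) = a"
  and psnd_encode [simp]: "psnd (prod_encode (a, b)) = b"
  by (simp_all add: pfst_def psnd_def)

lemma encode_pfst_psnd [simp]: "prod_encode (pfst n, psnd n) = n"
  by (simp add: pfst_def psnd_def)

lemma triangle_mono: "m \<le> n \<Longrightarrow> triangle m \<le> triangle n"
  by (induction n) (auto simp: le_Suc_eq)

text \<open>As \<open>prod_encode (a, b)\<close> is \<open>triangle (a + b) + a\<close>, the sum a +
  b is the number of the diagonal on which z lies, i.e. the least k with z <
  \<open>triangle (Suc k)\<close>. Truncated subtraction expresses this inequality. Both projections
  are computed from the diagonal, which is found by minimization.\<close>

lemma Least_triangle:
  assumes "z = prod_encode (a, b)"
  shows "(LEAST k. Suc z - triangle (Suc k) = 0) = a + b"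
proof (rule Least_equality)
  show "Suc z - triangle (Suc (a + b)) = 0" using assms by (simp add: prod_encode_def)
  fix k assume "Suc z - triangle (Suc k) = 0"
  then have "z < triangle (Suc k)" by simp
  then have "triangle (a + b) < triangle (Suc k)"
    using assms by (simp add: prod_encode_def)
  then show "a + b \<le> k"
    using triangle_mono[of "Suc k" "a + b"] by (meson not_less_eq_eq leD)
qed

lemma recursive_triangle_root:
  "recursive 1 (\<lambda>xs. pfst (xs ! 0) + psnd (xs ! 0))"
proof -
  have "recursive (1 + 1) (\<lambda>xs. Suc (xs ! 1) - triangle (Suc (xs ! 0)))"
    by (intro recursive_comp2[OF recursive_diff] recursive_comp1[OF recursive_triangle]
        recursive_Suc recursive.proj) auto
  from recursive.minimize[OF this]
  have "recursive 1 (\<lambda>xs. LEAST k. Suc (xs ! 0) - triangle (Suc k) = 0)"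
  proof -
    assume *: "\<forall>xs. length xs = 1 \<longrightarrow>
        (\<exists>k. Suc ((k # xs) ! 1) - triangle (Suc ((k # xs) ! 0)) = 0) \<Longrightarrow>
      recursive 1 (\<lambda>xs. LEAST k. Suc ((k # xs) ! 1) - triangle (Suc ((k # xs) ! 0)) = 0)"
    have "\<exists>k. Suc z - triangle (Suc k) = 0" for z
      by (rule exI[of _ z]) (simp add: triangle_def)
    with * show ?thesis by simp
  qed
  moreover have "(LEAST k. Suc z - triangle (Suc k) = 0) = pfst z + psnd z" for z
    by (rule Least_triangle) simp
  ultimately show ?thesis by simp
qed

text \<open>Unary functions suffice, since several arguments can be packed by
  \<open>prod_encode\<close>. All closure properties then have the same form, and the collection
  \<open>rf\<close> proves a function recursive by following the structure of its
  definition.\<close>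

definition RF :: "(nat \<Rightarrow> nat) \<Rightarrow> bool" where
  "RF f \<longleftrightarrow> recursive 1 (\<lambda>xs. f (xs ! 0))"

definition DP :: "(nat \<Rightarrow> bool) \<Rightarrow> bool" where
  "DP Q \<longleftrightarrow> RF (\<lambda>x. of_bool (Q x))"

named_theorems rf

lemma RF_id [rf]: "RF (\<lambda>x. x)"
  by (simp add: RF_def recursive.proj)

lemma RF_const [rf]: "RF (\<lambda>x. c)"
  by (simp add: RF_def recursive_const)

lemma RF_comp: "RF f \<Longrightarrow> RF g \<Longrightarrow> RF (\<lambda>x. f (g x))"
  unfolding RF_def by (rule recursive_comp1)

lemma DP_comp: "DP f \<Longrightarrow> RF g \<Longrightarrow> DP (\<lambda>x. f (g x))"
  unfolding DP_def by (rule RF_comp)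

lemma RF_comp2:
  "recursive 2 (\<lambda>xs. h (xs ! 0) (xs ! 1)) \<Longrightarrow> RF f \<Longrightarrow> RF g \<Longrightarrow> RF (\<lambda>x. h (f x) (g x))"
  unfolding RF_def by (rule recursive_comp2)

lemma RF_pfst0: "RF pfst" and RF_psnd0: "RF psnd"
proof -
  have *: "pfst z = z - triangle (pfst z + psnd z)" for z
    using encode_pfst_psnd[of z] by (simp add: prod_encode_def)
  have "recursive 1 (\<lambda>xs. xs ! 0 - triangle (pfst (xs ! 0) + psnd (xs ! 0)))"
    by (intro recursive_comp2[OF recursive_diff] recursive_comp1[OF recursive_triangle]
        recursive_triangle_root recursive.proj) auto
  then show 1: "RF pfst" by (simp add: RF_def flip: *)
  have "recursive 1 (\<lambda>xs. (pfst (xs ! 0) + psnd (xs ! 0)) - pfst (xs ! 0))"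
    by (intro recursive_comp2[OF recursive_diff] recursive_triangle_root 1[unfolded RF_def])
  then show "RF psnd" by (simp add: RF_def)
qed

lemma RF_pfst [rf]: "RF f \<Longrightarrow> RF (\<lambda>x. pfst (f x))"
  and RF_psnd [rf]: "RF f \<Longrightarrow> RF (\<lambda>x. psnd (f x))"
  by (simp_all add: RF_comp[OF RF_pfst0] RF_comp[OF RF_psnd0])

lemma RF_Suc [rf]: "RF f \<Longrightarrow> RF (\<lambda>x. Suc (f x))"
  by (simp add: RF_def recursive_Suc)

lemma RF_add [rf]: "RF f \<Longrightarrow> RF g \<Longrightarrow> RF (\<lambda>x. f x + g x)"
  and RF_diff [rf]: "RF f \<Longrightarrow> RF g \<Longrightarrow> RF (\<lambda>x. f x - g x)"
  and RF_prod_encode [rf]: "RF f \<Longrightarrow> RF g \<Longrightarrow> RF (\<lambda>x. prod_encode (f x, g x))"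
  by (rule RF_comp2[OF recursive_add] RF_comp2[OF recursive_diff] RF_comp2[OF recursive_prod_encode];
      assumption)+

text \<open>Counter, accumulator and parameter of the step function are packed into one number, so
  that the premise is again about \<open>RF\<close> and the rules can be iterated.\<close>

lemma RF_rec [rf]:
  assumes f: "RF f" and g: "RF (\<lambda>z. g (pfst z) (pfst (psnd z)) (psnd (psnd z)))" and b: "RF b"
  shows "RF (\<lambda>x. rec_nat (f x) (\<lambda>k r. g k r x) (b x))"
proof -
  have "recursive 3 (\<lambda>xs. prod_encode (xs ! 0, prod_encode (xs ! 1, xs ! 2)))"
    by (intro recursive_comp2[OF recursive_prod_encode] recursive.proj) auto
  from recursive_comp1[OF g[unfolded RF_def] this]
  have "recursive 3 (\<lambda>xs. g (xs ! 0) (xs ! 1) (xs ! 2))" by simp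
  from recursive_rec2[OF f[unfolded RF_def] this]
  have "recursive 2 (\<lambda>xs. rec_nat (f (xs ! 1)) (\<lambda>k r. g k r (xs ! 1)) (xs ! 0))" .
  from RF_comp2[of "\<lambda>u v. rec_nat (f v) (\<lambda>k r. g k r v) u", OF this b RF_id] show ?thesis by simp
qed

lemma RF_mult [rf]:
  assumes "RF f" "RF g" shows "RF (\<lambda>x. f x * g x)"
proof -
  have *: "m * n = rec_nat 0 (\<lambda>k r. r + n) m" for m n :: nat by (induction m) auto
  show ?thesis unfolding * by (intro rf assms RF_comp[OF assms(1)] RF_comp[OF assms(2)])
qed

lemma RF_of_bool [rf]: "DP Q \<Longrightarrow> RF (\<lambda>x. of_bool (Q x))"
  by (simp add: DP_def)

lemma DP_eq0: "RF f \<Longrightarrow> DP (\<lambda>x. f x = 0)"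
proof -
  assume "RF f"
  then have "RF (\<lambda>x. 1 - f x)" by (intro rf)
  moreover have "of_bool (n = 0) = 1 - n" for n :: nat by auto
  ultimately show ?thesis by (simp add: DP_def)
qed

lemma DP_not [rf]: "DP Q \<Longrightarrow> DP (\<lambda>x. \<not> Q x)"
  using DP_eq0[of "\<lambda>x. of_bool (Q x)"] by (simp add: DP_def)

lemma DP_conj [rf]: "DP Q \<Longrightarrow> DP R \<Longrightarrow> DP (\<lambda>x. Q x \<and> R x)"
proof -
  assume "DP Q" "DP R"
  then have "RF (\<lambda>x. of_bool (Q x) * of_bool (R x))" by (intro rf)
  then show ?thesis by (simp add: DP_def of_bool_conj)
qed

lemma DP_disj [rf]: "DP Q \<Longrightarrow> DP R \<Longrightarrow> DP (\<lambda>x. Q x \<or> R x)"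
proof -
  assume "DP Q" "DP R"
  then have "DP (\<lambda>x. \<not> (\<not> Q x \<and> \<not> R x))" by (intro rf)
  then show ?thesis by simp
qed

lemma DP_imp [rf]: "DP Q \<Longrightarrow> DP R \<Longrightarrow> DP (\<lambda>x. Q x \<longrightarrow> R x)"
  unfolding imp_conv_disj by (intro rf)

lemma DP_iff [rf]: "DP Q \<Longrightarrow> DP R \<Longrightarrow> DP (\<lambda>x. Q x \<longleftrightarrow> R x)"
  unfolding iff_conv_conj_imp by (intro rf)

lemma DP_le [rf]: "RF f \<Longrightarrow> RF g \<Longrightarrow> DP (\<lambda>x. f x \<le> g x)"
  using DP_eq0[of "\<lambda>x. f x - g x"] by (simp add: rf)

lemma DP_eq [rf]: "RF f \<Longrightarrow> RF g \<Longrightarrow> DP (\<lambda>x. f x = g x)"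
  unfolding eq_iff by (intro rf)

lemma RF_if [rf]:
  assumes "DP Q" "RF f" "RF g"
  shows "RF (\<lambda>x. if Q x then f x else g x)"
proof -
  have "RF (\<lambda>x. of_bool (Q x) * f x + of_bool (\<not> Q x) * g x)" using assms by (intro rf)
  moreover have "of_bool b * m + of_bool (\<not> b) * n = (if b then m else n)" for b and m n :: nat
    by auto
  ultimately show ?thesis by simp
qed

lemma DP_if [rf]:
  assumes "DP Q" "DP f" "DP g"
  shows "DP (\<lambda>x. if Q x then f x else g x)"
  using assms unfolding if_bool_eq_conj by (intro rf)

lemma DP_ex_less [rf]:
  assumes Q: "DP (\<lambda>z. Q (pfst z) (psnd z))" and b: "RF b"
  shows "DP (\<lambda>x. \<exists>k<b x. Q k x)"
proof -
  have Q': "DP (\<lambda>z. Q (pfst z) (psnd (psnd z)))"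
    using DP_comp[OF Q, of "\<lambda>z. prod_encode (pfst z, psnd (psnd z))"] by (simp add: rf)
  have "RF (\<lambda>x. rec_nat 0 (\<lambda>k r. of_bool (r \<noteq> 0 \<or> Q k x)) (b x))"
    by (intro rf Q' b)
  moreover have "rec_nat 0 (\<lambda>k r. of_bool (r \<noteq> 0 \<or> Q k x)) n = (of_bool (\<exists>k<n. Q k x) :: nat)"
    for n x
    by (induction n) (auto simp: less_Suc_eq)
  ultimately show ?thesis unfolding DP_def by (simp only:)
qed

lemma DP_all_less [rf]:
  assumes Q: "DP (\<lambda>z. Q (pfst z) (psnd z))" and b: "RF b"
  shows "DP (\<lambda>x. \<forall>k<b x. Q k x)"
proof -
  have "DP (\<lambda>x. \<not> (\<exists>k<b x. \<not> Q k x))" by (intro rf assms)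
  then show ?thesis by simp
qed

lemma RF_pow2 [rf]: "RF f \<Longrightarrow> RF (\<lambda>x. 2 ^ f x)"
proof -
  assume f: "RF f"
  have *: "2 ^ n = rec_nat 1 (\<lambda>k r. 2 * r) n" for n :: nat by (induction n) auto
  show ?thesis unfolding * by (intro rf f)
qed

section \<open>Finite sets coded by binary digits\<close>

lemma half_Suc: "Suc n div 2 = n - n div 2"
  by presburger

lemma DP_odd: "RF f \<Longrightarrow> DP (\<lambda>x. odd (f x))"
  and RF_half: "RF f \<Longrightarrow> RF (\<lambda>x. f x div 2)"
proof -
  assume f: "RF f"
  have *: "n div 2 = rec_nat 0 (\<lambda>k r. k - r) n" for n :: nat
    using half_Suc by (induction n) auto
  have **: "odd n \<longleftrightarrow> n \<noteq> 2 * (n div 2)" for n :: nat by presburger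
  show "RF (\<lambda>x. f x div 2)" unfolding * by (intro rf f)
  then show "DP (\<lambda>x. odd (f x))" unfolding ** by (intro rf f)
qed

lemma DP_in_set_decode [rf]:
  assumes "RF f" "RF g"
  shows "DP (\<lambda>x. f x \<in> set_decode (g x))"
proof -
  have *: "n div 2 ^ k = rec_nat n (\<lambda>k r. r div 2) k" for n k :: nat
    by (induction k) (simp_all add: div_mult2_eq power_Suc2 del: power_Suc)
  show ?thesis unfolding set_decode_def mem_Collect_eq *
    by (intro rf RF_half DP_odd assms)
qed

text \<open>An element k contributes 2 ^ k to the code. Quantifiers over a coded set thereby become
  bounded by the code itself.\<close>

lemma less_of_in_set_decode: "k \<in> set_decode n \<Longrightarrow> k < n"
proof -
  assume "k \<in> set_decode n"
  then have "odd (n div 2 ^ k)" by (simp add: set_decode_def)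
  then have "n div 2 ^ k \<noteq> 0" by (metis even_zero)
  then have "2 ^ k \<le> n" by (auto simp: div_eq_0_iff not_less)
  then show ?thesis using less_exp[of k] by linarith
qed

lemma DP_bex_decode [rf]:
  assumes Q: "DP (\<lambda>z. Q (pfst z) (psnd z))" and b: "RF b"
  shows "DP (\<lambda>x. \<exists>k\<in>set_decode (b x). Q k x)"
proof -
  have *: "(\<exists>k\<in>set_decode n. R k) \<longleftrightarrow> (\<exists>k<n. k \<in> set_decode n \<and> R k)" for n R
    using less_of_in_set_decode by blast
  show ?thesis unfolding * by (intro rf assms RF_comp[OF b])
qed

lemma DP_ball_decode [rf]:
  assumes Q: "DP (\<lambda>z. Q (pfst z) (psnd z))" and b: "RF b"
  shows "DP (\<lambda>x. \<forall>k\<in>set_decode (b x). Q k x)"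
proof -
  have "DP (\<lambda>x. \<not> (\<exists>k\<in>set_decode (b x). \<not> Q k x))" by (intro rf assms)
  then show ?thesis by simp
qed

text \<open>When k is examined, the accumulator is the code of the members below k. Since
  \<open>Q\<close> may consult it, this covers filtering as well as course-of-values
  recursion.\<close>

lemma set_encode_rec:
  "rec_nat 0 (\<lambda>k r. r + (if Q k r then 2 ^ k else 0)) n =
   set_encode {k. k < n \<and> Q k (rec_nat 0 (\<lambda>k r. r + (if Q k r then 2 ^ k else 0)) k)}"
proof (induction n)
  case (Suc n)
  let ?F = "rec_nat 0 (\<lambda>k r. r + (if Q k r then 2 ^ k else 0))"
  have "{k. k < Suc n \<and> Q k (?F k)} =
      (if Q n (?F n) then insert n {k. k < n \<and> Q k (?F k)} else {k. k < n \<and> Q k (?F k)})"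
    by (auto simp: less_Suc_eq)
  with Suc show ?case by simp
qed simp

lemma RF_filter [rf]:
  assumes Q: "DP (\<lambda>z. Q (pfst z) (psnd z))" and b: "RF b"
  shows "RF (\<lambda>x. set_encode {k. k < b x \<and> Q k x})"
proof -
  have Q': "DP (\<lambda>z. Q (pfst z) (psnd (psnd z)))"
    using DP_comp[OF Q, of "\<lambda>z. prod_encode (pfst z, psnd (psnd z))"] by (simp add: rf)
  have "RF (\<lambda>x. rec_nat 0 (\<lambda>k r. r + (if Q k x then 2 ^ k else 0)) (b x))"
    by (intro rf Q' b)
  then show ?thesis using set_encode_rec[of "\<lambda>k r. Q k _"] by simp
qed

lemma set_decode_power2 [simp]: "set_decode (2 ^ k) = {k}"
  using set_decode_plus_power_2[of k 0] by simp

definition union_code :: "(nat \<Rightarrow> nat) \<Rightarrow> nat \<Rightarrow> nat" where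
  "union_code F S = set_encode (\<Union>k\<in>set_decode S. set_decode (F k))"

lemma set_decode_union_code [simp]:
  "set_decode (union_code F S) = (\<Union>k\<in>set_decode S. set_decode (F k))"
  by (simp add: union_code_def)

lemma RF_union_code [rf]:
  assumes F: "RF (\<lambda>z. F (pfst z) (psnd z))" and S: "RF S"
  shows "RF (\<lambda>x. union_code (\<lambda>k. F k x) (S x))"
proof -
  \<comment> \<open>An element of the union is smaller than some code \<open>F k x\<close> with k <
    \<open>S x\<close>, hence smaller than the sum of these codes; this bounds the search.\<close>
  let ?B = "\<lambda>x. rec_nat 0 (\<lambda>k r. r + F k x) (S x)"
  have F': "RF (\<lambda>z. F (pfst z) (psnd (psnd z)))"
    using RF_comp[OF F, of "\<lambda>z. prod_encode (pfst z, psnd (psnd z))"] by (simp add: rf)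
  have F'': "RF (\<lambda>x. F (pfst x) (psnd (psnd x)))" by (rule F')
  have B: "RF ?B" by (intro rf F' S)
  have D: "DP (\<lambda>z. \<exists>k\<in>set_decode (S (psnd z)). pfst z \<in> set_decode (F k (psnd z)))"
    by (intro rf RF_comp[OF S] RF_comp[OF F, of "\<lambda>z. prod_encode (pfst z, psnd (psnd z))", simplified])
  have "RF (\<lambda>x. set_encode {j. j < ?B x \<and> (\<exists>k\<in>set_decode (S x). j \<in> set_decode (F k x))})"
    by (rule RF_filter[OF D B])
  moreover have "{j. j < ?B x \<and> (\<exists>k\<in>set_decode (S x). j \<in> set_decode (F k x))} =
      (\<Union>k\<in>set_decode (S x). set_decode (F k x))" for x
  proof -
    have "F k x \<le> rec_nat 0 (\<lambda>k r. r + F k x) n" if "k < n" for k n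
      using that by (induction n) (auto simp: less_Suc_eq trans_le_add1)
    then have "j < ?B x" if "k \<in> set_decode (S x)" "j \<in> set_decode (F k x)" for j k
      using less_of_in_set_decode that by (meson le_less_trans less_le_trans)
    then show ?thesis by blast
  qed
  ultimately show ?thesis by (simp add: union_code_def)
qed

lemma RF_insert0 [rf]: "RF f \<Longrightarrow> RF (\<lambda>x. set_encode {f x})"
proof -
  assume "RF f"
  then have "RF (\<lambda>x. 2 ^ f x)" by (intro rf)
  then show ?thesis by (simp add: set_encode_def)
qed

definition image_code :: "(nat \<Rightarrow> nat) \<Rightarrow> nat \<Rightarrow> nat" where
  "image_code F S = union_code (\<lambda>k. set_encode {F k}) S"

lemma set_decode_image_code [simp]: "set_decode (image_code F S) = F ` set_decode S"
  by (auto simp: image_code_def)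

lemma RF_image_code [rf]:
  "RF (\<lambda>z. F (pfst z) (psnd z)) \<Longrightarrow> RF S \<Longrightarrow> RF (\<lambda>x. image_code (\<lambda>k. F k x) (S x))"
  unfolding image_code_def by (intro rf)

text \<open>The code of a subset is at most that of the whole set, so no subset of the set coded by
  U is missed by the search up to U.\<close>

definition pow_code :: "nat \<Rightarrow> nat" where
  "pow_code U = set_encode {k. k < Suc U \<and> (\<forall>x\<in>set_decode k. x \<in> set_decode U)}"

lemma set_decode_pow_code: "set_decode (pow_code U) = {k. set_decode k \<subseteq> set_decode U}"
  using subset_decode_imp_le by (auto simp: pow_code_def less_Suc_eq_le)

lemma RF_pow_code [rf]: "RF f \<Longrightarrow> RF (\<lambda>x. pow_code (f x))"
proof -
  have "RF pow_code" unfolding pow_code_def[abs_def] by (intro rf)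
  then show "RF f \<Longrightarrow> RF (\<lambda>x. pow_code (f x))" by (rule RF_comp)
qed

definition un_code :: "nat \<Rightarrow> nat \<Rightarrow> nat" where
  "un_code A B = set_encode {k. k < A + B \<and> (k \<in> set_decode A \<or> k \<in> set_decode B)}"

lemma set_decode_un_code [simp]: "set_decode (un_code A B) = set_decode A \<union> set_decode B"
  using less_of_in_set_decode by (fastforce simp: un_code_def)

lemma RF_un_code [rf]: "RF f \<Longrightarrow> RF g \<Longrightarrow> RF (\<lambda>x. un_code (f x) (g x))"
proof -
  have "RF (\<lambda>z. un_code (pfst z) (psnd z))" unfolding un_code_def by (intro rf)
  then show "RF f \<Longrightarrow> RF g \<Longrightarrow> ?thesis"
    using RF_comp[of "\<lambda>z. un_code (pfst z) (psnd z)" "\<lambda>x. prod_encode (f x, g x)"] by (simp add: rf)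
qed

text \<open>Bit k of the accumulator is the truth value at k, so the step for k sees the truth
  values of all smaller numbers, in particular of the codes of subformulas.\<close>

lemma DP_course_of_values:
  assumes Q: "DP (\<lambda>z. Q (pfst z) (pfst (psnd z)) (psnd (psnd z)))" and f: "RF f"
    and g: "RF g"
  shows "DP (\<lambda>x. f x \<in> set_decode
    (rec_nat 0 (\<lambda>k r. r + (if Q k r (g x) then 2 ^ k else 0)) (Suc (f x))))"
proof -
  have "DP (\<lambda>z. Q (pfst z) (pfst (psnd z)) (g (psnd (psnd z))))"
    using DP_comp[OF Q, of "\<lambda>z. prod_encode (pfst z, prod_encode (pfst (psnd z), g (psnd (psnd z))))"]
    by (simp add: rf RF_comp[OF g])
  then show ?thesis by (intro rf f)
qed

section \<open>Causal orders generated by process lines and messages\<close>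

text \<open>
  The locale covers both directions of time: \<open>bef\<close> is the strict order on each process,
  \<open>pv e\<close> the position adjacent to \<open>e\<close>, which lies outside of \<open>E\<close> if \<open>e\<close> is extremal.
\<close>

locale chart_order =
  fixes E :: "'e set" and loc :: "'e \<Rightarrow> 'q" and bef :: "'e \<Rightarrow> 'e \<Rightarrow> bool"
    and pv :: "'e \<Rightarrow> 'e" and m :: "('e \<times> 'e) set"
  assumes fin: "finite E"
    and bef_loc: "bef e f \<Longrightarrow> loc e = loc f"
    and bef_irrefl: "\<not> bef e e"
    and bef_trans: "bef e f \<Longrightarrow> bef f g \<Longrightarrow> bef e g"
    and bef_total: "e \<in> E \<Longrightarrow> f \<in> E \<Longrightarrow> loc e = loc f \<Longrightarrow> e = f \<or> bef e f \<or> bef f e"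
    and bef_pv: "e \<in> E \<Longrightarrow> f \<in> E \<Longrightarrow> bef f e \<longleftrightarrow> pv e \<in> E \<and> (f = pv e \<or> bef f (pv e))"
    and m_E: "(z, y) \<in> m \<Longrightarrow> z \<in> E \<and> y \<in> E \<and> loc z \<noteq> loc y"
    and m_inj: "(z, y) \<in> m \<Longrightarrow> (z', y) \<in> m \<Longrightarrow> z = z'"
    and m_fun: "(z, y) \<in> m \<Longrightarrow> (z, y') \<in> m \<Longrightarrow> y = y'"
    and fifo: "(z, y) \<in> m \<Longrightarrow> (z', y') \<in> m \<Longrightarrow> loc z = loc z' \<Longrightarrow> bef y' y \<Longrightarrow> bef z' z"
    and acyc: "acyclic ({(pv e, e) | e. e \<in> E \<and> pv e \<in> E} \<union> m)"
begin

section \<open>The order generated by process lines and messages\<close>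

definition D :: "('e \<times> 'e) set" where
  "D = {(pv e, e) | e. e \<in> E \<and> pv e \<in> E} \<union> m"

lemma D_E: "(x, y) \<in> D \<Longrightarrow> x \<in> E \<and> y \<in> E"
  using m_E by (auto simp: D_def)

lemma lt_E: "(x, y) \<in> D\<^sup>+ \<Longrightarrow> x \<in> E \<and> y \<in> E"
  using D_E by (metis tranclD tranclD2)

lemma acyclic_D: "acyclic D"
  using acyc by (simp add: D_def)

lemma lt_irrefl: "(x, x) \<notin> D\<^sup>+"
  using acyclic_D by (simp add: acyclic_def)

lemma finite_D: "finite D"
  by (rule finite_subset[of _ "E \<times> E"]) (use D_E fin in auto)

lemma wf_D: "wf D"
  by (rule finite_acyclic_wf[OF finite_D acyclic_D])

lemma pv_bef: "e \<in> E \<Longrightarrow> pv e \<in> E \<Longrightarrow> bef (pv e) e"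
  using bef_pv by blast

lemma pv_loc: "e \<in> E \<Longrightarrow> pv e \<in> E \<Longrightarrow> loc (pv e) = loc e"
  using pv_bef bef_loc by blast

lemma pv_D: "e \<in> E \<Longrightarrow> pv e \<in> E \<Longrightarrow> (pv e, e) \<in> D"
  by (auto simp: D_def)

lemma m_D: "(z, y) \<in> m \<Longrightarrow> (z, y) \<in> D"
  by (auto simp: D_def)

lemma D_iff: "(x, e) \<in> D \<longleftrightarrow> (x = pv e \<and> e \<in> E \<and> pv e \<in> E) \<or> (x, e) \<in> m"
  by (auto simp: D_def)

lemma bef_lt:
  assumes "e \<in> E" "f \<in> E" "bef f e"
  shows "(f, e) \<in> D\<^sup>+"
  using wf_D assms
proof (induction e rule: wf_induct_rule)
  case (less e)
  then have pv: "pv e \<in> E" "f = pv e \<or> bef f (pv e)" using bef_pv by blast+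
  then have "(pv e, e) \<in> D" using less.prems by (simp add: pv_D)
  with pv less show ?case by (metis r_into_trancl trancl_into_trancl)
qed

lemma bef_le: "e \<in> E \<Longrightarrow> f \<in> E \<Longrightarrow> bef f e \<Longrightarrow> (f, e) \<in> D\<^sup>*"
  using bef_lt by (simp add: trancl_into_rtrancl)

lemma lt_imp_bef:
  assumes "(f, e) \<in> D\<^sup>+" "loc f = loc e"
  shows "bef f e"
proof -
  have E: "f \<in> E" "e \<in> E" using assms lt_E by auto
  then consider "f = e" | "bef f e" | "bef e f" using bef_total assms by blast
  then show ?thesis
    using E assms lt_irrefl bef_lt by cases (auto dest: trancl_trans)
qed

lemma le_imp_bef: "(f, e) \<in> D\<^sup>* \<Longrightarrow> loc f = loc e \<Longrightarrow> f = e \<or> bef f e"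
  using lt_imp_bef by (metis rtranclD)

lemma bef_asym: "bef e f \<Longrightarrow> \<not> bef f e"
  using bef_irrefl bef_trans by blast

lemma bef_max:
  assumes "A \<subseteq> E" "A \<noteq> {}" "\<And>f. f \<in> A \<Longrightarrow> loc f = q"
  obtains f where "f \<in> A" "\<And>g. g \<in> A \<Longrightarrow> g = f \<or> bef g f"
proof -
  have "finite A" using assms fin finite_subset by blast
  from this assms(2,1,3) have "\<exists>f\<in>A. \<forall>g\<in>A. g = f \<or> bef g f"
  proof (induction rule: finite_ne_induct)
    case (insert x F)
    then obtain f where f: "f \<in> F" "\<And>g. g \<in> F \<Longrightarrow> g = f \<or> bef g f" by auto
    have "x = f \<or> bef x f \<or> bef f x"
      using insert.prems f bef_total[of x f] by auto
    then show ?case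
    proof (elim disjE)
      assume "bef f x"
      then have "\<And>g. g \<in> insert x F \<Longrightarrow> g = x \<or> bef g x" using f bef_trans by blast
      then show ?thesis by blast
    qed (use f in blast)+
  qed simp
  then show thesis using that by blast
qed

text \<open>A local equation has only one solution, because \<open>D\<close> is well-founded. This
  is why labels that are merely guessed are forced to tell the truth.\<close>

lemma propagate:
  assumes X: "\<And>e. e \<in> E \<Longrightarrow> X e \<longleftrightarrow> B e \<or> pv e \<in> E \<and> X (pv e) \<or> (\<exists>z. (z, e) \<in> m \<and> X z)"
    and "e \<in> E"
  shows "X e \<longleftrightarrow> (\<exists>f\<in>E. (f, e) \<in> D\<^sup>* \<and> B f)"
  using wf_D \<open>e \<in> E\<close>
proof (induction e rule: wf_induct_rule)
  case (less e)
  have "X e \<longleftrightarrow> B e \<or> (\<exists>z. (z, e) \<in> D \<and> X z)"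
    using X[OF less.prems] less.prems by (auto simp: D_iff)
  also have "\<dots> \<longleftrightarrow> B e \<or> (\<exists>z. (z, e) \<in> D \<and> (\<exists>f\<in>E. (f, z) \<in> D\<^sup>* \<and> B f))"
    using less D_E by blast
  also have "\<dots> \<longleftrightarrow> (\<exists>f\<in>E. (f, e) \<in> D\<^sup>* \<and> B f)"
    using less.prems by (metis rtrancl.simps)
  finally show ?case .
qed

text \<open>The immediate predecessors of e lie on different processes, so at most one of them is in
  \<open>A\<close>. If the strict past contains an element of \<open>A\<close> that is not the
  first, it contains two elements, one of which is not adjacent to e. Otherwise only the first
  element of \<open>A\<close> is in the strict past, and it must not be adjacent itself.\<close>

lemma not_adjacent_iff:
  assumes A: "A \<subseteq> E" "\<And>f. f \<in> A \<Longrightarrow> loc f = q" and e: "e \<in> E"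
  shows "(\<exists>f\<in>A. (f, e) \<in> D\<^sup>+ \<and> (f, e) \<notin> D) \<longleftrightarrow>
    (\<exists>z. (z, e) \<in> D \<and> (\<exists>f\<in>A. (f, z) \<in> D\<^sup>* \<and> (\<exists>g\<in>A. bef g f))) \<or>
    (\<exists>z. (z, e) \<in> D \<and> (\<exists>f\<in>A. (f, z) \<in> D\<^sup>*)) \<and> (\<forall>z. (z, e) \<in> D \<longrightarrow> z \<notin> A)"
    (is "?L \<longleftrightarrow> ?S \<or> ?F \<and> ?N")
proof
  assume ?L
  then obtain f where f: "f \<in> A" "(f, e) \<in> D\<^sup>+" "(f, e) \<notin> D" by blast
  obtain z where z: "(f, z) \<in> D\<^sup>*" "(z, e) \<in> D" using f(2) by (meson tranclD2)
  show "?S \<or> ?F \<and> ?N"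
  proof (cases ?N)
    case True then show ?thesis using f z by blast
  next
    case False
    then obtain g where g: "g \<in> A" "(g, e) \<in> D" by blast
    then have "bef f g \<or> bef g f" using f A bef_total by (metis subsetD)
    then show ?thesis using f g z by blast
  qed
next
  assume "?S \<or> ?F \<and> ?N"
  then show ?L
  proof
    assume ?S
    then obtain z f g where *: "(z, e) \<in> D" "f \<in> A" "(f, z) \<in> D\<^sup>*" "g \<in> A" "bef g f" by blast
    then have f: "(f, e) \<in> D\<^sup>+" by simp
    have g: "(g, e) \<in> D\<^sup>+" using * A bef_lt f by (meson subsetD trancl_trans)
    have "(f, e) \<notin> D \<or> (g, e) \<notin> D"
    proof (rule ccontr)
      assume "\<not> ?thesis"
      then have "f = g"
        using m_inj m_E pv_loc e * A unfolding D_iff by metis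
      then show False using * bef_irrefl by blast
    qed
    then show ?L using f g * by blast
  next
    assume "?F \<and> ?N"
    then show ?L by (meson rtrancl_into_trancl1)
  qed
qed

subsection \<open>Causality along sequences of processes\<close>

text \<open>The sequence is read backwards from x: its head is the process of x, its last entry that
  of f. Moving along a process costs nothing, so that each further entry stands for one
  message.\<close>

fun reach :: "'q list \<Rightarrow> 'e \<Rightarrow> 'e \<Rightarrow> bool" where
  "reach [] f x \<longleftrightarrow> False"
| "reach [r] f x \<longleftrightarrow> x \<in> E \<and> loc x = r \<and> f \<in> E \<and> (f = x \<or> bef f x)"
| "reach (r # s # \<rho>) f x \<longleftrightarrow> x \<in> E \<and> loc x = r \<and>
    (\<exists>y\<in>E. \<exists>z. (y = x \<or> bef y x) \<and> (z, y) \<in> m \<and> reach (s # \<rho>) f z)"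

lemma reach_loc: "reach \<rho> f x \<Longrightarrow> x \<in> E \<and> f \<in> E \<and> \<rho> \<noteq> [] \<and> loc x = hd \<rho> \<and> loc x \<in> set \<rho>"
  by (induction \<rho> f x rule: reach.induct) auto

lemma reach_mono:
  assumes "reach \<rho> f x" "x = x' \<or> bef x x'" "x' \<in> E"
  shows "reach \<rho> f x'"
proof (cases "(\<rho>, f, x)" rule: reach.cases)
  case (2 r f x) then show ?thesis using assms bef_trans bef_loc by auto
next
  case (3 r s \<rho> f x) then show ?thesis using assms bef_trans bef_loc by auto
qed (use assms in auto)

lemma reach_le: "reach \<rho> f x \<Longrightarrow> (f, x) \<in> D\<^sup>*"
proof (induction \<rho> f x rule: reach.induct)
  case (3 r s \<rho> f x)
  then obtain y z where "y \<in> E" "y = x \<or> bef y x" "(z, y) \<in> m" "(f, z) \<in> D\<^sup>*" "x \<in> E" by auto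
  then have "(f, y) \<in> D\<^sup>*" "(y, x) \<in> D\<^sup>*" using m_D bef_le by (auto intro: rtrancl_into_rtrancl)
  then show ?case by (rule rtrancl_trans)
qed (auto intro: bef_le)

lemma reach_suffix:
  "reach \<rho> f x \<Longrightarrow> r \<in> set \<rho> \<Longrightarrow>
    \<exists>\<rho>\<^sub>1 \<rho>\<^sub>2 y. \<rho> = \<rho>\<^sub>1 @ r # \<rho>\<^sub>2 \<and> reach (r # \<rho>\<^sub>2) f y \<and> (y, x) \<in> D\<^sup>*"
proof (induction \<rho> f x rule: reach.induct)
  case (2 s f x)
  then show ?case by (intro exI[of _ "[]"] exI[of _ x]) auto
next
  case (3 t s \<rho> f x)
  show ?case
  proof (cases "r = t")
    case True
    then show ?thesis using 3 by (intro exI[of _ "[]"] exI[of _ "s # \<rho>"] exI[of _ x]) auto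
  next
    case False
    from 3 obtain y z where yz: "y \<in> E" "y = x \<or> bef y x" "(z, y) \<in> m" "reach (s # \<rho>) f z" "x \<in> E"
      by auto
    then have "(z, y) \<in> D\<^sup>*" "(y, x) \<in> D\<^sup>*" using m_D bef_le by auto
    then have zx: "(z, x) \<in> D\<^sup>*" by simp
    from 3 False yz obtain \<rho>1 \<rho>2 w where "s # \<rho> = \<rho>1 @ r # \<rho>2" "reach (r # \<rho>2) f w" "(w, z) \<in> D\<^sup>*"
      by fastforce
    then show ?thesis using zx
      by (intro exI[of _ "t # \<rho>1"] exI[of _ \<rho>2] exI[of _ w]) (auto intro: rtrancl_trans)
  qed
qed auto

text \<open>A process visited twice is left only after its last visit, so the sequence can be taken distinct.\<close>

lemma le_reach:
  assumes "(f, x) \<in> D\<^sup>*" "x \<in> E"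
  shows "\<exists>\<rho>. distinct \<rho> \<and> set \<rho> \<subseteq> loc ` E \<and> reach \<rho> f x"
  using assms
proof (induction rule: rtrancl_induct)
  case base
  then show ?case by (intro exI[of _ "[loc f]"]) auto
next
  case (step y z)
  then obtain \<rho> where \<rho>: "distinct \<rho>" "set \<rho> \<subseteq> loc ` E" "reach \<rho> f y" using D_E by blast
  show ?case
  proof (cases "(y, z) \<in> m")
    case False
    then have "bef y z" using step pv_bef by (auto simp: D_iff)
    then show ?thesis using \<rho> reach_mono step by blast
  next
    case m: True
    show ?thesis
    proof (cases "loc z \<in> set \<rho>")
      case True
      then obtain \<rho>1 \<rho>2 w where w: "\<rho> = \<rho>1 @ loc z # \<rho>2" "reach (loc z # \<rho>2) f w" "(w, y) \<in> D\<^sup>*"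
        using reach_suffix \<rho> by blast
      then have "(w, z) \<in> D\<^sup>*" using step by simp
      then have "w = z \<or> bef w z" using le_imp_bef reach_loc[OF w(2)] by simp
      then have "reach (loc z # \<rho>2) f z" using reach_mono w step by blast
      then show ?thesis using w \<rho> by (intro exI[of _ "loc z # \<rho>2"]) auto
    next
      case False
      obtain s \<rho>' where "\<rho> = s # \<rho>'" using reach_loc[OF \<rho>(3)] by (cases \<rho>) auto
      then have "reach (loc z # \<rho>) f z" using \<rho> m step by auto
      then show ?thesis using False \<rho> step by (intro exI[of _ "loc z # \<rho>"]) auto
    qed
  qed
qed

lemma reach_single_step:
  assumes "x \<in> E"
  shows "reach [loc x] f x \<longleftrightarrow> f = x \<or> pv x \<in> E \<and> reach [loc x] f (pv x)"
  using assms bef_pv pv_loc by auto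

text \<open>This is where the channels being FIFO matters.\<close>

lemma reach_step:
  assumes x: "x \<in> E"
  shows "reach (loc x # s # \<rho>) f x \<longleftrightarrow>
    (if \<exists>z. (z, x) \<in> m \<and> loc z = s then \<exists>z. (z, x) \<in> m \<and> reach (s # \<rho>) f z
     else pv x \<in> E \<and> reach (loc x # s # \<rho>) f (pv x))"
proof (cases "\<exists>z. (z, x) \<in> m \<and> loc z = s")
  case True
  then obtain z where z: "(z, x) \<in> m" "loc z = s" by blast
  have "reach (s # \<rho>) f z" if "reach (loc x # s # \<rho>) f x"
  proof -
    from that obtain y' z' where y': "y' = x \<or> bef y' x" "(z', y') \<in> m" "reach (s # \<rho>) f z'" by auto
    \<comment> \<open>The path may arrive through an earlier message from s. By \<open>fifo\<close>,
      that message was not sent after z, so the path can stay on s until z and use the latest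
      message instead.\<close>
    then have "z' = z \<or> bef z' z"
      using m_inj fifo z reach_loc[OF y'(3)] by (metis list.sel(1))
    then show ?thesis using reach_mono[OF y'(3)] m_E[OF z(1)] by blast
  qed
  then show ?thesis using True z x m_inj by auto
next
  case False
  have "reach (loc x # s # \<rho>) f x \<longleftrightarrow>
     (\<exists>y\<in>E. \<exists>z. bef y x \<and> (z, y) \<in> m \<and> reach (s # \<rho>) f z)"
    using False x reach_loc by fastforce
  also have "\<dots> \<longleftrightarrow> pv x \<in> E \<and> reach (loc x # s # \<rho>) f (pv x)"
    using x bef_pv pv_loc by auto
  finally show ?thesis unfolding if_not_P[OF False] .
qed

text \<open>
  A value attached to the elements of \<open>A\<close> and passed on along \<open>\<rho>\<close> is that of the latest
  element of \<open>A\<close> that reaches \<open>x\<close> along \<open>\<rho>\<close>.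
\<close>

lemma token:
  assumes A: "A \<subseteq> E" "\<And>f. f \<in> A \<Longrightarrow> loc f = q"
    and S: "\<And>r s \<rho>. r # s # \<rho> \<in> S \<Longrightarrow> s # \<rho> \<in> S"
    and T1: "\<And>x. x \<in> E \<Longrightarrow> [loc x] \<in> S \<Longrightarrow> x \<notin> A \<Longrightarrow>
      tok [loc x] x = (if pv x \<in> E then tok [loc x] (pv x) else {})"
    and T2: "\<And>x s \<rho> z. x \<in> E \<Longrightarrow> loc x # s # \<rho> \<in> S \<Longrightarrow> (z, x) \<in> m \<Longrightarrow> loc z = s \<Longrightarrow>
      tok (loc x # s # \<rho>) x = tok (s # \<rho>) z"
    and T3: "\<And>x s \<rho>. x \<in> E \<Longrightarrow> loc x # s # \<rho> \<in> S \<Longrightarrow> \<not> (\<exists>z. (z, x) \<in> m \<and> loc z = s) \<Longrightarrow>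
      tok (loc x # s # \<rho>) x = (if pv x \<in> E then tok (loc x # s # \<rho>) (pv x) else {})"
    and \<rho>: "\<rho> \<in> S" "\<rho> \<noteq> []" "hd \<rho> = loc x" "x \<in> E"
  shows "(\<forall>f\<in>A. \<not> reach \<rho> f x) \<and> tok \<rho> x = {} \<or>
    (\<exists>f\<in>A. reach \<rho> f x \<and> (\<forall>g\<in>A. reach \<rho> g x \<longrightarrow> g = f \<or> bef g f) \<and> tok \<rho> x = tok [q] f)"
  using \<rho>
proof (induction \<rho> arbitrary: x rule: induct_list012)
  case (2 r)
  from wf_D 2 show ?case
  proof (induction x rule: wf_induct_rule)
    case (less x)
    show ?case
    proof (cases "x \<in> A")
      case True
      \<comment> \<open>T1 leaves the value on \<open>A\<close> free; it is this value that the
        other events pass on.\<close>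
      then show ?thesis using less.prems A by (intro disjI2 bexI[of _ x]) auto
    next
      case False
      have r: "r = loc x" using less by simp
      have step: "reach [r] f x \<longleftrightarrow> pv x \<in> E \<and> reach [r] f (pv x)" if "f \<in> A" for f
        using reach_single_step[of x f] less.prems that False r by auto
      show ?thesis
      proof (cases "pv x \<in> E")
        case True
        then have "(pv x, x) \<in> D" "hd [r] = loc (pv x)"
          using less.prems pv_loc by (auto simp: pv_D)
        from less.IH[OF this(1) less.prems(1,2) this(2) True]
        show ?thesis using step True T1[of x] less.prems False r by auto
      next
        case pv: False
        then show ?thesis using step T1[of x] less.prems False r by auto
      qed
    qed
  qed
next
  case (3 r s \<rho>)
  from wf_D 3(3-) show ?case
  proof (induction x rule: wf_induct_rule)
    case (less x)
    have r: "r = loc x" using less by simp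
    show ?case
    proof (cases "\<exists>z. (z, x) \<in> m \<and> loc z = s")
      case True
      then obtain z where z: "(z, x) \<in> m" "loc z = s" by blast
      have "reach (r # s # \<rho>) f x \<longleftrightarrow> reach (s # \<rho>) f z" for f
        using reach_step[of x s \<rho> f] True z m_inj r less.prems by auto
      moreover have "tok (r # s # \<rho>) x = tok (s # \<rho>) z" using T2 z less.prems r by blast
      ultimately show ?thesis using 3(2)[of z] S less.prems z m_E by auto
    next
      case False
      have step: "reach (r # s # \<rho>) f x \<longleftrightarrow> pv x \<in> E \<and> reach (r # s # \<rho>) f (pv x)" for f
        using reach_step[of x s \<rho> f] False r less.prems by auto
      have T: "tok (r # s # \<rho>) x = (if pv x \<in> E then tok (r # s # \<rho>) (pv x) else {})"
        using T3 False less.prems r by blast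
      show ?thesis
      proof (cases "pv x \<in> E")
        case True
        then have "(pv x, x) \<in> D" "hd (r # s # \<rho>) = loc (pv x)"
          using less.prems pv_loc by (auto simp: pv_D)
        from less.IH[OF this(1) less.prems(1,2) this(2) True]
        show ?thesis using step True T by auto
      next
        case pv: False
        then show ?thesis using step T by auto
      qed
    qed
  qed
qed auto

text \<open>The counterpart of \<open>propagate\<close> for the opposite direction: the intended
  meaning solves the local equations.\<close>

lemma propagate_step:
  assumes "e \<in> E"
  shows "(\<exists>f\<in>A. (f, e) \<in> D\<^sup>* \<and> B f) \<longleftrightarrow> e \<in> A \<and> B e \<or>
    (\<exists>f\<in>A. pv e \<in> E \<and> (f, pv e) \<in> D\<^sup>* \<and> B f) \<or> (\<exists>z. (z, e) \<in> m \<and> (\<exists>f\<in>A. (f, z) \<in> D\<^sup>* \<and> B f))"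
proof -
  have "(f, e) \<in> D\<^sup>* \<longleftrightarrow> f = e \<or> (\<exists>z. (f, z) \<in> D\<^sup>* \<and> (z, e) \<in> D)" for f
    by (metis rtrancl.simps)
  then show ?thesis using assms by (auto simp: D_iff)
qed

text \<open>The path from f to \<open>pv e\<close> may visit other processes, but f and e lie on the
  same one and are therefore ordered there. So it can be seen at the preceding position whether e is
  the first element of \<open>A\<close>.\<close>

lemma nonfirst_iff:
  assumes A: "A \<subseteq> E" "\<And>f. f \<in> A \<Longrightarrow> loc f = q" and e: "e \<in> A"
  shows "(\<exists>f\<in>A. pv e \<in> E \<and> (f, pv e) \<in> D\<^sup>*) \<longleftrightarrow> (\<exists>g\<in>A. bef g e)"
proof
  assume "\<exists>f\<in>A. pv e \<in> E \<and> (f, pv e) \<in> D\<^sup>*"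
  then obtain f where f: "f \<in> A" "pv e \<in> E" "(f, pv e) \<in> D\<^sup>*" by blast
  then have "(f, e) \<in> D\<^sup>+" using pv_D e A by (meson rtrancl_into_trancl1 subsetD)
  then show "\<exists>g\<in>A. bef g e" using lt_imp_bef f A e by blast
next
  assume "\<exists>g\<in>A. bef g e"
  then obtain g where g: "g \<in> A" "bef g e" by blast
  then have "pv e \<in> E \<and> (g = pv e \<or> bef g (pv e))" using bef_pv A e by blast
  then show "\<exists>f\<in>A. pv e \<in> E \<and> (f, pv e) \<in> D\<^sup>*" using g bef_le A by blast
qed

text \<open>The element whose value a token carries according to \<open>token\<close>. The following
  lemmas show that it obeys the rules T1 to T3, so that a colour defined by it is passed on
  correctly.\<close>

definition latest :: "'e set \<Rightarrow> 'q list \<Rightarrow> 'e \<Rightarrow> 'e \<Rightarrow> bool" where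
  "latest A \<rho> x f \<longleftrightarrow> f \<in> A \<and> reach \<rho> f x \<and> (\<forall>g\<in>A. reach \<rho> g x \<longrightarrow> g = f \<or> bef g f)"

lemma latest_self: "x \<in> A \<Longrightarrow> A \<subseteq> E \<Longrightarrow> latest A [loc x] x f \<longleftrightarrow> f = x"
  unfolding latest_def using bef_asym by auto

lemma latest_pv: "x \<in> E \<Longrightarrow> x \<notin> A \<Longrightarrow>
    latest A [loc x] x f \<longleftrightarrow> pv x \<in> E \<and> latest A [loc x] (pv x) f"
  unfolding latest_def using reach_single_step by (metis reach_loc)

lemma latest_m:
  assumes "(z, x) \<in> m" "loc z = s"
  shows "latest A (loc x # s # \<rho>) x f \<longleftrightarrow> latest A (s # \<rho>) z f"
proof -
  have "reach (loc x # s # \<rho>) f x \<longleftrightarrow> reach (s # \<rho>) f z" for f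
    using reach_step[of x s \<rho> f] assms m_E m_inj by metis
  then show ?thesis by (simp add: latest_def)
qed

lemma latest_other:
  assumes "x \<in> E" "\<not> (\<exists>z. (z, x) \<in> m \<and> loc z = s)"
  shows "latest A (loc x # s # \<rho>) x f \<longleftrightarrow> pv x \<in> E \<and> latest A (loc x # s # \<rho>) (pv x) f"
proof -
  have "reach (loc x # s # \<rho>) f x \<longleftrightarrow> pv x \<in> E \<and> reach (loc x # s # \<rho>) f (pv x)" for f
    using reach_step[of x s \<rho> f] assms by simp
  then show ?thesis by (auto simp: latest_def)
qed

lemma latest_mono:
  assumes "latest A \<rho> x f" "x = y \<or> bef x y" "y \<in> E" "latest A \<rho> y g"
  shows "f = g \<or> bef f g"
  using assms reach_mono unfolding latest_def by blast

subsection \<open>Paths through chains\<close>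

text \<open>The path runs through a maximal chain containing \<open>C\<close>.\<close>

lemma chain_path:
  assumes C: "C \<subseteq> E" "\<And>x y. x \<in> C \<Longrightarrow> y \<in> C \<Longrightarrow> (x, y) \<in> D\<^sup>* \<or> (y, x) \<in> D\<^sup>*"
    and a: "a \<in> C" "\<And>c. c \<in> C \<Longrightarrow> (a, c) \<in> D\<^sup>*"
  shows "\<exists>R\<subseteq>D. single_valued R \<and> (\<forall>x y. (x, y) \<in> R \<longrightarrow> x = a \<or> (\<exists>w. (w, x) \<in> R)) \<and>
    (\<forall>c\<in>C. c = a \<or> (\<exists>w. (w, c) \<in> R))"
proof -
  define chain where "chain K \<longleftrightarrow> C \<subseteq> K \<and> K \<subseteq> E \<and> (\<forall>x\<in>K. \<forall>y\<in>K. (x, y) \<in> D\<^sup>* \<or> (y, x) \<in> D\<^sup>*) \<and>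
    (\<forall>c\<in>K. (a, c) \<in> D\<^sup>*)" for K
  have 1: "chain C" using C a by (simp add: chain_def)
  have 2: "\<forall>K. chain K \<longrightarrow> card K < Suc (card E)" using fin by (simp add: chain_def card_mono less_Suc_eq_le)
  obtain K where "chain K" and mx: "\<forall>K'. chain K' \<longrightarrow> card K' \<le> card K"
    using ex_has_greatest_nat[of chain, OF 1 2] by blast
  note K = \<open>chain K\<close>[unfolded chain_def]
  have "finite K" using K fin finite_subset by blast
  \<comment> \<open>The covering relation of the maximal chain K.\<close>
  define R where "R = {(x, y). x \<in> K \<and> y \<in> K \<and> (x, y) \<in> D\<^sup>+ \<and>
      (\<forall>z\<in>K. (x, z) \<in> D\<^sup>+ \<longrightarrow> (z, y) \<notin> D\<^sup>+)}"
  have "R \<subseteq> D"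
  proof safe
    fix x y assume xy: "(x, y) \<in> R"
    then have "(x, y) \<in> D\<^sup>+" by (simp add: R_def)
    then obtain z where z: "(x, z) \<in> D" "(z, y) \<in> D\<^sup>*" by (meson tranclD)
    show "(x, y) \<in> D"
    proof (rule ccontr)
      \<comment> \<open>Then the first edge of a path from x to y ends in some z strictly between
        them. All of K lies below x or above y, so z could be added to K, against its
        maximality.\<close>
      assume "(x, y) \<notin> D"
      then have zy: "(z, y) \<in> D\<^sup>+" using z by (metis rtranclD)
      have xz: "(x, z) \<in> D\<^sup>+" using z by blast
      have "z \<notin> K" using xy xz zy by (auto simp: R_def)
      have cmp: "(c, x) \<in> D\<^sup>* \<or> (y, c) \<in> D\<^sup>*" if "c \<in> K" for c
      proof (rule ccontr)
        assume n: "\<not> ?thesis"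
        moreover have "x \<in> K" "y \<in> K" using xy by (auto simp: R_def)
        ultimately have "(x, c) \<in> D\<^sup>*" "(c, y) \<in> D\<^sup>*" "x \<noteq> c" "c \<noteq> y" using K that by blast+
        then have "(x, c) \<in> D\<^sup>+" "(c, y) \<in> D\<^sup>+" by (simp_all add: rtrancl_eq_or_trancl)
        then show False using xy that by (auto simp: R_def)
      qed
      have "(c, z) \<in> D\<^sup>* \<or> (z, c) \<in> D\<^sup>*" if "c \<in> K" for c
        using cmp[OF that] xz z by (meson rtrancl_trans trancl_into_rtrancl)
      moreover have "(a, z) \<in> D\<^sup>*"
      proof -
        have "x \<in> K" using xy by (auto simp: R_def)
        then have "(a, x) \<in> D\<^sup>*" using K by blast
        then show ?thesis using z by (meson rtrancl.rtrancl_into_rtrancl)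
      qed
      moreover have "z \<in> E" using z D_E by blast
      ultimately have "chain (insert z K)" using K by (auto simp: chain_def)
      with mx have "card (insert z K) \<le> card K" by blast
      then show False using \<open>z \<notin> K\<close> \<open>finite K\<close> by simp
    qed
  qed
  moreover have "single_valued R"
  proof (rule single_valuedI)
    fix x y y' assume "(x, y) \<in> R" "(x, y') \<in> R"
    then have "x \<in> K" "y \<in> K" "y' \<in> K" "(x, y) \<in> D\<^sup>+" "(x, y') \<in> D\<^sup>+"
      and "(y, y') \<notin> D\<^sup>+" "(y', y) \<notin> D\<^sup>+" by (auto simp: R_def)
    with K show "y = y'" by (auto simp: rtrancl_eq_or_trancl)
  qed
  moreover have pre: "x = a \<or> (\<exists>w. (w, x) \<in> R)" if x: "x \<in> K" for x
  proof (cases "x = a")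
    case False
    \<comment> \<open>A maximal element of this set is covered by x.\<close>
    let ?W = "{w\<in>K. (w, x) \<in> D\<^sup>+}"
    have "(a, x) \<in> D\<^sup>+" using K x False by (metis rtranclD)
    then have aW: "a \<in> ?W" using K a by blast
    have wf: "wf ((D\<inverse>)\<^sup>+)"
      by (intro wf_trancl finite_acyclic_wf_converse finite_D acyclic_D)
    obtain w where w: "w \<in> ?W" "\<And>y. (y, w) \<in> (D\<inverse>)\<^sup>+ \<Longrightarrow> y \<notin> ?W"
      by (rule wfE_min[OF wf aW]) (rule that)
    then have "(w, x) \<in> R" using x unfolding R_def by (auto simp: trancl_converse)
    then show ?thesis by blast
  qed simp
  moreover have "x \<in> K" if "(x, y) \<in> R" for x y using that by (simp add: R_def)
  ultimately show ?thesis
    using K by (intro exI[of _ R]) blast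
qed

end

subsection \<open>Colouring chains of pairs\<close>

text \<open>
  Let \<open>g u\<close> be the least right end of a pair starting at \<open>u\<close> or later. The number of
  applications of \<open>g\<close> possible from \<open>u\<close> drops by one or two along each pair.
\<close>

lemma chain_colouring:
  fixes R :: "(nat \<times> nat) set"
  assumes fin: "finite R" and lt: "\<And>u v. (u, v) \<in> R \<Longrightarrow> u < v"
    and ch: "\<And>u v u' v'. (u, v) \<in> R \<Longrightarrow> (u', v') \<in> R \<Longrightarrow> u < u' \<Longrightarrow> v \<le> v'"
  shows "\<exists>\<chi>. (\<forall>u. \<chi> u < (3::nat)) \<and> (\<forall>(u, v)\<in>R. \<chi> u \<noteq> \<chi> v)"
proof -
  obtain N where N: "\<And>u v. (u, v) \<in> R \<Longrightarrow> v < N"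
    using finite_nat_set_iff_bounded[of "snd ` R"] fin by fastforce
  define ex where "ex u \<longleftrightarrow> (\<exists>u' v. (u', v) \<in> R \<and> u \<le> u')" for u
  define g where "g u = (LEAST v. \<exists>u'. (u', v) \<in> R \<and> u \<le> u')" for u
  have g: "\<exists>u'. (u', g u) \<in> R \<and> u \<le> u'" if "ex u" for u
    unfolding g_def by (rule LeastI_ex) (use that ex_def in blast)
  have g_le: "g u \<le> v" if "(u', v) \<in> R" "u \<le> u'" for u u' v
    using that unfolding g_def by (intro Least_le) blast
  have g_gt: "u < g u" "g u < N" if "ex u" for u
    using g[OF that] lt N by fastforce+
  define lv where "lv = (\<lambda>u. (LEAST n. \<not> ex ((g ^^ n) u)))"
  have bd: "\<exists>n. \<not> ex ((g ^^ n) u)" for u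
  proof (rule ccontr)
    assume "\<not> ?thesis"
    then have *: "ex ((g ^^ n) u)" for n by blast
    have "n \<le> (g ^^ n) u" for n
    proof (induction n)
      case (Suc n) then show ?case using g_gt(1)[OF *[of n]] by simp
    qed simp
    from this[of "Suc N"] g_gt(2)[OF *[of N]] show False by simp
  qed
  have lv0: "lv u = 0" if "\<not> ex u" for u
    unfolding lv_def by (rule Least_equality) (use that in auto)
  have lvS: "lv u = Suc (lv (g u))" if "ex u" for u
  proof -
    obtain n where "\<not> ex ((g ^^ n) u)" using bd by blast
    from Least_Suc[of "\<lambda>n. \<not> ex ((g ^^ n) u)", OF this] that show ?thesis
      unfolding lv_def by (simp add: funpow_Suc_right del: funpow.simps(2))
  qed
  have ex_mono: "ex u" if "ex v" "u \<le> v" for u v using that unfolding ex_def by (meson le_trans)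
  have g_mono: "g u \<le> g v" if "ex v" "u \<le> v" for u v
    using g[OF that(1)] g_le that by (meson le_trans)
  have lv_mono: "lv v \<le> lv u" if "u \<le> v" for u v
    using that
  proof (induction "lv u" arbitrary: u v rule: less_induct)
    case less
    show ?case
    proof (cases "ex v")
      case True
      then have u: "ex u" using less ex_mono by blast
      show ?thesis using less(1)[of "g u" "g v"] g_mono[OF True less(2)] lvS u True by simp
    qed (simp add: lv0)
  qed
  have "lv u mod 3 \<noteq> lv v mod 3" if uv: "(u, v) \<in> R" for u v
  proof -
    have u: "ex u" using uv unfolding ex_def by blast
    \<comment> \<open>As g u \<le> v, the level drops by at least one from u to v. The next step
      bounds the drop by two, so the levels of u and v differ modulo 3.\<close>
    have "lv v \<le> lv (g u)" by (rule lv_mono[OF g_le[OF uv]]) simp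
    moreover have "lv (g u) \<le> Suc (lv v)"
    proof (cases "ex (g u)")
      case True
      \<comment> \<open>This pair starts at g u or later, hence after u, and by \<open>ch\<close> it
        does not end before v. So two applications of g lead from u at least as far as v.\<close>
      obtain u' where u': "(u', g (g u)) \<in> R" "g u \<le> u'" using g[OF True] by blast
      then have "v \<le> g (g u)" using ch[OF uv u'(1)] g_gt(1)[OF u] by simp
      then show ?thesis using lv_mono lvS[OF True] by simp
    qed (simp add: lv0)
    ultimately have "lv u = Suc (lv v) \<or> lv u = Suc (Suc (lv v))" using lvS[OF u] by linarith
    then show ?thesis by (elim disjE) (simp_all add: mod_Suc)
  qed
  then show ?thesis by (intro exI[of _ "\<lambda>u. lv u mod 3"]) auto
qed

declare split_paired_All [simp del] split_paired_Ex [simp del]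

section \<open>Types of events\<close>

text \<open>
  A formula with two variables is evaluated at a pair of events from their unary types and the
  relation between them. The variable \<open>x\<close> stands for the event of type \<open>\<tau>\<close>, the other variable for
  the event of type \<open>\<tau>\<^sub>0\<close>, and \<open>\<eta>\<close> is the relation of the latter to the former, see \<open>rel\<close> below.
  Types contain the codes of formulas, with the variable of an atom normalised to 0. As membership
  in the quantified sets is part of the type, second-order quantifiers are skipped.
\<close>

primrec ev :: "(nat, nat) fm \<Rightarrow> nat \<Rightarrow> nat \<Rightarrow> nat \<Rightarrow> nat \<Rightarrow> bool" where
  "ev (Proc p u) x \<tau>\<^sub>0 \<tau> \<eta> \<longleftrightarrow> fm_code (Proc p 0) \<in> set_decode (if u = x then \<tau> else \<tau>\<^sub>0)"
| "ev (Letter a u) x \<tau>\<^sub>0 \<tau> \<eta> \<longleftrightarrow> fm_code (Letter a 0) \<in> set_decode (if u = x then \<tau> else \<tau>\<^sub>0)"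
| "ev (Mem u X) x \<tau>\<^sub>0 \<tau> \<eta> \<longleftrightarrow> fm_code (Mem 0 X) \<in> set_decode (if u = x then \<tau> else \<tau>\<^sub>0)"
| "ev (Eq u v) x \<tau>\<^sub>0 \<tau> \<eta> \<longleftrightarrow> u = v \<or> \<eta> = 0"
| "ev (Succ u v) x \<tau>\<^sub>0 \<tau> \<eta> \<longleftrightarrow> u \<noteq> v \<and> \<eta> = (if v = x then 1 else 2)"
| "ev (Msg u v) x \<tau>\<^sub>0 \<tau> \<eta> \<longleftrightarrow> u \<noteq> v \<and> \<eta> = (if v = x then 3 else 4)"
| "ev (Le u v) x \<tau>\<^sub>0 \<tau> \<eta> \<longleftrightarrow> u = v \<or> \<eta> = 0 \<or>
     (if v = x then \<eta> = 1 \<or> \<eta> = 3 \<or> \<eta> = 5 else \<eta> = 2 \<or> \<eta> = 4 \<or> \<eta> = 6)"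
| "ev (Or \<phi> \<psi>) x \<tau>\<^sub>0 \<tau> \<eta> \<longleftrightarrow> ev \<phi> x \<tau>\<^sub>0 \<tau> \<eta> \<or> ev \<psi> x \<tau>\<^sub>0 \<tau> \<eta>"
| "ev (Neg \<phi>) x \<tau>\<^sub>0 \<tau> \<eta> \<longleftrightarrow> \<not> ev \<phi> x \<tau>\<^sub>0 \<tau> \<eta>"
| "ev (Ex u \<phi>) x \<tau>\<^sub>0 \<tau> \<eta> \<longleftrightarrow> fm_code (Ex u \<phi>) \<in> set_decode (if 1 - u = x then \<tau> else \<tau>\<^sub>0)"
| "ev (ExSet X \<phi>) x \<tau>\<^sub>0 \<tau> \<eta> \<longleftrightarrow> ev \<phi> x \<tau>\<^sub>0 \<tau> \<eta>"

primrec cl :: "(nat, nat) fm \<Rightarrow> nat set" where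
  "cl (Proc p u) = {fm_code (Proc p 0)}"
| "cl (Letter a u) = {fm_code (Letter a 0)}"
| "cl (Mem u X) = {fm_code (Mem 0 X)}"
| "cl (Eq u v) = {}"
| "cl (Succ u v) = {}"
| "cl (Msg u v) = {}"
| "cl (Le u v) = {}"
| "cl (Or \<phi> \<psi>) = cl \<phi> \<union> cl \<psi>"
| "cl (Neg \<phi>) = cl \<phi>"
| "cl (Ex u \<phi>) = insert (fm_code (Ex u \<phi>)) (cl \<phi>)"
| "cl (ExSet X \<phi>) = cl \<phi>"

lemma finite_cl [simp]: "finite (cl \<phi>)"
  by (induction \<phi>) auto

lemma card_cl: "card (cl \<phi>) \<le> fm_length \<phi>"
proof (induction \<phi>)
  case (Or \<phi> \<psi>)
  then show ?case using card_Un_le[of "cl \<phi>" "cl \<psi>"] by simp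
next
  case (Ex u \<phi>)
  then show ?case using card_insert_le_m1[of "Suc (fm_length \<phi>)" "cl \<phi>"] by (simp add: card_insert_if)
qed auto

text \<open>Strips the prefix of set quantifiers, whose variables become free.\<close>

primrec core :: "(nat, nat) fm \<Rightarrow> (nat, nat) fm" where
  "core (Proc p u) = Proc p u"
| "core (Letter a u) = Letter a u"
| "core (Mem u X) = Mem u X"
| "core (Eq u v) = Eq u v"
| "core (Succ u v) = Succ u v"
| "core (Msg u v) = Msg u v"
| "core (Le u v) = Le u v"
| "core (Or \<phi> \<psi>) = Or \<phi> \<psi>"
| "core (Neg \<phi>) = Neg \<phi>"
| "core (Ex u \<phi>) = Ex u \<phi>"
| "core (ExSet X \<phi>) = core \<phi>"

lemma ev_core: "ev (core \<phi>) = ev \<phi>"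
  by (induction \<phi>) (auto intro!: ext)

lemma cl_core: "cl (core \<phi>) = cl \<phi>"
  by (induction \<phi>) auto

lemma fo2_core: "emso2 \<phi> \<Longrightarrow> fo2 (core \<phi>)"
proof (induction rule: emso2.induct)
  case (matrix \<psi>)
  then have "core \<psi> = \<psi>" by (cases \<psi>) auto
  with matrix show ?case by simp
qed auto

lemma sat_core_if: "sat P M \<nu> V \<phi> \<Longrightarrow> \<exists>V'. sat P M \<nu> V' (core \<phi>)"
  by (induction \<phi> arbitrary: V) auto

text \<open>Each set quantifier takes the value that V already assigns to its variable, which
  therefore has to be a set of events.\<close>

lemma sat_if_core: "sat P M \<nu> V (core \<phi>) \<Longrightarrow> \<forall>X. V X \<subseteq> events P M \<Longrightarrow> sat P M \<nu> V \<phi>"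
proof (induction \<phi>)
  case (ExSet X \<phi>)
  then have "sat P M \<nu> (V(X := V X)) \<phi>" by simp
  then show ?case using ExSet.prems unfolding sat.simps by blast
qed auto

lemma sat_cong:
  "(\<And>x. x \<in> free_fo \<phi> \<Longrightarrow> \<nu> x = \<nu>' x) \<Longrightarrow> (\<And>X. X \<in> free_so \<phi> \<Longrightarrow> V X = V' X) \<Longrightarrow>
   sat P M \<nu> V \<phi> \<longleftrightarrow> sat P M \<nu>' V' \<phi>"
proof (induction \<phi> arbitrary: \<nu> \<nu>' V V')
  case (Or \<phi> \<psi>)
  from Or.IH(1)[of \<nu> \<nu>' V V'] Or.IH(2)[of \<nu> \<nu>' V V'] Or.prems show ?case by simp
next
  case (Neg \<phi>)
  from Neg.IH[of \<nu> \<nu>' V V'] Neg.prems show ?case by simp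
next
  case (Ex x \<phi>)
  have "sat P M (\<nu>(x := e)) V \<phi> \<longleftrightarrow> sat P M (\<nu>'(x := e)) V' \<phi>" for e
    by (rule Ex.IH) (use Ex.prems in auto)
  then show ?case by simp
next
  case (ExSet X \<phi>)
  have "sat P M \<nu> (V(X := U)) \<phi> \<longleftrightarrow> sat P M \<nu>' (V'(X := U)) \<phi>" for U
    by (rule ExSet.IH) (use ExSet.prems in auto)
  then show ?case by simp
qed auto

lemma free_fo_fo2: "fo2 \<phi> \<Longrightarrow> free_fo \<phi> \<subseteq> {0, 1}"
  by (induction \<phi>) auto

text \<open>Finer relations are tested before coarser ones, so that 5 and 6 stand for causality that
  is not a single edge. The values 1, 3, 5 put f after e, the values 2, 4, 6 before e, and 7 means
  that they are parallel.\<close>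

definition rel :: "(nat, nat) msc \<Rightarrow> nat event \<Rightarrow> nat event \<Rightarrow> nat" where
  "rel M e f =
    (if e = f then 0 else if (e, f) \<in> proc_rel M then 1 else if (f, e) \<in> proc_rel M then 2
     else if (e, f) \<in> msg M then 3 else if (f, e) \<in> msg M then 4
     else if (e, f) \<in> causal M then 5 else if (f, e) \<in> causal M then 6 else 7)"

lemma rel_less: "rel M e f < 8"
  by (simp add: rel_def)

section \<open>Satisfaction in terms of types\<close>

context
  fixes P :: "nat set" and \<Sigma> :: "nat set" and M :: "(nat, nat) msc"
  assumes msc: "is_msc P \<Sigma> M"
begin

lemma acyclic_edges: "acyclic (proc_rel M \<union> msg M)"
  using msc by (simp add: is_msc_def)

lemma causal_antisym: "(e, f) \<in> causal M \<Longrightarrow> (f, e) \<in> causal M \<Longrightarrow> e = f"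
  unfolding causal_def by (rule antisymD[OF acyclic_impl_antisym_rtrancl[OF acyclic_edges]])

lemma edge_causal: "(e, f) \<in> proc_rel M \<Longrightarrow> (e, f) \<in> causal M" "(e, f) \<in> msg M \<Longrightarrow> (e, f) \<in> causal M"
  by (auto simp: causal_def)

lemma edge_irrefl: "(e, e) \<notin> proc_rel M" "(e, e) \<notin> msg M"
  using acyclic_edges trancl.r_into_trancl[of e e "proc_rel M \<union> msg M"] by (auto simp: acyclic_def)

lemma msg_events:
  assumes "(e, f) \<in> msg M"
  shows "e \<in> events P M" "f \<in> events P M" "fst e \<noteq> fst f"
proof -
  have "msg M \<subseteq> (\<Union>p\<in>P. \<Union>q\<in>P - {p}. events_of M p \<times> events_of M q)"
    using msc by (simp only: is_msc_def)
  with assms have "(e, f) \<in> (\<Union>p\<in>P. \<Union>q\<in>P - {p}. events_of M p \<times> events_of M q)" by (rule subsetD[rotated])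
  then show "e \<in> events P M" "f \<in> events P M" "fst e \<noteq> fst f"
    by (auto simp: events_def events_of_def)
qed

lemma edge_disjoint: "(e, f) \<in> msg M \<Longrightarrow> (e, f) \<notin> proc_rel M \<and> (f, e) \<notin> proc_rel M"
  using msg_events(3)[of e f] by (auto simp: proc_rel_def)

lemma causal_refl [simp]: "(e, e) \<in> causal M"
  by (simp add: causal_def)

lemma rel_simps:
  "rel M e f = 0 \<longleftrightarrow> e = f"
  "rel M e f = Suc 0 \<longleftrightarrow> (e, f) \<in> proc_rel M"
  "rel M e f = 2 \<longleftrightarrow> (f, e) \<in> proc_rel M"
  "rel M e f = 3 \<longleftrightarrow> (e, f) \<in> msg M"
  "rel M e f = 4 \<longleftrightarrow> (f, e) \<in> msg M"
  "(e, f) \<in> causal M \<longleftrightarrow> rel M e f \<in> {0, 1, 3, 5}"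
  "(f, e) \<in> causal M \<longleftrightarrow> rel M e f \<in> {0, 2, 4, 6}"
  using edge_irrefl[of e] edge_disjoint[of e f] edge_disjoint[of f e]
    edge_causal[of e f] edge_causal[of f e] causal_antisym[of e f] causal_refl[of e]
  unfolding rel_def by (auto split: if_splits)

text \<open>The assumption t4 on existential formulas may use the claim for their body, so that one
  induction serves two purposes. If the types are defined by truth, t4 is immediate; if they are
  merely consistent, t4 follows from consistency and the claim for the body.\<close>

lemma sat_iff_ev:
  assumes t1: "\<And>e p. e \<in> events P M \<Longrightarrow> fm_code (Proc p 0) \<in> cl \<phi> \<Longrightarrow>
      fm_code (Proc p 0) \<in> set_decode (t e) \<longleftrightarrow> p = fst e"
    and t2: "\<And>e a. e \<in> events P M \<Longrightarrow> fm_code (Letter a 0) \<in> cl \<phi> \<Longrightarrow>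
      fm_code (Letter a 0) \<in> set_decode (t e) \<longleftrightarrow> a = letter M e"
    and t3: "\<And>e X. e \<in> events P M \<Longrightarrow> fm_code (Mem 0 X) \<in> cl \<phi> \<Longrightarrow>
      fm_code (Mem 0 X) \<in> set_decode (t e) \<longleftrightarrow> e \<in> V X"
    and t4: "\<And>e u \<chi>. e \<in> events P M \<Longrightarrow> fm_code (Ex u \<chi>) \<in> cl \<phi> \<Longrightarrow> fo2 (Ex u \<chi>) \<Longrightarrow>
      (\<And>e f. e \<in> events P M \<Longrightarrow> f \<in> events P M \<Longrightarrow>
        sat P M ((\<lambda>_. e)(u := f)) V \<chi> \<longleftrightarrow> ev \<chi> u (t e) (t f) (rel M e f)) \<Longrightarrow>
      fm_code (Ex u \<chi>) \<in> set_decode (t e) \<longleftrightarrow> sat P M (\<lambda>_. e) V (Ex u \<chi>)"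
    and "fo2 \<chi>" "cl \<chi> \<subseteq> cl \<phi>" "x \<le> 1" "e \<in> events P M" "f \<in> events P M"
    and "\<nu> x = f" "\<nu> (1 - x) = e"
  shows "sat P M \<nu> V \<chi> \<longleftrightarrow> ev \<chi> x (t e) (t f) (rel M e f)"
  using assms(5-)
proof (induction \<chi> arbitrary: x e f \<nu>)
  case (Proc p u)
  have "sat P M \<nu> V (Proc p u) \<longleftrightarrow> p = fst (\<nu> u)"
  proof -
    have "\<nu> u \<in> events P M" using Proc by (auto simp: le_Suc_eq)
    then show ?thesis by (auto simp: events_def events_of_def)
  qed
  then show ?case using Proc t1 by (auto simp: le_Suc_eq)
next
  case (Letter a u)
  then show ?case using t2 by (auto simp: le_Suc_eq)
next
  case (Mem u X)
  then show ?case using t3 by (auto simp: le_Suc_eq)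
next
  case (Eq u v)
  then show ?case by (auto simp: le_Suc_eq rel_simps)
next
  case (Succ u v)
  then show ?case
    using edge_irrefl[of "\<nu> 0"] edge_irrefl[of "\<nu> (Suc 0)"] by (auto simp: le_Suc_eq rel_simps)
next
  case (Msg u v)
  then show ?case
    using edge_irrefl[of "\<nu> 0"] edge_irrefl[of "\<nu> (Suc 0)"] by (auto simp: le_Suc_eq rel_simps)
next
  case (Le u v)
  define r where "r = rel M e f"
  have c: "(e, f) \<in> causal M \<longleftrightarrow> r = 0 \<or> r = 1 \<or> r = 3 \<or> r = 5"
    "(f, e) \<in> causal M \<longleftrightarrow> r = 0 \<or> r = 2 \<or> r = 4 \<or> r = 6"
    by (simp_all add: rel_simps(6)[of e f] rel_simps(7)[of f e] r_def)
  have "x = 0 \<or> x = 1" "u = 0 \<or> u = 1" "v = 0 \<or> v = 1" using Le by auto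
  then show ?case
    unfolding sat.simps ev.simps r_def[symmetric] using Le.prems(6,7)
    by (elim disjE) (simp_all add: c)
next
  case (Or \<phi> \<psi>)
  then show ?case using Or.IH(1)[of x f e \<nu>] Or.IH(2)[of x f e \<nu>] by simp
next
  case (Neg \<phi>)
  then show ?case using Neg.IH[of x f e \<nu>] by simp
next
  case (Ex u \<chi>)
  let ?g = "\<nu> (1 - u)"
  have g: "?g \<in> events P M" and u: "u \<le> 1" using Ex by (auto simp: le_Suc_eq)
  \<comment> \<open>With two variables, only \<open>1 - u\<close> can be free in this formula, so
    its truth is a property of a single event and can be part of that event's type.\<close>
  have "sat P M \<nu> V (Ex u \<chi>) \<longleftrightarrow> sat P M (\<lambda>_. ?g) V (Ex u \<chi>)"
    by (rule sat_cong) (use Ex.prems(1) free_fo_fo2[of \<chi>] in \<open>auto simp: le_Suc_eq\<close>)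
  also have "\<dots> \<longleftrightarrow> fm_code (Ex u \<chi>) \<in> set_decode (t ?g)"
  proof (rule t4[symmetric])
    fix e f assume "e \<in> events P M" "f \<in> events P M"
    then show "sat P M ((\<lambda>_. e)(u := f)) V \<chi> \<longleftrightarrow> ev \<chi> u (t e) (t f) (rel M e f)"
      using Ex.prems u by (intro Ex.IH) auto
  qed (use g Ex.prems in auto)
  also have "\<dots> \<longleftrightarrow> ev (Ex u \<chi>) x (t e) (t f) (rel M e f)"
    using Ex.prems by (auto simp: le_Suc_eq)
  finally show ?case .
qed auto

lemma fm_lang_iff_types:
  assumes "sentence \<phi>" "emso2 \<phi>"
  shows "M \<in> fm_lang P \<Sigma> \<phi> \<longleftrightarrow> (\<exists>t. \<forall>e\<in>events P M. set_decode (t e) \<subseteq> cl \<phi> \<and>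
    (\<forall>p. fm_code (Proc p 0) \<in> cl \<phi> \<longrightarrow> (fm_code (Proc p 0) \<in> set_decode (t e) \<longleftrightarrow> p = fst e)) \<and>
    (\<forall>a. fm_code (Letter a 0) \<in> cl \<phi> \<longrightarrow>
      (fm_code (Letter a 0) \<in> set_decode (t e) \<longleftrightarrow> a = letter M e)) \<and>
    (\<forall>u \<chi>. fm_code (Ex u \<chi>) \<in> cl \<phi> \<longrightarrow>
      (fm_code (Ex u \<chi>) \<in> set_decode (t e) \<longleftrightarrow>
        (\<exists>f\<in>events P M. ev \<chi> u (t e) (t f) (rel M e f)))) \<and>
    ev \<phi> 0 (t e) (t e) 0)"
    (is "_ \<longleftrightarrow> (\<exists>t. ?Q t)")
proof
  \<comment> \<open>An MSC has at least one event, at which the sentence can be evaluated; both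
    variables are then interpreted by it, whence the relation 0.\<close>
  obtain e0 where e0: "e0 \<in> events P M"
    using msc by (force simp: is_msc_def events_def events_of_def Suc_le_eq)
  have fo2: "fo2 (core \<phi>)" using assms fo2_core by blast
  have free: "free_fo \<phi> = {}" "free_so \<phi> = {}" using assms by (auto simp: sentence_def)
  have any: "sat P M \<nu> V \<phi> \<longleftrightarrow> sat P M \<nu>' V' \<phi>" for \<nu> V \<nu>' V'
    by (rule sat_cong) (use free in auto)
  {
    assume "M \<in> fm_lang P \<Sigma> \<phi>"
    then have all: "sat P M \<nu> V \<phi>" for \<nu> V by (auto simp: fm_lang_def)
    obtain V where V: "sat P M (\<lambda>_. e0) V (core \<phi>)" using sat_core_if all by blast
    define t where "t e = set_encode {fm_code \<chi> |\<chi>. fm_code \<chi> \<in> cl \<phi> \<and> sat P M (\<lambda>_. e) V \<chi>}" for e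
    have fin: "finite {fm_code \<chi> |\<chi>. fm_code \<chi> \<in> cl \<phi> \<and> sat P M (\<lambda>_. e) V \<chi>}" for e
      by (rule finite_subset[of _ "cl \<phi>"]) auto
    have t: "fm_code \<chi> \<in> set_decode (t e) \<longleftrightarrow> sat P M (\<lambda>_. e) V \<chi>" if "fm_code \<chi> \<in> cl \<phi>" for \<chi> e
      using that fm_code_inject by (auto simp: t_def fin)
    have iff: "sat P M \<nu> V \<chi> \<longleftrightarrow> ev \<chi> x (t e) (t f) (rel M e f)"
      if "fo2 \<chi>" "cl \<chi> \<subseteq> cl \<phi>" "x \<le> 1" "e \<in> events P M" "f \<in> events P M" "\<nu> x = f" "\<nu> (1 - x) = e"
      for \<chi> \<nu> e f x
      by (rule sat_iff_ev[where \<phi> = \<phi>])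
        (use that in \<open>simp_all only: t, auto simp: events_def events_of_def\<close>)
    have "fo2 \<chi> \<and> cl \<chi> \<subseteq> cl \<psi> \<and> u \<le> 1" if "fm_code (Ex u \<chi>) \<in> cl \<psi>" "fo2 \<psi>" for u \<chi> \<psi>
      using that by (induction \<psi>) (auto dest: fm_code_inject)
    from this[of _ _ "core \<phi>"] have Ex: "fo2 \<chi> \<and> cl \<chi> \<subseteq> cl \<phi> \<and> u \<le> 1" if "fm_code (Ex u \<chi>) \<in> cl \<phi>" for u \<chi>
      using that fo2 by (simp add: cl_core)
    have "?Q t"
    proof (intro ballI conjI allI impI)
      fix e assume e: "e \<in> events P M"
      show "set_decode (t e) \<subseteq> cl \<phi>" by (auto simp: t_def fin)
      show "fm_code (Proc p 0) \<in> set_decode (t e) \<longleftrightarrow> p = fst e" if "fm_code (Proc p 0) \<in> cl \<phi>" for p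
        using t[OF that] e by (auto simp: events_def events_of_def)
      show "fm_code (Letter a 0) \<in> set_decode (t e) \<longleftrightarrow> a = letter M e"
        if "fm_code (Letter a 0) \<in> cl \<phi>" for a
        using t[OF that] by auto
      show "fm_code (Ex u \<chi>) \<in> set_decode (t e) \<longleftrightarrow> (\<exists>f\<in>events P M. ev \<chi> u (t e) (t f) (rel M e f))"
        if "fm_code (Ex u \<chi>) \<in> cl \<phi>" for u \<chi>
      proof -
        have "sat P M ((\<lambda>_. e)(u := f)) V \<chi> \<longleftrightarrow> ev \<chi> u (t e) (t f) (rel M e f)"
          if "f \<in> events P M" for f
          using Ex[OF \<open>fm_code (Ex u \<chi>) \<in> cl \<phi>\<close>] e that
          by (intro iff) (auto simp: le_Suc_eq)
        then show ?thesis using t[OF that] by auto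
      qed
      have "sat P M (\<lambda>_. e0) V (core \<phi>) \<longleftrightarrow> ev (core \<phi>) 0 (t e0) (t e0) (rel M e0 e0)"
        by (rule iff) (use fo2 e0 in \<open>auto simp: cl_core\<close>)
      have "sat P M (\<lambda>_. e) V (core \<phi>) \<longleftrightarrow> sat P M (\<lambda>_. e0) V (core \<phi>)"
      proof (rule sat_cong)
        have "free_fo (core \<psi>) = free_fo \<psi>" for \<psi> by (induction \<psi>) auto
        then show "x \<in> free_fo (core \<phi>) \<Longrightarrow> e = e0" for x using free by auto
      qed auto
      then have "sat P M (\<lambda>_. e) V (core \<phi>)" using V by blast
      moreover have "sat P M (\<lambda>_. e) V (core \<phi>) \<longleftrightarrow> ev (core \<phi>) 0 (t e) (t e) (rel M e e)"
        by (rule iff) (use fo2 e in \<open>auto simp: cl_core\<close>)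
      ultimately show "ev \<phi> 0 (t e) (t e) 0" by (simp add: ev_core rel_def)
    qed
    then show "\<exists>t. ?Q t" by blast
  }
  assume "\<exists>t. ?Q t"
  then obtain t where t: "?Q t" by blast
  \<comment> \<open>The quantified sets are read off the types.\<close>
  define V where "V X = {e \<in> events P M. fm_code (Mem 0 X) \<in> set_decode (t e)}" for X
  have "sat P M (\<lambda>_. e0) V (core \<phi>) \<longleftrightarrow> ev (core \<phi>) 0 (t e0) (t e0) (rel M e0 e0)"
  proof (rule sat_iff_ev[where \<phi> = \<phi>])
    fix e u \<chi>
    assume "e \<in> events P M" "fm_code (Ex u \<chi>) \<in> cl \<phi>"
      and "\<And>e f. e \<in> events P M \<Longrightarrow> f \<in> events P M \<Longrightarrow>
        sat P M ((\<lambda>_. e)(u := f)) V \<chi> \<longleftrightarrow> ev \<chi> u (t e) (t f) (rel M e f)"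
    then show "fm_code (Ex u \<chi>) \<in> set_decode (t e) \<longleftrightarrow> sat P M (\<lambda>_. e) V (Ex u \<chi>)"
      using t by auto
  qed (use t fo2 e0 in \<open>auto simp: cl_core V_def\<close>)
  then have "sat P M (\<lambda>_. e0) V (core \<phi>)" using t e0 by (simp add: ev_core rel_def)
  then have "sat P M (\<lambda>_. e0) V \<phi>" by (rule sat_if_core) (auto simp: V_def)
  then show "M \<in> fm_lang P \<Sigma> \<phi>" using msc any unfolding fm_lang_def by blast
qed

end

subsection \<open>Evaluation on codes\<close>

text \<open>The constructor of a formula with a given code (see \<open>fm_code\<close>), and its arguments.\<close>

definition tag :: "nat \<Rightarrow> nat" where "tag n = pfst (n - 1)"
definition ar1 :: "nat \<Rightarrow> nat" where "ar1 n = pfst (psnd (n - 1) - 1)"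
definition ar2 :: "nat \<Rightarrow> nat" where "ar2 n = pfst (psnd (psnd (n - 1) - 1) - 1)"

lemma tag_simps [simp]:
  "tag (list_encode (k # xs)) = k"
  "ar1 (list_encode (k # a # xs)) = a"
  "ar2 (list_encode (k # a # b # xs)) = b"
  by (simp_all add: tag_def ar1_def ar2_def)

lemma RF_tag [rf]: "RF f \<Longrightarrow> RF (\<lambda>x. tag (f x))"
  and RF_ar1 [rf]: "RF f \<Longrightarrow> RF (\<lambda>x. ar1 (f x))"
  and RF_ar2 [rf]: "RF f \<Longrightarrow> RF (\<lambda>x. ar2 (f x))"
  unfolding tag_def ar1_def ar2_def by (intro rf, assumption)+

lemma RF_list_encode_Cons [rf]:
  "RF f \<Longrightarrow> RF (\<lambda>x. list_encode (g x)) \<Longrightarrow> RF (\<lambda>x. list_encode (f x # g x))"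
  by (simp add: rf)

text \<open>Immediate subformulas have smaller codes, which permits course-of-values recursion over
  formulas.\<close>

lemma list_encode_arg_less:
  "a < list_encode (k # a # xs)" "b < list_encode (k # a # b # xs)"
proof -
  have *: "a < list_encode (a # xs)" "list_encode xs < list_encode (a # xs)" for a xs
    by (simp_all add: less_Suc_eq_le le_prod_encode_1 le_prod_encode_2)
  show "a < list_encode (k # a # xs)" "b < list_encode (k # a # b # xs)"
    by (meson * less_trans)+
qed

lemma course_of_values:
  fixes Q :: "nat \<Rightarrow> nat \<Rightarrow> bool"
  defines "F \<equiv> rec_nat 0 (\<lambda>k r. r + (if Q k r then 2 ^ k else 0))"
  shows "c \<in> set_decode (F n) \<longleftrightarrow> c < n \<and> Q c (F c)"
  using set_encode_rec[of Q n] unfolding F_def by simp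

text \<open>\<open>T\<close> codes the set of all smaller codes that evaluate to true under the same
  parameters.\<close>

definition ev_step :: "nat \<Rightarrow> nat \<Rightarrow> nat \<Rightarrow> bool" where
  "ev_step k T par \<longleftrightarrow>
    (let x = pfst par; \<tau>\<^sub>0 = pfst (psnd par); \<tau> = pfst (psnd (psnd par)); \<eta> = psnd (psnd (psnd par)) in
      tag k = 0 \<and> list_encode [0, ar1 k, 0] \<in> set_decode (if ar2 k = x then \<tau> else \<tau>\<^sub>0) \<or>
      tag k = 1 \<and> list_encode [1, ar1 k, 0] \<in> set_decode (if ar2 k = x then \<tau> else \<tau>\<^sub>0) \<or>
      tag k = 2 \<and> list_encode [2, 0, ar2 k] \<in> set_decode (if ar1 k = x then \<tau> else \<tau>\<^sub>0) \<or>
      tag k = 3 \<and> (ar1 k = ar2 k \<or> \<eta> = 0) \<or>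
      tag k = 4 \<and> \<not> ar1 k = ar2 k \<and> \<eta> = (if ar2 k = x then 1 else 2) \<or>
      tag k = 5 \<and> \<not> ar1 k = ar2 k \<and> \<eta> = (if ar2 k = x then 3 else 4) \<or>
      tag k = 6 \<and> (ar1 k = ar2 k \<or> \<eta> = 0 \<or>
        (if ar2 k = x then \<eta> = 1 \<or> \<eta> = 3 \<or> \<eta> = 5 else \<eta> = 2 \<or> \<eta> = 4 \<or> \<eta> = 6)) \<or>
      tag k = 7 \<and> (ar1 k \<in> set_decode T \<or> ar2 k \<in> set_decode T) \<or>
      tag k = 8 \<and> \<not> ar1 k \<in> set_decode T \<or>
      tag k = 9 \<and> k \<in> set_decode (if 1 - ar1 k = x then \<tau> else \<tau>\<^sub>0) \<or>
      tag k = 10 \<and> ar2 k \<in> set_decode T)"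

definition ev_code :: "nat \<Rightarrow> nat \<Rightarrow> nat \<Rightarrow> nat \<Rightarrow> nat \<Rightarrow> bool" where
  "ev_code c x \<tau>\<^sub>0 \<tau> \<eta> \<longleftrightarrow> c \<in> set_decode (rec_nat 0
    (\<lambda>k r. r + (if ev_step k r (prod_encode (x, prod_encode (\<tau>\<^sub>0, prod_encode (\<tau>, \<eta>)))) then 2 ^ k else 0))
    (Suc c))"

lemma DP_ev_code [rf]:
  "RF a \<Longrightarrow> RF b \<Longrightarrow> RF c \<Longrightarrow> RF d \<Longrightarrow> RF e \<Longrightarrow> DP (\<lambda>x. ev_code (a x) (b x) (c x) (d x) (e x))"
  unfolding ev_code_def
proof (rule DP_course_of_values)
  show "DP (\<lambda>z. ev_step (pfst z) (pfst (psnd z)) (psnd (psnd z)))"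
    unfolding ev_step_def Let_def by (intro rf)
qed (assumption | rule rf)+

lemma ev_code: "ev_code (fm_code \<phi>) x \<tau>\<^sub>0 \<tau> \<eta> \<longleftrightarrow> ev \<phi> x \<tau>\<^sub>0 \<tau> \<eta>"
proof -
  let ?par = "prod_encode (x, prod_encode (\<tau>\<^sub>0, prod_encode (\<tau>, \<eta>)))"
  define F where "F = rec_nat 0 (\<lambda>k r. r + (if ev_step k r ?par then 2 ^ k else 0))"
  note F = course_of_values[of _ "\<lambda>k r. ev_step k r ?par", folded F_def]
  have rec: "ev_code c x \<tau>\<^sub>0 \<tau> \<eta> \<longleftrightarrow> ev_step c (F c) ?par" for c
    unfolding ev_code_def F_def[symmetric] F by simp
  have sub: "c \<in> set_decode (F n) \<longleftrightarrow> ev_code c x \<tau>\<^sub>0 \<tau> \<eta>" if "c < n" for c n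
    unfolding rec F using that by simp
  note [simp] = sub[OF list_encode_arg_less(1)] sub[OF list_encode_arg_less(2)]
  note [simp del] = list_encode.simps
  show ?thesis
    by (induction \<phi>) (simp_all add: rec[of "list_encode _"] ev_step_def Let_def)
qed

text \<open>The recursion runs over formulas while the potential member c stays fixed:
  \<open>T\<close> codes the set of smaller codes whose closure contains c.\<close>

definition cl_step :: "nat \<Rightarrow> nat \<Rightarrow> nat \<Rightarrow> bool" where
  "cl_step k T c \<longleftrightarrow>
    (tag k = 0 \<or> tag k = 1) \<and> c = list_encode [tag k, ar1 k, 0] \<or>
    tag k = 2 \<and> c = list_encode [2, 0, ar2 k] \<or>
    tag k = 7 \<and> (ar1 k \<in> set_decode T \<or> ar2 k \<in> set_decode T) \<or>
    tag k = 8 \<and> ar1 k \<in> set_decode T \<or>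
    tag k = 9 \<and> (c = k \<or> ar2 k \<in> set_decode T) \<or>
    tag k = 10 \<and> ar2 k \<in> set_decode T"

definition in_cl :: "nat \<Rightarrow> nat \<Rightarrow> bool" where
  "in_cl n c \<longleftrightarrow> n \<in> set_decode (rec_nat 0
    (\<lambda>k r. r + (if cl_step k r c then 2 ^ k else 0)) (Suc n))"

definition cl_code :: "nat \<Rightarrow> nat" where
  "cl_code n = set_encode {c. c < Suc n \<and> in_cl n c}"

lemma RF_cl_code [rf]: "RF f \<Longrightarrow> RF (\<lambda>x. cl_code (f x))"
proof -
  have "DP (\<lambda>z. in_cl (psnd z) (pfst z))"
    unfolding in_cl_def
  proof (rule DP_course_of_values)
    show "DP (\<lambda>z. cl_step (pfst z) (pfst (psnd z)) (psnd (psnd z)))"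
      unfolding cl_step_def by (intro rf)
  qed (intro rf)+
  then have "RF cl_code" unfolding cl_code_def[abs_def] by (intro rf)
  then show "RF f \<Longrightarrow> RF (\<lambda>x. cl_code (f x))" by (rule RF_comp)
qed

lemma prod_encode_mono: "a \<le> a' \<Longrightarrow> b \<le> b' \<Longrightarrow> prod_encode (a, b) \<le> prod_encode (a', b')"
  using triangle_mono[of "a + b" "a' + b'"] by (simp add: prod_encode_def add_mono)

text \<open>Justifies the search bound in \<open>cl_code\<close>. Codes are monotone in their
  entries, so replacing the variable of an atom by 0 does not increase its code.\<close>

lemma cl_le_code: "c \<in> cl \<phi> \<Longrightarrow> c \<le> fm_code \<phi>"
proof (induction \<phi>)
  case (Or \<phi> \<psi>)
  have "fm_code \<phi> < fm_code (Or \<phi> \<psi>)" "fm_code \<psi> < fm_code (Or \<phi> \<psi>)"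
    unfolding fm_code.simps by (rule list_encode_arg_less)+
  with Or show ?case by auto
next
  case (Neg \<phi>)
  have "fm_code \<phi> < fm_code (Neg \<phi>)" unfolding fm_code.simps by (rule list_encode_arg_less)
  with Neg show ?case by auto
next
  case (Ex u \<phi>)
  have "fm_code \<phi> < fm_code (Ex u \<phi>)" unfolding fm_code.simps by (rule list_encode_arg_less)
  with Ex show ?case by auto
next
  case (ExSet X \<phi>)
  have "fm_code \<phi> < fm_code (ExSet X \<phi>)" unfolding fm_code.simps by (rule list_encode_arg_less)
  with ExSet show ?case by auto
qed (auto intro!: prod_encode_mono)

lemma set_decode_cl_code: "set_decode (cl_code (fm_code \<phi>)) = cl \<phi>"
proof -
  have "in_cl (fm_code \<phi>) c \<longleftrightarrow> c \<in> cl \<phi>" for c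
  proof -
    define F where "F = rec_nat 0 (\<lambda>k r. r + (if cl_step k r c then 2 ^ k else 0))"
    note F = course_of_values[of _ "\<lambda>k r. cl_step k r c", folded F_def]
    have rec: "in_cl n c \<longleftrightarrow> cl_step n (F n) c" for n
      unfolding in_cl_def F_def[symmetric] F by simp
    have sub: "j \<in> set_decode (F n) \<longleftrightarrow> in_cl j c" if "j < n" for j n
      unfolding rec F using that by simp
    note [simp] = sub[OF list_encode_arg_less(1)] sub[OF list_encode_arg_less(2)]
    note [simp del] = list_encode.simps
    show ?thesis
      by (induction \<phi>) (simp_all add: rec[of "list_encode _"] cl_step_def)
  qed
  then show ?thesis using cl_le_code by (auto simp: cl_code_def less_Suc_eq_le)
qed

section \<open>Labels and local conditions\<close>

text \<open>
  A label is a set of fields, given by its code. The field \<open>fld g k q \<tau> \<pi> \<pi>' \<rho>\<close> is the statement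
  number \<open>g\<close>, with the parameters following, about the events of type \<open>\<tau>\<close> on process \<open>q\<close>.
  The type of an event is the set of formulas true at it, \<open>\<pi>\<close>, \<open>\<pi>'\<close>, \<open>\<rho>\<close> are sequences of processes.
\<close>

definition fld :: "nat \<Rightarrow> nat \<Rightarrow> nat \<Rightarrow> nat \<Rightarrow> nat \<Rightarrow> nat \<Rightarrow> nat \<Rightarrow> nat" where
  "fld g k q \<tau> \<pi> \<pi>' \<rho> = list_encode [g, k, q, \<tau>, \<pi>, \<pi>', \<rho>]"

definition isA :: "nat \<Rightarrow> nat \<Rightarrow> nat \<Rightarrow> bool" where
  "isA q \<tau> L \<longleftrightarrow> fld 0 0 q \<tau> 0 0 0 \<in> set_decode L"

text \<open>Some event of type \<open>\<tau>\<close> on \<open>q\<close> is in relation \<open>k\<close> (see \<open>rel\<close>) to this one.\<close>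

definition obs :: "nat \<Rightarrow> nat \<Rightarrow> nat \<Rightarrow> nat \<Rightarrow> bool" where
  "obs k q \<tau> L \<longleftrightarrow> fld 1 k q \<tau> 0 0 0 \<in> set_decode L"

text \<open>
  For \<open>pst\<close>, the causal past contains: an event of type \<open>\<tau>\<close> on \<open>q\<close> (0), one that is not the first
  (1), the last one (2). For \<open>fut\<close>, the causal future contains: such an event (0), one that is not
  the last (1), the first one (2). For \<open>bas\<close>, the event itself is of type \<open>\<tau>\<close> on \<open>q\<close>, but not the
  first (0), not the last (1). For \<open>glob\<close>, some event is of type \<open>\<tau>\<close> on \<open>q\<close>.
\<close>

definition pst :: "nat \<Rightarrow> nat \<Rightarrow> nat \<Rightarrow> nat \<Rightarrow> bool" where
  "pst k q \<tau> L \<longleftrightarrow> fld 2 k q \<tau> 0 0 0 \<in> set_decode L"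
definition fut :: "nat \<Rightarrow> nat \<Rightarrow> nat \<Rightarrow> nat \<Rightarrow> bool" where
  "fut k q \<tau> L \<longleftrightarrow> fld 3 k q \<tau> 0 0 0 \<in> set_decode L"
definition bas :: "nat \<Rightarrow> nat \<Rightarrow> nat \<Rightarrow> nat \<Rightarrow> bool" where
  "bas k q \<tau> L \<longleftrightarrow> fld 4 k q \<tau> 0 0 0 \<in> set_decode L"

definition glob :: "nat \<Rightarrow> nat \<Rightarrow> nat \<Rightarrow> bool" where
  "glob q \<tau> L \<longleftrightarrow> fld 5 0 q \<tau> 0 0 0 \<in> set_decode L"

text \<open>
  A path through all events of type \<open>\<tau>\<close> on \<open>q\<close> that is to cover the events of \<open>p\<close> without parallel
  ones among them enters the event from its predecessor (0), from the sender of its message (1).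
\<close>

definition line :: "nat \<Rightarrow> nat \<Rightarrow> nat \<Rightarrow> nat \<Rightarrow> nat \<Rightarrow> bool" where
  "line d p q \<tau> L \<longleftrightarrow> fld 6 d q \<tau> (list_encode [p]) 0 0 \<in> set_decode L"

text \<open>
  Colours passed on along \<open>\<rho>\<close>, whose head is the process of the event: in the colouring for the pair
  \<open>(\<pi>, \<pi>')\<close>, the colour of the latest event of type \<open>\<tau>\<close> on \<open>q\<close> that reaches this one along \<open>\<rho>\<close>; and
  the colour of the one preceding the earliest one that is reached along \<open>\<rho>\<close>.
\<close>

definition tok :: "nat \<Rightarrow> nat \<Rightarrow> nat \<Rightarrow> nat \<Rightarrow> nat \<Rightarrow> nat \<Rightarrow> nat \<Rightarrow> bool" where
  "tok c q \<tau> \<pi> \<pi>' \<rho> L \<longleftrightarrow> fld 7 c q \<tau> \<pi> \<pi>' \<rho> \<in> set_decode L"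
definition tok' :: "nat \<Rightarrow> nat \<Rightarrow> nat \<Rightarrow> nat \<Rightarrow> nat \<Rightarrow> nat \<Rightarrow> nat \<Rightarrow> bool" where
  "tok' c q \<tau> \<pi> \<pi>' \<rho> L \<longleftrightarrow> fld 8 c q \<tau> \<pi> \<pi>' \<rho> \<in> set_decode L"

lemmas field_defs = isA_def obs_def pst_def fut_def bas_def glob_def line_def tok_def tok'_def

lemma RF_fld [rf]:
  "RF a \<Longrightarrow> RF b \<Longrightarrow> RF c \<Longrightarrow> RF d \<Longrightarrow> RF e \<Longrightarrow> RF f \<Longrightarrow> RF g \<Longrightarrow>
   RF (\<lambda>x. fld (a x) (b x) (c x) (d x) (e x) (f x) (g x))"
  unfolding fld_def by (rule rf | assumption)+

definition type_codes :: "nat \<Rightarrow> nat" where "type_codes \<phi> = pow_code (cl_code \<phi>)"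

text \<open>Every k in the set triggers one round of prepending, so the length is bounded by the
  number of processes without this number being computed. Recursion up to P meets all elements, as
  they are smaller than the code.\<close>

definition seq_codes :: "nat \<Rightarrow> nat" where
  "seq_codes P = rec_nat (set_encode {0}) (\<lambda>k r. if k \<in> set_decode P
     then un_code r (union_code (\<lambda>p. image_code (\<lambda>l. Suc (prod_encode (p, l))) r) P) else r) P"

text \<open>There are nine kinds of statements, and the second parameter needs eight values because
  of the relations. The number 0 is the code of the empty sequence and thus belongs to
  \<open>seq_codes P\<close>, which makes it available as a default parameter.\<close>

definition field_codes :: "nat \<Rightarrow> nat \<Rightarrow> nat" where
  "field_codes P \<phi> =
     union_code (\<lambda>g. union_code (\<lambda>k. union_code (\<lambda>q. union_code (\<lambda>\<tau>. union_code (\<lambda>\<pi>. union_code (\<lambda>\<pi>'.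
       image_code (\<lambda>\<rho>. fld g k q \<tau> \<pi> \<pi>' \<rho>)
     (seq_codes P)) (seq_codes P)) (seq_codes P)) (type_codes \<phi>)) P) (set_encode {..<8})) (set_encode {..<9})"

text \<open>
  In the following, \<open>L\<^sub>0\<close>, \<open>L\<close>, \<open>L\<^sub>1\<close> are the labels of three successive positions on process \<open>p\<close>, and \<open>In\<close>
  (or \<open>Out\<close>) that of the event on \<open>r\<close> from which a message is received (to which it is sent),
  with 0 standing for a missing event.
\<close>

definition fwd_type :: "nat \<Rightarrow> nat \<Rightarrow> nat \<Rightarrow> nat \<Rightarrow> nat \<Rightarrow> bool" where
  "fwd_type P \<phi> p a L \<longleftrightarrow> (\<exists>\<tau>\<in>set_decode (type_codes \<phi>). isA p \<tau> L \<and>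
     (\<forall>q\<in>set_decode P. \<forall>\<tau>'\<in>set_decode (type_codes \<phi>). isA q \<tau>' L \<longrightarrow> q = p \<and> \<tau>' = \<tau>) \<and>
     (\<forall>c\<in>set_decode (cl_code \<phi>).
       (tag c = 0 \<longrightarrow> (c \<in> set_decode \<tau> \<longleftrightarrow> ar1 c = p)) \<and>
       (tag c = 1 \<longrightarrow> (c \<in> set_decode \<tau> \<longleftrightarrow> ar1 c = a)) \<and>
       (tag c = 9 \<longrightarrow> (c \<in> set_decode \<tau> \<longleftrightarrow> (\<exists>\<eta><8. \<exists>q\<in>set_decode P.
          \<exists>\<tau>'\<in>set_decode (type_codes \<phi>). obs \<eta> q \<tau>' L \<and> ev_code (ar2 c) (ar1 c) \<tau> \<tau>' \<eta>)))) \<and>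
     ev_code \<phi> 0 \<tau> \<tau> 0)"

text \<open>The equations are stratified, although those for the past refer to the future through
  \<open>bas 1\<close>: \<open>pst 0\<close> and \<open>fut 0\<close> depend on \<open>isA\<close>
  only, they determine \<open>bas\<close>, and all other bits depend on these. The condition on
  \<open>obs 6\<close> is that of \<open>not_adjacent_iff\<close>.\<close>

definition fwd_bits :: "nat \<Rightarrow> nat \<Rightarrow> nat \<Rightarrow> nat \<Rightarrow> nat \<Rightarrow> bool" where
  "fwd_bits L\<^sub>0 L In q \<tau> \<longleftrightarrow>
     (pst 0 q \<tau> L \<longleftrightarrow> isA q \<tau> L \<or> pst 0 q \<tau> L\<^sub>0 \<or> pst 0 q \<tau> In) \<and>
     (pst 1 q \<tau> L \<longleftrightarrow> bas 0 q \<tau> L \<or> pst 1 q \<tau> L\<^sub>0 \<or> pst 1 q \<tau> In) \<and>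
     (pst 2 q \<tau> L \<longleftrightarrow> isA q \<tau> L \<and> \<not> bas 1 q \<tau> L \<or> pst 2 q \<tau> L\<^sub>0 \<or> pst 2 q \<tau> In) \<and>
     (bas 0 q \<tau> L \<longleftrightarrow> isA q \<tau> L \<and> pst 0 q \<tau> L\<^sub>0) \<and>
     (obs 0 q \<tau> L \<longleftrightarrow> isA q \<tau> L) \<and>
     (obs 2 q \<tau> L \<longleftrightarrow> isA q \<tau> L\<^sub>0) \<and>
     (obs 4 q \<tau> L \<longleftrightarrow> isA q \<tau> In) \<and>
     (obs 6 q \<tau> L \<longleftrightarrow> (pst 1 q \<tau> L\<^sub>0 \<or> pst 1 q \<tau> In) \<or>
        (pst 0 q \<tau> L\<^sub>0 \<or> pst 0 q \<tau> In) \<and> \<not> isA q \<tau> L\<^sub>0 \<and> \<not> isA q \<tau> In)"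

text \<open>The global bit is merely kept constant along the process here; the acceptance condition
  fixes its value. A label \<open>L\<^sub>1\<close> equal to 0 means that the event is the last
  one.\<close>

definition bwd_bits :: "nat \<Rightarrow> nat \<Rightarrow> nat \<Rightarrow> nat \<Rightarrow> nat \<Rightarrow> bool" where
  "bwd_bits L Out L\<^sub>1 q \<tau> \<longleftrightarrow>
     (fut 0 q \<tau> L \<longleftrightarrow> isA q \<tau> L \<or> fut 0 q \<tau> L\<^sub>1 \<or> fut 0 q \<tau> Out) \<and>
     (fut 1 q \<tau> L \<longleftrightarrow> bas 1 q \<tau> L \<or> fut 1 q \<tau> L\<^sub>1 \<or> fut 1 q \<tau> Out) \<and>
     (fut 2 q \<tau> L \<longleftrightarrow> isA q \<tau> L \<and> \<not> bas 0 q \<tau> L \<or> fut 2 q \<tau> L\<^sub>1 \<or> fut 2 q \<tau> Out) \<and>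
     (bas 1 q \<tau> L \<longleftrightarrow> isA q \<tau> L \<and> fut 0 q \<tau> L\<^sub>1) \<and>
     (obs 1 q \<tau> L \<longleftrightarrow> isA q \<tau> L\<^sub>1) \<and>
     (obs 3 q \<tau> L \<longleftrightarrow> isA q \<tau> Out) \<and>
     (obs 5 q \<tau> L \<longleftrightarrow> (fut 1 q \<tau> L\<^sub>1 \<or> fut 1 q \<tau> Out) \<or>
        (fut 0 q \<tau> L\<^sub>1 \<or> fut 0 q \<tau> Out) \<and> \<not> isA q \<tau> L\<^sub>1 \<and> \<not> isA q \<tau> Out) \<and>
     (L\<^sub>1 \<noteq> 0 \<longrightarrow> (glob q \<tau> L \<longleftrightarrow> glob q \<tau> L\<^sub>1))"

definition fwd_line :: "nat \<Rightarrow> nat \<Rightarrow> nat \<Rightarrow> nat \<Rightarrow> nat \<Rightarrow> nat \<Rightarrow> bool" where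
  "fwd_line L\<^sub>0 L In q \<tau> p \<longleftrightarrow>
     (line 0 p q \<tau> L \<longrightarrow> L\<^sub>0 \<noteq> 0) \<and> (line 1 p q \<tau> L \<longrightarrow> In \<noteq> 0) \<and>
     (bas 0 q \<tau> L \<longrightarrow> line 0 p q \<tau> L \<or> line 1 p q \<tau> L)"

text \<open>A line does not branch, and it begins only at the first element of \<open>A\<close>.
  Lines may merge, which does no harm because they are followed backwards.\<close>

definition bwd_line :: "nat \<Rightarrow> nat \<Rightarrow> nat \<Rightarrow> nat \<Rightarrow> nat \<Rightarrow> nat \<Rightarrow> bool" where
  "bwd_line L Out L\<^sub>1 q \<tau> p \<longleftrightarrow>
     \<not> (line 0 p q \<tau> L\<^sub>1 \<and> line 1 p q \<tau> Out) \<and>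
     (line 0 p q \<tau> L\<^sub>1 \<or> line 1 p q \<tau> Out \<longrightarrow>
        line 0 p q \<tau> L \<or> line 1 p q \<tau> L \<or> isA q \<tau> L \<and> \<not> bas 0 q \<tau> L)"

text \<open>In the first case all of \<open>A\<close> is comparable with the event: it lies on the
  same process, or above its first or below its last element, which is comparable in the right
  direction. In the second case the first or the last element of \<open>A\<close> is parallel as
  soon as \<open>A\<close> is nonempty. In the remaining case a positive claim is certified by
  colours and a negative one by a line.\<close>

definition fwd_par :: "nat \<Rightarrow> nat \<Rightarrow> nat \<Rightarrow> nat \<Rightarrow> nat \<Rightarrow> bool" where
  "fwd_par P p L q \<tau> \<longleftrightarrow>
     (if q = p \<or> fut 2 q \<tau> L \<or> pst 2 q \<tau> L then \<not> obs 7 q \<tau> L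
      else if \<not> pst 0 q \<tau> L \<or> \<not> fut 0 q \<tau> L then obs 7 q \<tau> L \<longleftrightarrow> glob q \<tau> L
      else if obs 7 q \<tau> L
      then \<forall>\<pi>\<in>set_decode (seq_codes P). \<forall>\<pi>'\<in>set_decode (seq_codes P).
        \<forall>c<3. \<not> (tok c q \<tau> \<pi> \<pi>' \<pi> L \<and> tok' c q \<tau> \<pi> \<pi>' \<pi>' L)
      else line 0 p q \<tau> L \<or> line 1 p q \<tau> L)"

text \<open>\<open>Suc (prod_encode (p, \<rho>))\<close> codes the sequence \<rho> with p put in
  front, and \<open>tag \<rho>\<close> is the head of \<rho>. An element of \<open>A\<close> chooses
  its colours freely, but has at least one. Its \<open>tok'\<close> is taken from the label before
  it, which holds the colours of the preceding element of \<open>A\<close>; from there they travel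
  backwards in time.\<close>

definition fwd_tok :: "nat \<Rightarrow> nat \<Rightarrow> nat \<Rightarrow> nat \<Rightarrow> nat \<Rightarrow> nat \<Rightarrow> nat \<Rightarrow> nat \<Rightarrow> nat \<Rightarrow> nat \<Rightarrow> bool" where
  "fwd_tok P p L\<^sub>0 L In r q \<tau> \<pi> \<pi>' \<longleftrightarrow>
     (if isA q \<tau> L
      then (\<exists>c<3. tok c q \<tau> \<pi> \<pi>' (list_encode [p]) L) \<and>
        (\<forall>c<3. tok' c q \<tau> \<pi> \<pi>' (list_encode [p]) L \<longleftrightarrow> tok c q \<tau> \<pi> \<pi>' (list_encode [p]) L\<^sub>0)
      else \<forall>c<3. tok c q \<tau> \<pi> \<pi>' (list_encode [p]) L \<longleftrightarrow> tok c q \<tau> \<pi> \<pi>' (list_encode [p]) L\<^sub>0) \<and>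
     (\<forall>\<rho>\<in>set_decode (seq_codes P). \<rho> \<noteq> 0 \<and> Suc (prod_encode (p, \<rho>)) \<in> set_decode (seq_codes P) \<longrightarrow>
       (\<forall>c<3. tok c q \<tau> \<pi> \<pi>' (Suc (prod_encode (p, \<rho>))) L \<longleftrightarrow>
         (if In \<noteq> 0 \<and> r = tag \<rho> then tok c q \<tau> \<pi> \<pi>' \<rho> In
          else tok c q \<tau> \<pi> \<pi>' (Suc (prod_encode (p, \<rho>))) L\<^sub>0)))"

definition bwd_tok :: "nat \<Rightarrow> nat \<Rightarrow> nat \<Rightarrow> nat \<Rightarrow> nat \<Rightarrow> nat \<Rightarrow> nat \<Rightarrow> nat \<Rightarrow> nat \<Rightarrow> nat \<Rightarrow> bool" where
  "bwd_tok P p L Out r L\<^sub>1 q \<tau> \<pi> \<pi>' \<longleftrightarrow>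
     (\<not> isA q \<tau> L \<longrightarrow>
       (\<forall>c<3. tok' c q \<tau> \<pi> \<pi>' (list_encode [p]) L \<longleftrightarrow> tok' c q \<tau> \<pi> \<pi>' (list_encode [p]) L\<^sub>1)) \<and>
     (\<forall>\<rho>\<in>set_decode (seq_codes P). \<rho> \<noteq> 0 \<and> Suc (prod_encode (p, \<rho>)) \<in> set_decode (seq_codes P) \<longrightarrow>
       (\<forall>c<3. tok' c q \<tau> \<pi> \<pi>' (Suc (prod_encode (p, \<rho>))) L \<longleftrightarrow>
         (if Out \<noteq> 0 \<and> r = tag \<rho> then tok' c q \<tau> \<pi> \<pi>' \<rho> Out
          else tok' c q \<tau> \<pi> \<pi>' (Suc (prod_encode (p, \<rho>))) L\<^sub>1)))"

definition fwd :: "nat \<Rightarrow> nat \<Rightarrow> nat \<Rightarrow> nat \<Rightarrow> nat \<Rightarrow> nat \<Rightarrow> nat \<Rightarrow> nat \<Rightarrow> bool" where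
  "fwd P \<phi> p a L\<^sub>0 L In r \<longleftrightarrow> fwd_type P \<phi> p a L \<and>
     (\<forall>q\<in>set_decode P. \<forall>\<tau>\<in>set_decode (type_codes \<phi>).
       fwd_bits L\<^sub>0 L In q \<tau> \<and> fwd_par P p L q \<tau> \<and>
       (\<forall>p'\<in>set_decode P. fwd_line L\<^sub>0 L In q \<tau> p') \<and>
       (\<forall>\<pi>\<in>set_decode (seq_codes P). \<forall>\<pi>'\<in>set_decode (seq_codes P). fwd_tok P p L\<^sub>0 L In r q \<tau> \<pi> \<pi>'))"

definition bwd :: "nat \<Rightarrow> nat \<Rightarrow> nat \<Rightarrow> nat \<Rightarrow> nat \<Rightarrow> nat \<Rightarrow> nat \<Rightarrow> bool" where
  "bwd P \<phi> p L Out r L\<^sub>1 \<longleftrightarrow>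
     (\<forall>q\<in>set_decode P. \<forall>\<tau>\<in>set_decode (type_codes \<phi>).
       bwd_bits L Out L\<^sub>1 q \<tau> \<and> (\<forall>p'\<in>set_decode P. bwd_line L Out L\<^sub>1 q \<tau> p') \<and>
       (\<forall>\<pi>\<in>set_decode (seq_codes P). \<forall>\<pi>'\<in>set_decode (seq_codes P). bwd_tok P p L Out r L\<^sub>1 q \<tau> \<pi> \<pi>'))"

section \<open>Decidability of the local conditions\<close>

lemma RF_type_codes [rf]: "RF f \<Longrightarrow> RF (\<lambda>x. type_codes (f x))"
  unfolding type_codes_def by (rule rf | assumption)+

lemma RF_seq_codes [rf]: "RF f \<Longrightarrow> RF (\<lambda>x. seq_codes (f x))"
proof -
  have "RF seq_codes" unfolding seq_codes_def[abs_def] by (intro rf)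
  then show "RF f \<Longrightarrow> RF (\<lambda>x. seq_codes (f x))" by (rule RF_comp)
qed

lemma RF_field_codes [rf]: "RF f \<Longrightarrow> RF g \<Longrightarrow> RF (\<lambda>x. field_codes (f x) (g x))"
proof -
  have "RF (\<lambda>x. field_codes (pfst x) (psnd x))" unfolding field_codes_def by (intro rf)
  from RF_comp[OF this, of "\<lambda>x. prod_encode (f x, g x)"]
  show "RF f \<Longrightarrow> RF g \<Longrightarrow> RF (\<lambda>x. field_codes (f x) (g x))" by (simp add: rf)
qed

lemma DP_fwd [rf]:
  assumes "RF a" "RF b" "RF c" "RF d" "RF e" "RF f" "RF g" "RF h"
  shows "DP (\<lambda>x. fwd (a x) (b x) (c x) (d x) (e x) (f x) (g x) (h x))"
proof -
  \<comment> \<open>Projections from nested pairs, which pack the eight arguments into one.\<close>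
  let ?p = "\<lambda>k x. pfst ((psnd ^^ k) x)"
  have "DP (\<lambda>x. fwd (?p 0 x) (?p 1 x) (?p 2 x) (?p 3 x) (?p 4 x) (?p 5 x) (?p 6 x) (?p 7 x))"
    unfolding fwd_def fwd_type_def fwd_bits_def fwd_par_def fwd_line_def fwd_tok_def field_defs
      funpow.simps numeral_eq_Suc pred_numeral_simps One_nat_def comp_def id_def
      BitM.simps
    by (intro rf)
  from DP_comp[OF this, of "\<lambda>x. prod_encode (a x, prod_encode (b x, prod_encode (c x, prod_encode (d x,
      prod_encode (e x, prod_encode (f x, prod_encode (g x, prod_encode (h x, 0))))))))"]
  show ?thesis by (simp add: rf assms numeral_eq_Suc)
qed

lemma DP_bwd [rf]:
  assumes "RF a" "RF b" "RF c" "RF d" "RF e" "RF f" "RF g"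
  shows "DP (\<lambda>x. bwd (a x) (b x) (c x) (d x) (e x) (f x) (g x))"
proof -
  let ?p = "\<lambda>k x. pfst ((psnd ^^ k) x)"
  have "DP (\<lambda>x. bwd (?p 0 x) (?p 1 x) (?p 2 x) (?p 3 x) (?p 4 x) (?p 5 x) (?p 6 x))"
    unfolding bwd_def bwd_bits_def bwd_line_def bwd_tok_def field_defs
      funpow.simps numeral_eq_Suc pred_numeral_simps One_nat_def comp_def id_def
      BitM.simps
    by (intro rf)
  from DP_comp[OF this, of "\<lambda>x. prod_encode (a x, prod_encode (b x, prod_encode (c x, prod_encode (d x,
      prod_encode (e x, prod_encode (f x, prod_encode (g x, 0)))))))"]
  show ?thesis by (simp add: rf assms numeral_eq_Suc)
qed

lemma set_decode_type_codes:
  "set_decode (type_codes (fm_code \<phi>)) = {\<tau>. set_decode \<tau> \<subseteq> cl \<phi>}"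
  by (simp add: type_codes_def set_decode_pow_code set_decode_cl_code)

definition seqs :: "nat set \<Rightarrow> nat list set" where
  "seqs P = {xs. set xs \<subseteq> P \<and> length xs \<le> card P}"

lemma set_decode_seq_codes: "set_decode (seq_codes P) = list_encode ` seqs (set_decode P)"
proof -
  define F where "F = rec_nat (set_encode {0}) (\<lambda>k r. if k \<in> set_decode P
     then un_code r (union_code (\<lambda>p. image_code (\<lambda>l. Suc (prod_encode (p, l))) r) P) else r)"
  have F: "F (Suc n) = (if n \<in> set_decode P then un_code (F n) (union_code (\<lambda>p.
      image_code (\<lambda>l. Suc (prod_encode (p, l))) (F n)) P) else F n)" for n
    by (simp add: F_def)
  let ?c = "\<lambda>n. card {k. k < n \<and> k \<in> set_decode P}"
  have "set_decode (F n) = list_encode ` {xs. set xs \<subseteq> set_decode P \<and> length xs \<le> ?c n}" for n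
  proof (induction n)
    case 0
    have "set_decode (Suc 0) = {0}" using set_decode_power2[of 0] by simp
    then show ?case by (auto simp: F_def)
  next
    case (Suc n)
    show ?case
    proof (cases "n \<in> set_decode P")
      case False
      then have "{k. k < Suc n \<and> k \<in> set_decode P} = {k. k < n \<and> k \<in> set_decode P}"
        by (auto simp: less_Suc_eq)
      then show ?thesis using Suc False by (simp add: F)
    next
      case True
      then have "{k. k < Suc n \<and> k \<in> set_decode P} = insert n {k. k < n \<and> k \<in> set_decode P}"
        by (auto simp: less_Suc_eq)
      then have c: "?c (Suc n) = Suc (?c n)" by simp
      have "{xs. set xs \<subseteq> set_decode P \<and> length xs \<le> Suc k} =
        {xs. set xs \<subseteq> set_decode P \<and> length xs \<le> k} \<union>
        (\<Union>p\<in>set_decode P. (#) p ` {xs. set xs \<subseteq> set_decode P \<and> length xs \<le> k})"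
        (is "?A = ?B \<union> ?C") for k
      proof (intro equalityI subsetI)
        fix xs assume "xs \<in> ?A" then show "xs \<in> ?B \<union> ?C" by (cases xs) auto
      qed auto
      then show ?thesis using True by (simp add: F Suc c image_Un image_UN image_image)
    qed
  qed
  moreover have "{k. k < P \<and> k \<in> set_decode P} = set_decode P"
    using less_of_in_set_decode by auto
  ultimately show ?thesis by (simp add: seq_codes_def seqs_def F_def)
qed

lemma set_decode_field_codes: "set_decode (field_codes P \<phi>) =
  {fld g k q \<tau> \<pi> \<pi>' \<rho> |g k q \<tau> \<pi> \<pi>' \<rho>. g < 9 \<and> k < 8 \<and> q \<in> set_decode P \<and>
    \<tau> \<in> set_decode (type_codes \<phi>) \<and> \<pi> \<in> set_decode (seq_codes P) \<and>
    \<pi>' \<in> set_decode (seq_codes P) \<and> \<rho> \<in> set_decode (seq_codes P)}"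
  unfolding field_codes_def set_decode_union_code set_decode_image_code
    set_encode_inverse[OF finite_lessThan]
  by blast

section \<open>The machine\<close>

text \<open>
  A state consists of the kind of the last event (0 internal, 1 send, 2 receive), the process it
  communicates with, its label, and the label of its partner. The initial state is 0, which reads as
  empty labels.
\<close>

definition state_code :: "nat \<Rightarrow> nat \<Rightarrow> nat \<Rightarrow> nat \<Rightarrow> nat" where
  "state_code g r L R = prod_encode (prod_encode (g, r), prod_encode (L, R))"
definition skind :: "nat \<Rightarrow> nat" where "skind s = pfst (pfst s)"
definition speer :: "nat \<Rightarrow> nat" where "speer s = psnd (pfst s)"
definition sown :: "nat \<Rightarrow> nat" where "sown s = pfst (psnd s)"
definition spartner :: "nat \<Rightarrow> nat" where "spartner s = psnd (psnd s)"
definition s_in :: "nat \<Rightarrow> nat" where "s_in s = (if skind s = 0 \<or> skind s = 1 then 0 else spartner s)"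
definition s_out :: "nat \<Rightarrow> nat" where "s_out s = (if skind s = 1 then spartner s else 0)"

lemma state_simps [simp]:
  "skind (state_code g r L R) = g" "speer (state_code g r L R) = r"
  "sown (state_code g r L R) = L" "spartner (state_code g r L R) = R"
  by (simp_all add: state_code_def skind_def speer_def sown_def spartner_def)

lemma RF_state [rf]:
  "RF f \<Longrightarrow> RF (\<lambda>x. skind (f x))" "RF f \<Longrightarrow> RF (\<lambda>x. speer (f x))"
  "RF f \<Longrightarrow> RF (\<lambda>x. sown (f x))" "RF f \<Longrightarrow> RF (\<lambda>x. spartner (f x))"
  "RF f \<Longrightarrow> RF (\<lambda>x. s_in (f x))" "RF f \<Longrightarrow> RF (\<lambda>x. s_out (f x))"
  unfolding skind_def speer_def sown_def spartner_def s_in_def s_out_def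
  by ((rule rf | assumption)+)

lemma RF_state_code [rf]:
  "RF a \<Longrightarrow> RF b \<Longrightarrow> RF c \<Longrightarrow> RF d \<Longrightarrow> RF (\<lambda>x. state_code (a x) (b x) (c x) (d x))"
  unfolding state_code_def by (rule rf | assumption)+

lemma sown_0 [simp]: "sown 0 = 0"
  using le_prod_encode_1[of "pfst (psnd 0)" "psnd (psnd 0)"] le_prod_encode_2[of "psnd 0" "pfst 0"]
  by (simp add: sown_def)

definition states_code :: "nat \<Rightarrow> nat \<Rightarrow> nat" where
  "states_code P \<phi> = un_code (set_encode {0})
     (union_code (\<lambda>g. union_code (\<lambda>r. union_code (\<lambda>L. image_code (\<lambda>R. state_code g r L R)
       (pow_code (field_codes P \<phi>))) (pow_code (field_codes P \<phi>))) P) (set_encode {..<3}))"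

lemma set_decode_states_code: "set_decode (states_code P \<phi>) =
  insert 0 {state_code g r L R |g r L R. g < 3 \<and> r \<in> set_decode P \<and>
    set_decode L \<subseteq> set_decode (field_codes P \<phi>) \<and> set_decode R \<subseteq> set_decode (field_codes P \<phi>)}"
proof -
  have "set_decode (set_encode {0}) = {0}" by (rule set_encode_inverse) simp
  then show ?thesis
    unfolding states_code_def set_decode_un_code set_decode_union_code set_decode_image_code
      set_encode_inverse[OF finite_lessThan] set_decode_pow_code by blast
qed

text \<open>The backward conditions of an event need the next label and are therefore checked by the
  following transition, or by acceptance if the event is the last. Labels of events are nonzero,
  which keeps 0 free for missing events.\<close>

definition step :: "nat \<Rightarrow> nat \<Rightarrow> nat \<Rightarrow> nat \<Rightarrow> nat \<Rightarrow> nat \<Rightarrow> bool" where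
  "step P \<phi> p a s s' \<longleftrightarrow> sown s' \<noteq> 0 \<and> (skind s' = 0 \<or> speer s' \<noteq> p) \<and>
     fwd P \<phi> p a (sown s) (sown s') (s_in s') (speer s') \<and>
     (s \<noteq> 0 \<longrightarrow> bwd P \<phi> p (sown s) (s_out s) (speer s) (sown s'))"

text \<open>A message consists of the labels of its send and its receive event, in this order. As
  both ends use the same message, each of them has guessed the label of the other correctly.\<close>

definition step_action :: "nat \<Rightarrow> nat \<Rightarrow> (nat, nat, nat) action" where
  "step_action a s =
     (if skind s = 0 then Internal a
      else if skind s = 1 then Send a (prod_encode (sown s, spartner s)) (speer s)
      else Receive a (prod_encode (spartner s, sown s)) (speer s))"

text \<open>All events of q are in the past of the last one there, so \<open>pst 0\<close> in the
  final state of q tells whether the type occurs on q at all. If q has no events, its final state is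
  0, where the statement is false.\<close>

definition accepting :: "nat \<Rightarrow> nat \<Rightarrow> (nat \<Rightarrow> nat) \<Rightarrow> bool" where
  "accepting P \<phi> s \<longleftrightarrow> (\<forall>p\<in>set_decode P. s p \<noteq> 0 \<longrightarrow>
     bwd P \<phi> p (sown (s p)) (s_out (s p)) (speer (s p)) 0 \<and>
     (\<forall>q\<in>set_decode P. \<forall>\<tau>\<in>set_decode (type_codes \<phi>).
        glob q \<tau> (sown (s p)) \<longleftrightarrow> pst 0 q \<tau> (sown (s q))))"

definition msg_codes :: "nat \<Rightarrow> nat \<Rightarrow> nat" where
  "msg_codes P \<phi> = union_code (\<lambda>L. image_code (\<lambda>R. prod_encode (L, R))
     (pow_code (field_codes P \<phi>))) (pow_code (field_codes P \<phi>))"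

definition cfm :: "nat \<Rightarrow> nat \<Rightarrow> nat \<Rightarrow> (nat, nat, nat, nat) cfm" where
  "cfm P \<Sigma> \<phi> = \<lparr>states = (\<lambda>p. set_decode (states_code P \<phi>)), init = (\<lambda>p. 0),
     trans = (\<lambda>p. {(s, step_action a s', s') |s a s'. s \<in> set_decode (states_code P \<phi>) \<and>
       a \<in> set_decode \<Sigma> \<and> s' \<in> set_decode (states_code P \<phi>) \<and> step P \<phi> p a s s'}),
     msgs = set_decode (msg_codes P \<phi>),
     acc = {s \<in> (\<Pi>\<^sub>E p\<in>set_decode P. set_decode (states_code P \<phi>)). accepting P \<phi> s}\<rparr>"

lemma set_decode_msg_codes: "set_decode (msg_codes P \<phi>) =
  {prod_encode (L, R) |L R. set_decode L \<subseteq> set_decode (field_codes P \<phi>) \<and>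
     set_decode R \<subseteq> set_decode (field_codes P \<phi>)}"
  by (auto simp: msg_codes_def set_decode_pow_code)

lemma is_cfm: "is_cfm (set_decode P) (set_decode \<Sigma>) (cfm P \<Sigma> \<phi>)"
proof -
  have "step_action a s' \<in> actions (set_decode P) (set_decode \<Sigma>) (set_decode (msg_codes P \<phi>)) p"
    if asm: "a \<in> set_decode \<Sigma>" "s' \<in> set_decode (states_code P \<phi>)" "step P \<phi> p a s s'" for a s s' p
  proof -
    have "s' \<noteq> 0" using asm(3) sown_0 by (metis step_def)
    then obtain g r L R where *: "s' = state_code g r L R" "r \<in> set_decode P"
      "set_decode L \<subseteq> set_decode (field_codes P \<phi>)" "set_decode R \<subseteq> set_decode (field_codes P \<phi>)"
      using asm by (auto simp: set_decode_states_code)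
    then have "g = 0 \<or> r \<noteq> p" using asm by (auto simp: step_def)
    then show ?thesis using asm * by (auto simp: step_action_def actions_def set_decode_msg_codes)
  qed
  moreover have "0 \<in> set_decode (states_code P \<phi>)" by (simp add: set_decode_states_code)
  ultimately show ?thesis by (auto simp: is_cfm_def cfm_def)
qed

subsection \<open>Computing the machine\<close>

definition trans_codes :: "nat \<Rightarrow> nat \<Rightarrow> nat \<Rightarrow> nat \<Rightarrow> nat" where
  "trans_codes P \<Sigma> \<phi> p = union_code (\<lambda>s. union_code (\<lambda>a. union_code (\<lambda>s'.
     if step P \<phi> p a s s' then set_encode {list_encode [s,
       if skind s' = 0 then list_encode [0, a]
       else if skind s' = 1 then list_encode [1, a, prod_encode (sown s', spartner s'), speer s']
       else list_encode [2, a, prod_encode (spartner s', sown s'), speer s'], s']} else 0)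
     (states_code P \<phi>)) \<Sigma>) (states_code P \<phi>)"

text \<open>Accepting global states are coded by their graphs. All subsets of the full relation
  between processes and states are searched for graphs of functions, whose values are accessed by
  bounded quantifiers.\<close>

definition acc_codes :: "nat \<Rightarrow> nat \<Rightarrow> nat" where
  "acc_codes P \<phi> = set_encode {G. G < Suc (union_code (\<lambda>p. image_code (\<lambda>s. prod_encode (p, s))
       (states_code P \<phi>)) P) \<and>
     (\<forall>x\<in>set_decode G. pfst x \<in> set_decode P \<and> psnd x \<in> set_decode (states_code P \<phi>)) \<and>
     (\<forall>p\<in>set_decode P. \<exists>s\<in>set_decode (states_code P \<phi>). prod_encode (p, s) \<in> set_decode G \<and>
       (\<forall>s'\<in>set_decode (states_code P \<phi>). prod_encode (p, s') \<in> set_decode G \<longrightarrow> s' = s) \<and>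
       (s \<noteq> 0 \<longrightarrow> bwd P \<phi> p (sown s) (s_out s) (speer s) 0 \<and>
         (\<forall>q\<in>set_decode P. \<forall>s'\<in>set_decode (states_code P \<phi>). prod_encode (q, s') \<in> set_decode G \<longrightarrow>
           (\<forall>\<tau>\<in>set_decode (type_codes \<phi>). glob q \<tau> (sown s) \<longleftrightarrow> pst 0 q \<tau> (sown s')))))}"

definition machine_code :: "nat \<Rightarrow> nat \<Rightarrow> nat \<Rightarrow> nat" where
  "machine_code P \<Sigma> \<phi> = list_encode
     [image_code (\<lambda>p. prod_encode (p, states_code P \<phi>)) P,
      image_code (\<lambda>p. prod_encode (p, 0)) P,
      image_code (\<lambda>p. prod_encode (p, trans_codes P \<Sigma> \<phi> p)) P,
      msg_codes P \<phi>,
      acc_codes P \<phi>]"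

lemma RF_states_code [rf]: "RF f \<Longrightarrow> RF g \<Longrightarrow> RF (\<lambda>x. states_code (f x) (g x))"
proof -
  have "RF (\<lambda>x. states_code (pfst x) (psnd x))" unfolding states_code_def by (intro rf)
  from RF_comp[OF this, of "\<lambda>x. prod_encode (f x, g x)"]
  show "RF f \<Longrightarrow> RF g \<Longrightarrow> RF (\<lambda>x. states_code (f x) (g x))" by (simp add: rf)
qed

lemma RF_machine_code:
  "RF (\<lambda>x. machine_code (pfst x) (pfst (psnd x)) (psnd (psnd x)))"
  unfolding machine_code_def msg_codes_def trans_codes_def step_def acc_codes_def glob_def pst_def
  by (intro rf)

lemma recursive_machine_code: "recursive 3 (\<lambda>xs. machine_code (xs ! 0) (xs ! 1) (xs ! 2))"
proof -
  have "recursive 3 (\<lambda>xs. prod_encode (xs ! 0, prod_encode (xs ! 1, xs ! 2)))"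
    by (intro recursive_comp2[OF recursive_prod_encode] recursive.proj) auto
  from recursive_comp1[OF RF_machine_code[unfolded RF_def] this] show ?thesis by simp
qed

lemma set_encode_eqI: "finite A \<Longrightarrow> set_decode n = A \<Longrightarrow> set_encode A = n"
  by auto

text \<open>Identifies the computed number with the code of the actual machine. The essential point
  is the bijection between accepting functions and the graphs found by
  \<open>acc_codes\<close>.\<close>

lemma cfm_code_cfm: "cfm_code (set_decode P) (cfm P \<Sigma> \<phi>) = machine_code P \<Sigma> \<phi>"
proof -
  let ?Q = "set_decode (states_code P \<phi>)"
  let ?P = "set_decode P"
  have fc: "fun_code ?P f = image_code (\<lambda>p. prod_encode (p, f p)) P" for f
    unfolding fun_code_def by (rule set_encode_eqI) auto
  have tr: "set_encode (transition_code ` trans (cfm P \<Sigma> \<phi>) p) = trans_codes P \<Sigma> \<phi> p" for p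
  proof (rule set_encode_eqI)
    have code: "transition_code (s, step_action a s', s') = list_encode [s,
       if skind s' = 0 then list_encode [0, a]
       else if skind s' = 1 then list_encode [1, a, prod_encode (sown s', spartner s'), speer s']
       else list_encode [2, a, prod_encode (spartner s', sown s'), speer s'], s']" for s a s'
      by (simp add: transition_code_def source_def act_def target_def step_action_def)
    have tc: "set_decode (trans_codes P \<Sigma> \<phi> p) = {transition_code (s, step_action a s', s') |s a s'.
        s \<in> ?Q \<and> a \<in> set_decode \<Sigma> \<and> s' \<in> ?Q \<and> step P \<phi> p a s s'}"
    proof -
      have *: "set_decode (if b then set_encode {n} else 0) = {x. x = n \<and> b}" for b n by auto
      show ?thesis unfolding trans_codes_def set_decode_union_code * code by blast
    qed
    show "set_decode (trans_codes P \<Sigma> \<phi> p) = transition_code ` trans (cfm P \<Sigma> \<phi>) p"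
      unfolding tc by (auto simp: cfm_def)
    then show "finite (transition_code ` trans (cfm P \<Sigma> \<phi>) p)"
      using finite_set_decode[of "trans_codes P \<Sigma> \<phi> p"] by simp
  qed
  have ac: "set_encode (fun_code ?P ` acc (cfm P \<Sigma> \<phi>)) = acc_codes P \<phi>"
  proof -
    let ?A = "{G. G < Suc (union_code (\<lambda>p. image_code (\<lambda>s. prod_encode (p, s)) (states_code P \<phi>)) P) \<and>
     (\<forall>x\<in>set_decode G. pfst x \<in> ?P \<and> psnd x \<in> ?Q) \<and>
     (\<forall>p\<in>?P. \<exists>s\<in>?Q. prod_encode (p, s) \<in> set_decode G \<and>
       (\<forall>s'\<in>?Q. prod_encode (p, s') \<in> set_decode G \<longrightarrow> s' = s) \<and>
       (s \<noteq> 0 \<longrightarrow> bwd P \<phi> p (sown s) (s_out s) (speer s) 0 \<and>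
         (\<forall>q\<in>?P. \<forall>s'\<in>?Q. prod_encode (q, s') \<in> set_decode G \<longrightarrow>
           (\<forall>\<tau>\<in>set_decode (type_codes \<phi>). glob q \<tau> (sown s) \<longleftrightarrow> pst 0 q \<tau> (sown s')))))}"
    have "fun_code ?P ` acc (cfm P \<Sigma> \<phi>) = ?A"
    proof (intro equalityI subsetI)
      fix G assume "G \<in> fun_code ?P ` acc (cfm P \<Sigma> \<phi>)"
      then obtain f where f: "G = fun_code ?P f" "f \<in> (\<Pi>\<^sub>E p\<in>?P. ?Q)" "accepting P \<phi> f"
        by (auto simp: cfm_def)
      have G: "set_decode G = (\<lambda>p. prod_encode (p, f p)) ` ?P"
        unfolding f(1) fc by simp
      have Q: "f p \<in> ?Q" if "p \<in> ?P" for p using f(2) that by blast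
      have "G \<le> union_code (\<lambda>p. image_code (\<lambda>s. prod_encode (p, s)) (states_code P \<phi>)) P"
        by (rule subset_decode_imp_le) (use Q in \<open>auto simp: G\<close>)
      moreover have "\<exists>s\<in>?Q. prod_encode (p, s) \<in> set_decode G \<and>
       (\<forall>s'\<in>?Q. prod_encode (p, s') \<in> set_decode G \<longrightarrow> s' = s) \<and>
       (s \<noteq> 0 \<longrightarrow> bwd P \<phi> p (sown s) (s_out s) (speer s) 0 \<and>
         (\<forall>q\<in>?P. \<forall>s'\<in>?Q. prod_encode (q, s') \<in> set_decode G \<longrightarrow>
           (\<forall>\<tau>\<in>set_decode (type_codes \<phi>). glob q \<tau> (sown s) \<longleftrightarrow> pst 0 q \<tau> (sown s'))))"
        if "p \<in> ?P" for p
        using f(3) that Q unfolding accepting_def by (intro bexI[of _ "f p"]) (auto simp: G)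
      ultimately show "G \<in> ?A" using Q by (auto simp: G less_Suc_eq_le)
    next
      fix G assume G: "G \<in> ?A"
      \<comment> \<open>The state paired with p is unique by the choice of G; the restriction makes
        the function extensional, as the type of \<open>acc\<close> demands.\<close>
      define f where "f = restrict (\<lambda>p. SOME s. s \<in> ?Q \<and> prod_encode (p, s) \<in> set_decode G) ?P"
      have f: "f p \<in> ?Q" "prod_encode (p, f p) \<in> set_decode G" if "p \<in> ?P" for p
      proof -
        have "\<exists>s. s \<in> ?Q \<and> prod_encode (p, s) \<in> set_decode G" using G that by blast
        from someI_ex[OF this] show "f p \<in> ?Q" "prod_encode (p, f p) \<in> set_decode G"
          using that by (simp_all add: f_def)
      qed
      have u: "s = f p" if "p \<in> ?P" "s \<in> ?Q" "prod_encode (p, s) \<in> set_decode G" for p s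
        using that f[OF that(1)] G by blast
      have "x \<in> (\<lambda>p. prod_encode (p, f p)) ` ?P" if "x \<in> set_decode G" for x
      proof -
        have "pfst x \<in> ?P" "psnd x \<in> ?Q" using G that by blast+
        moreover from this have "psnd x = f (pfst x)" using that by (intro u) simp_all
        then have "x = prod_encode (pfst x, f (pfst x))" by (metis encode_pfst_psnd)
        ultimately show ?thesis by blast
      qed
      then have "set_decode G = (\<lambda>p. prod_encode (p, f p)) ` ?P" using f by blast
      then have "G = fun_code ?P f" unfolding fun_code_def by (metis set_decode_inverse)
      moreover have "accepting P \<phi> f"
        unfolding accepting_def
      proof (intro ballI impI)
        fix p assume p: "p \<in> ?P" "f p \<noteq> 0"
        have "\<exists>s\<in>?Q. prod_encode (p, s) \<in> set_decode G \<and>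
         (s \<noteq> 0 \<longrightarrow> bwd P \<phi> p (sown s) (s_out s) (speer s) 0 \<and>
           (\<forall>q\<in>?P. \<forall>s'\<in>?Q. prod_encode (q, s') \<in> set_decode G \<longrightarrow>
             (\<forall>\<tau>\<in>set_decode (type_codes \<phi>). glob q \<tau> (sown s) \<longleftrightarrow> pst 0 q \<tau> (sown s'))))"
          using G p(1) by blast
        then show "bwd P \<phi> p (sown (f p)) (s_out (f p)) (speer (f p)) 0 \<and>
          (\<forall>q\<in>?P. \<forall>\<tau>\<in>set_decode (type_codes \<phi>). glob q \<tau> (sown (f p)) \<longleftrightarrow> pst 0 q \<tau> (sown (f q)))"
          using u[OF p(1)] p(2) f by blast
      qed
      moreover have "f \<in> (\<Pi>\<^sub>E p\<in>?P. ?Q)" using f(1) by (auto simp: f_def)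
      ultimately show "G \<in> fun_code ?P ` acc (cfm P \<Sigma> \<phi>)" by (auto simp: cfm_def)
    qed
    then show ?thesis by (simp only: acc_codes_def)
  qed
  show ?thesis
    unfolding cfm_code_def machine_code_def tr ac by (simp add: fc cfm_def)
qed

subsection \<open>Runs as labellings\<close>

definition prv :: "nat event \<Rightarrow> nat event" where "prv e = (fst e, snd e - 1)"
definition nxt :: "nat event \<Rightarrow> nat event" where "nxt e = (fst e, Suc (snd e))"

definition in_lab :: "(nat, nat) msc \<Rightarrow> (nat event \<Rightarrow> nat) \<Rightarrow> nat event \<Rightarrow> nat" where
  "in_lab M L e = (if \<exists>z. (z, e) \<in> msg M then L (THE z. (z, e) \<in> msg M) else 0)"
definition out_lab :: "(nat, nat) msc \<Rightarrow> (nat event \<Rightarrow> nat) \<Rightarrow> nat event \<Rightarrow> nat" where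
  "out_lab M L e = (if \<exists>z. (e, z) \<in> msg M then L (THE z. (e, z) \<in> msg M) else 0)"
text \<open>The value for internal events only has to be some process of P, so that the
  corresponding state exists.\<close>

definition peer :: "(nat, nat) msc \<Rightarrow> nat event \<Rightarrow> nat" where
  "peer M e = (if \<exists>z. (z, e) \<in> msg M then fst (THE z. (z, e) \<in> msg M)
     else if \<exists>z. (e, z) \<in> msg M then fst (THE z. (e, z) \<in> msg M) else fst e)"

text \<open>What an accepting run amounts to once its states are reduced to labels. The guessed
  labels of partners are replaced by the actual ones, which M determines.\<close>

definition good :: "nat \<Rightarrow> nat \<Rightarrow> (nat, nat) msc \<Rightarrow> (nat event \<Rightarrow> nat) \<Rightarrow> bool" where
  "good P \<phi> M L \<longleftrightarrow>
     (\<forall>e. e \<notin> events (set_decode P) M \<longrightarrow> L e = 0) \<and>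
     (\<forall>e\<in>events (set_decode P) M. L e \<noteq> 0 \<and> set_decode (L e) \<subseteq> set_decode (field_codes P \<phi>) \<and>
        fwd P \<phi> (fst e) (letter M e) (L (prv e)) (L e) (in_lab M L e) (peer M e) \<and>
        bwd P \<phi> (fst e) (L e) (out_lab M L e) (peer M e) (L (nxt e))) \<and>
     (\<forall>p\<in>set_decode P. word M p \<noteq> [] \<longrightarrow>
        (\<forall>q\<in>set_decode P. \<forall>\<tau>\<in>set_decode (type_codes \<phi>).
          glob q \<tau> (L (p, length (word M p))) \<longleftrightarrow> pst 0 q \<tau> (L (q, length (word M q)))))"

context
  fixes P :: nat and \<Sigma> :: "nat set" and M :: "(nat, nat) msc"
  assumes msc: "is_msc (set_decode P) \<Sigma> M"
begin

lemma msg_unique: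
  assumes "(e, f) \<in> msg M" "(e', f') \<in> msg M" "{e, f} \<inter> {e', f'} \<noteq> {}"
  shows "e = e' \<and> f = f'"
proof -
  have *: "\<forall>(e, f)\<in>msg M. \<forall>(e', f')\<in>msg M. {e, f} \<inter> {e', f'} \<noteq> {} \<longrightarrow> (e, f) = (e', f')"
    using msc unfolding is_msc_def by (elim conjE)
  have "\<forall>x\<in>msg M. \<forall>y\<in>msg M. {fst x, snd x} \<inter> {fst y, snd y} \<noteq> {} \<longrightarrow> x = y"
    using * unfolding case_prod_beta prod.collapse .
  from this[rule_format, OF assms(1,2)] assms(3) show ?thesis by simp
qed

lemma msg_labs:
  assumes "(e, f) \<in> msg M"
  shows "in_lab M L f = L e" "out_lab M L f = 0" "peer M f = fst e"
    "out_lab M L e = L f" "in_lab M L e = 0" "peer M e = fst f"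
proof -
  have 1: "(THE z. (z, f) \<in> msg M) = e" and 2: "(THE z. (e, z) \<in> msg M) = f"
    using assms msg_unique by (blast intro: the_equality)+
  have 3: "\<not> (\<exists>z. (z, e) \<in> msg M)" "\<not> (\<exists>z. (f, z) \<in> msg M)"
  proof -
    have "e \<noteq> f" using msg_events(3)[OF msc assms] by auto
    then show "\<not> (\<exists>z. (z, e) \<in> msg M)" "\<not> (\<exists>z. (f, z) \<in> msg M)" using assms msg_unique by blast+
  qed
  show "in_lab M L f = L e" "out_lab M L f = 0" "peer M f = fst e"
    "out_lab M L e = L f" "in_lab M L e = 0" "peer M e = fst f"
    unfolding in_lab_def out_lab_def peer_def 1 2 using assms 3 by auto
qed

lemma internal_labs:
  assumes "internal_event M e"
  shows "in_lab M L e = 0" "out_lab M L e = 0" "peer M e = fst e"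
  using assms unfolding internal_event_def in_lab_def out_lab_def peer_def
  by (auto simp: Field_def Domain_iff Range_iff)

lemma not_internal: "\<not> internal_event M e \<Longrightarrow> (\<exists>f. (e, f) \<in> msg M) \<or> (\<exists>f. (f, e) \<in> msg M)"
  by (auto simp: internal_event_def Field_def Domain_iff Range_iff)

lemma in_events: "e \<in> events (set_decode P) M \<longleftrightarrow>
    fst e \<in> set_decode P \<and> 1 \<le> snd e \<and> snd e \<le> length (word M (fst e))"
  by (cases e) (auto simp: events_def events_of_def)

lemma good_if_lang:
  assumes "M \<in> cfm_lang (set_decode P) \<Sigma> (cfm P \<Sigma>' \<phi>)"
  shows "\<exists>L. good P \<phi> M L"
proof -
  let ?E = "events (set_decode P) M"
  obtain \<rho> where run: "is_run (set_decode P) (cfm P \<Sigma>' \<phi>) M \<rho>"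
    and acc: "restrict (final_state (cfm P \<Sigma>' \<phi>) M \<rho>) (set_decode P) \<in> acc (cfm P \<Sigma>' \<phi>)"
    using assms by (auto simp: cfm_lang_def)
  define S where "S e = (if e \<in> ?E then target (\<rho> e) else 0)" for e
  have tr: "\<rho> e \<in> trans (cfm P \<Sigma>' \<phi>) (fst e)" "label (act (\<rho> e)) = letter M e" if "e \<in> ?E" for e
    using run that unfolding is_run_def events_def events_of_def by auto
  have src: "source (\<rho> e) = S (prv e)" if e: "e \<in> ?E" for e
  proof (cases "snd e = 1")
    case True
    then have "prv e \<notin> ?E" by (simp add: in_events prv_def)
    moreover have "events_of M (fst e) \<noteq> {}" "e = (fst e, 1)" "fst e \<in> set_decode P"
      using e True by (auto simp: in_events events_of_def prod_eq_iff)
    then have "source (\<rho> e) = init (cfm P \<Sigma>' \<phi>) (fst e)" using run unfolding is_run_def by metis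
    ultimately show ?thesis by (simp add: S_def cfm_def)
  next
    case False
    then have "(prv e, e) \<in> proc_rel M" "prv e \<in> ?E"
      using e by (cases e; auto simp: in_events prv_def proc_rel_def)+
    then show ?thesis using run unfolding is_run_def S_def by auto
  qed
  have act: "act (\<rho> e) = step_action (letter M e) (S e)" and S: "S e \<in> set_decode (states_code P \<phi>)"
    and st: "step P \<phi> (fst e) (letter M e) (S (prv e)) (S e)" if e: "e \<in> ?E" for e
  proof -
    from tr(1)[OF e] obtain s a s' where t: "\<rho> e = (s, step_action a s', s')"
      "s' \<in> set_decode (states_code P \<phi>)" "step P \<phi> (fst e) a s s'"
      by (auto simp: cfm_def)
    have "a = letter M e" using tr(2)[OF e] t(1) by (auto simp: act_def step_action_def split: if_splits)
    moreover have "s' = S e" "s = S (prv e)" using src[OF e] t(1) e by (auto simp: S_def target_def source_def)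
    ultimately show "act (\<rho> e) = step_action (letter M e) (S e)" "S e \<in> set_decode (states_code P \<phi>)"
      "step P \<phi> (fst e) (letter M e) (S (prv e)) (S e)" using t by (auto simp: act_def)
  qed
  define L where "L e = sown (S e)" for e
  have L0: "L e = 0" if "e \<notin> ?E" for e using that by (simp add: L_def S_def)
  have msg: "skind (S e) = 1 \<and> skind (S f) \<noteq> 0 \<and> skind (S f) \<noteq> 1 \<and> speer (S e) = fst f \<and>
     speer (S f) = fst e \<and> spartner (S e) = L f \<and> spartner (S f) = L e" if ef: "(e, f) \<in> msg M" for e f
  proof -
    have E: "e \<in> ?E" "f \<in> ?E" using msg_events[OF msc ef] by auto
    obtain a b m where "act (\<rho> e) = Send a m (fst f)" "act (\<rho> f) = Receive b m (fst e)"
      using run ef unfolding is_run_def by blast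
    then show ?thesis using act[OF E(1)] act[OF E(2)]
      by (auto simp: step_action_def L_def split: if_splits)
  qed
  have int: "skind (S e) = 0" if e: "e \<in> ?E" "internal_event M e" for e
  proof -
    have "\<forall>e\<in>?E. internal_event M e \<longrightarrow> (\<exists>a. act (\<rho> e) = Internal a)"
      using run unfolding is_run_def by (elim conjE)
    then obtain a where "act (\<rho> e) = Internal a" using e by blast
    then show ?thesis using act[OF e(1)] by (auto simp: step_action_def split: if_splits)
  qed
  have io: "s_in (S e) = in_lab M L e \<and> s_out (S e) = out_lab M L e \<and> (\<not> internal_event M e \<longrightarrow> speer (S e) = peer M e)"
    if "e \<in> ?E" for e
  proof (cases "internal_event M e")
    case True
    then show ?thesis using int[OF that] internal_labs by (simp add: s_in_def s_out_def)
  next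
    case False
    then show ?thesis using not_internal msg msg_labs by (fastforce simp: s_in_def s_out_def)
  qed
  \<comment> \<open>At an internal event the process stored in the state is arbitrary. Without a
    partner label the conditions do not look at it, so it may be exchanged for
    \<open>peer M e\<close>.\<close>
  have r_irrel: "fwd P \<phi> p a x y 0 r \<longleftrightarrow> fwd P \<phi> p a x y 0 r'" "bwd P \<phi> p x 0 r y \<longleftrightarrow> bwd P \<phi> p x 0 r' y"
    for p a x y r r'
    by (simp_all add: fwd_def fwd_tok_def bwd_def bwd_tok_def)
  have F: "fwd P \<phi> (fst e) (letter M e) (L (prv e)) (L e) (in_lab M L e) (peer M e)" if "e \<in> ?E" for e
    using st[OF that] io[OF that] r_irrel(1) internal_labs unfolding step_def L_def[symmetric] by metis
  have B: "bwd P \<phi> (fst e) (L e) (out_lab M L e) (peer M e) x"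
    if "e \<in> ?E" "bwd P \<phi> (fst e) (sown (S e)) (s_out (S e)) (speer (S e)) x" for e x
    using that io[OF that(1)] r_irrel(2) internal_labs unfolding L_def[symmetric] by metis
  have last: "final_state (cfm P \<Sigma>' \<phi>) M \<rho> p = S (p, length (word M p))" if "p \<in> set_decode P" for p
    using that by (auto simp: final_state_def S_def in_events events_of_def cfm_def Suc_le_eq)
  have ok: "accepting P \<phi> (restrict (final_state (cfm P \<Sigma>' \<phi>) M \<rho>) (set_decode P))"
    using acc by (simp add: cfm_def)
  have nz: "S e \<noteq> 0" "L e \<noteq> 0" if "e \<in> ?E" for e
    using st[OF that] sown_0 unfolding step_def L_def by metis+
  have lastE: "(p, length (word M p)) \<in> ?E" if "p \<in> set_decode P" "word M p \<noteq> []" for p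
    using that by (auto simp: in_events Suc_le_eq)
  have "good P \<phi> M L"
    unfolding good_def
  proof (intro conjI allI ballI impI)
    fix e assume e: "e \<in> ?E"
    show "L e \<noteq> 0" using nz e by blast
    show "set_decode (L e) \<subseteq> set_decode (field_codes P \<phi>)"
      using S[OF e] nz[OF e] by (auto simp: set_decode_states_code L_def)
    show "fwd P \<phi> (fst e) (letter M e) (L (prv e)) (L e) (in_lab M L e) (peer M e)" by (rule F[OF e])
    show "bwd P \<phi> (fst e) (L e) (out_lab M L e) (peer M e) (L (nxt e))"
    proof (rule B[OF e])
      show "bwd P \<phi> (fst e) (sown (S e)) (s_out (S e)) (speer (S e)) (L (nxt e))"
      \<comment> \<open>The next transition checks the condition, or else acceptance does, with 0 in
        place of the missing label.\<close>
      proof (cases "nxt e \<in> ?E")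
        case True
        then have "prv (nxt e) = e" "fst (nxt e) = fst e" by (auto simp: prv_def nxt_def)
        then show ?thesis using st[OF True] nz[OF e] by (simp add: step_def L_def)
      next
        case False
        then have "snd e = length (word M (fst e))" "fst e \<in> set_decode P"
          using e by (auto simp: in_events nxt_def)
        then have "S e = final_state (cfm P \<Sigma>' \<phi>) M \<rho> (fst e)" using last[of "fst e"] by (metis prod.collapse)
        then show ?thesis
          using ok nz[OF e] L0[OF False] \<open>fst e \<in> set_decode P\<close> by (auto simp: accepting_def)
      qed
    qed
  next
    fix p q \<tau> assume p: "p \<in> set_decode P" "word M p \<noteq> []" "q \<in> set_decode P" "\<tau> \<in> set_decode (type_codes \<phi>)"
    then show "glob q \<tau> (L (p, length (word M p))) \<longleftrightarrow> pst 0 q \<tau> (L (q, length (word M q)))"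
      using ok nz(1)[OF lastE[OF p(1,2)]] last[of p] last[of q] by (auto simp: accepting_def L_def)
  qed (use L0 in blast)
  then show ?thesis by blast
qed

lemma lang_if_good:
  assumes L: "good P \<phi> M L" and \<Sigma>: "set_decode \<Sigma>' = \<Sigma>"
  shows "M \<in> cfm_lang (set_decode P) \<Sigma> (cfm P \<Sigma>' \<phi>)"
proof -
  let ?E = "events (set_decode P) M"
  \<comment> \<open>For internal events \<open>out_lab\<close> is 0, so they store the empty label
    as that of their partner.\<close>
  define S where "S e = (if e \<in> ?E then state_code
      (if \<exists>z. (z, e) \<in> msg M then 2 else if \<exists>z. (e, z) \<in> msg M then 1 else 0) (peer M e) (L e)
      (if \<exists>z. (z, e) \<in> msg M then in_lab M L e else out_lab M L e) else 0)" for e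
  define \<rho> where "\<rho> e = (S (prv e), step_action (letter M e) (S e), S e)" for e
  have L0: "L e = 0" if "e \<notin> ?E" for e using L that unfolding good_def by blast
  have own: "sown (S e) = L e" for e by (simp add: S_def L0)
  have msg: "skind (S e) = 1 \<and> skind (S f) = 2 \<and> speer (S e) = fst f \<and>
     speer (S f) = fst e \<and> spartner (S e) = L f \<and> spartner (S f) = L e \<and> fst e \<noteq> fst f"
    if ef: "(e, f) \<in> msg M" for e f
  proof -
    have E: "e \<in> ?E" "f \<in> ?E" "fst e \<noteq> fst f" using msg_events[OF msc ef] by auto
    have "\<not> (\<exists>z. (z, e) \<in> msg M)"
    proof
      assume "\<exists>z. (z, e) \<in> msg M"
      then obtain z where "(z, e) \<in> msg M" by blast
      then show False using msg_unique[OF ef] E(3) by blast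
    qed
    then show ?thesis using E ef msg_labs[OF ef] by (auto simp: S_def)
  qed
  have int: "skind (S e) = 0 \<and> s_in (S e) = 0 \<and> s_out (S e) = 0 \<and> speer (S e) = fst e"
    if "e \<in> ?E" "internal_event M e" for e
    using that internal_labs[OF that(2)]
    by (auto simp: S_def s_in_def s_out_def internal_event_def Field_def Domain_iff Range_iff)
  have io: "s_in (S e) = in_lab M L e \<and> s_out (S e) = out_lab M L e \<and> speer (S e) = peer M e \<and>
      (skind (S e) = 0 \<or> speer (S e) \<noteq> fst e)"
    if "e \<in> ?E" for e
  proof (cases "internal_event M e")
    case True
    then show ?thesis using int[OF that] internal_labs by simp
  next
    case False
    then show ?thesis using not_internal msg msg_labs by (fastforce simp: s_in_def s_out_def)
  qed
  have lab: "L e \<noteq> 0" "set_decode (L e) \<subseteq> set_decode (field_codes P \<phi>)"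
    "fwd P \<phi> (fst e) (letter M e) (L (prv e)) (L e) (in_lab M L e) (peer M e)"
    "bwd P \<phi> (fst e) (L e) (out_lab M L e) (peer M e) (L (nxt e))" if "e \<in> ?E" for e
    using L that unfolding good_def by blast+
  have sub: "set_decode (L e) \<subseteq> set_decode (field_codes P \<phi>)" for e
    by (cases "e \<in> ?E") (simp_all add: lab L0)
  have Q: "S e \<in> set_decode (states_code P \<phi>)" for e
  proof (cases "e \<in> ?E")
    case True
    have "peer M e \<in> set_decode P"
    proof (cases "internal_event M e")
      case True
      then show ?thesis using \<open>e \<in> ?E\<close> internal_labs by (simp add: in_events)
    next
      case False
      then show ?thesis using not_internal msg_labs msg_events[OF msc] by (metis in_events)
    qed
    moreover have "set_decode (in_lab M L e) \<subseteq> set_decode (field_codes P \<phi>)"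
      "set_decode (out_lab M L e) \<subseteq> set_decode (field_codes P \<phi>)"
      using sub by (simp_all add: in_lab_def out_lab_def)
    ultimately show ?thesis
      using True sub[of e] unfolding set_decode_states_code S_def
      by (intro insertI2 CollectI exI conjI, simp) auto
  qed (simp add: S_def set_decode_states_code)
  have lett: "letter M e \<in> set_decode \<Sigma>'" if "e \<in> ?E" for e
  proof -
    have "\<forall>p\<in>set_decode P. word M p \<in> lists \<Sigma>" using msc unfolding is_msc_def by (elim conjE)
    then have "set (word M (fst e)) \<subseteq> \<Sigma>" using that by (auto simp: in_events)
    then show ?thesis using that nth_mem[of "snd e - 1" "word M (fst e)"]
      unfolding letter_def \<Sigma> by (auto simp: in_events)
  qed
  have st: "step P \<phi> (fst e) (letter M e) (S (prv e)) (S e)" if e: "e \<in> ?E" for e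
  proof -
    have "bwd P \<phi> (fst e) (L (prv e)) (s_out (S (prv e))) (speer (S (prv e))) (L e)" if "S (prv e) \<noteq> 0"
    proof -
      have "prv e \<in> ?E" using that by (metis S_def)
      moreover have "nxt (prv e) = e" "fst (prv e) = fst e" using e by (auto simp: nxt_def prv_def in_events)
      ultimately show ?thesis using lab(4)[of "prv e"] io[of "prv e"] by simp
    qed
    then show ?thesis using lab[OF e] io[OF e] by (auto simp: step_def own)
  qed
  have "is_run (set_decode P) (cfm P \<Sigma>' \<phi>) M \<rho>"
    unfolding is_run_def
  proof (intro conjI ballI impI)
    fix p e assume "p \<in> set_decode P" "e \<in> events_of M p"
    then have e: "e \<in> ?E" "fst e = p" by (auto simp: events_def events_of_def)
    then show "\<rho> e \<in> trans (cfm P \<Sigma>' \<phi>) p"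
      using Q[of e] Q[of "prv e"] st[OF e(1)] lett[OF e(1)] by (auto simp: cfm_def \<rho>_def)
    show "label (act (\<rho> e)) = letter M e" by (simp add: \<rho>_def act_def step_action_def)
  next
    fix p
    have "S (p, 0) = 0" by (simp add: S_def in_events)
    then show "source (\<rho> (p, 1)) = init (cfm P \<Sigma>' \<phi>) p"
      by (simp add: \<rho>_def source_def cfm_def prv_def)
  next
    fix x assume "x \<in> proc_rel M"
    then show "case x of (e, f) \<Rightarrow> target (\<rho> e) = source (\<rho> f)"
      by (auto simp: proc_rel_def \<rho>_def target_def source_def prv_def)
  next
    fix e assume "e \<in> ?E" "internal_event M e"
    then show "\<exists>a. act (\<rho> e) = Internal a" using int by (simp add: \<rho>_def act_def step_action_def)
  next
    fix x assume "x \<in> msg M"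
    then show "case x of (e, f) \<Rightarrow> \<exists>a b m. act (\<rho> e) = Send a m (fst f) \<and> act (\<rho> f) = Receive b m (fst e)"
      using msg by (auto simp: \<rho>_def act_def step_action_def own)
  qed
  moreover have "restrict (final_state (cfm P \<Sigma>' \<phi>) M \<rho>) (set_decode P) \<in> acc (cfm P \<Sigma>' \<phi>)"
  proof -
    have last: "final_state (cfm P \<Sigma>' \<phi>) M \<rho> p = S (p, length (word M p))" if "p \<in> set_decode P" for p
      using that
      by (auto simp: final_state_def S_def in_events events_of_def cfm_def Suc_le_eq \<rho>_def target_def)
    have "accepting P \<phi> (restrict (final_state (cfm P \<Sigma>' \<phi>) M \<rho>) (set_decode P))"
      unfolding accepting_def
    proof (intro ballI impI)
      fix p assume p: "p \<in> set_decode P" "restrict (final_state (cfm P \<Sigma>' \<phi>) M \<rho>) (set_decode P) p \<noteq> 0"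
      let ?e = "(p, length (word M p))"
      have "S ?e \<noteq> 0" using p last by simp
      then have e: "?e \<in> ?E" by (metis S_def)
      then have "word M p \<noteq> []" by (auto simp: in_events)
      then have "\<forall>q\<in>set_decode P. \<forall>\<tau>\<in>set_decode (type_codes \<phi>). glob q \<tau> (L ?e) \<longleftrightarrow>
          pst 0 q \<tau> (L (q, length (word M q)))"
        using L p(1) unfolding good_def by blast
      moreover have "L (nxt ?e) = 0" by (rule L0) (simp add: nxt_def in_events)
      ultimately show "bwd P \<phi> p (sown (restrict (final_state (cfm P \<Sigma>' \<phi>) M \<rho>) (set_decode P) p))
         (s_out (restrict (final_state (cfm P \<Sigma>' \<phi>) M \<rho>) (set_decode P) p))
         (speer (restrict (final_state (cfm P \<Sigma>' \<phi>) M \<rho>) (set_decode P) p)) 0 \<and>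
        (\<forall>q\<in>set_decode P. \<forall>\<tau>\<in>set_decode (type_codes \<phi>).
            glob q \<tau> (sown (restrict (final_state (cfm P \<Sigma>' \<phi>) M \<rho>) (set_decode P) p)) \<longleftrightarrow>
            pst 0 q \<tau> (sown (restrict (final_state (cfm P \<Sigma>' \<phi>) M \<rho>) (set_decode P) q)))"
        using lab(4)[OF e] io[OF e] p(1) last by (simp add: own)
    qed
    then show ?thesis using last Q by (auto simp: cfm_def)
  qed
  ultimately show ?thesis using msc by (auto simp: cfm_lang_def)
qed

end

section \<open>Labellings describe the order\<close>

locale chart =
  fixes P :: nat and \<Sigma> :: "nat set" and M :: "(nat, nat) msc"
  assumes msc: "is_msc (set_decode P) \<Sigma> M"
begin

abbreviation E :: "nat event set" where "E \<equiv> events (set_decode P) M"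
definition before :: "nat event \<Rightarrow> nat event \<Rightarrow> bool" where
  "before e f \<longleftrightarrow> fst e = fst f \<and> snd e < snd f"

lemmas in_E = in_events[OF msc]

lemma proc_rel_iff: "(e, f) \<in> proc_rel M \<longleftrightarrow> e = prv f \<and> e \<in> E \<and> f \<in> E"
proof -
  have "word M p = []" if "p \<notin> set_decode P" for p
    using msc that unfolding is_msc_def by (elim conjE) blast
  then have "p \<in> set_decode P" if "i < length (word M p)" for p i using that by fastforce
  then show ?thesis
    by (cases e; cases f) (auto simp: proc_rel_def in_E prv_def)
qed

lemma proc_rel_nxt: "(e, f) \<in> proc_rel M \<longleftrightarrow> f = nxt e \<and> e \<in> E \<and> f \<in> E"
  by (cases e; cases f) (auto simp: proc_rel_iff in_E prv_def nxt_def)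

lemma proc_rel_rtrancl:
  assumes "e \<in> E" "f \<in> E"
  shows "(e, f) \<in> (proc_rel M)\<^sup>* \<longleftrightarrow> fst e = fst f \<and> snd e \<le> snd f"
proof
  assume "(e, f) \<in> (proc_rel M)\<^sup>*"
  then show "fst e = fst f \<and> snd e \<le> snd f"
    by (induction rule: rtrancl_induct) (auto simp: proc_rel_nxt nxt_def)
next
  have "(e, (fst e, snd e + k)) \<in> (proc_rel M)\<^sup>*" if "(fst e, snd e + k) \<in> E" for k
    using that
  proof (induction k)
    case (Suc k)
    have "((fst e, snd e + k), (fst e, snd e + Suc k)) \<in> proc_rel M"
      using Suc.prems assms by (auto simp: proc_rel_nxt in_E nxt_def)
    then show ?case using Suc proc_rel_nxt by (meson rtrancl.rtrancl_into_rtrancl)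
  qed simp
  from this[of "snd f - snd e"]
  show "(e, f) \<in> (proc_rel M)\<^sup>*" if "fst e = fst f \<and> snd e \<le> snd f"
    using that assms by (metis le_add_diff_inverse prod.collapse)
qed

text \<open>An equivalence, because each direction of time uses one implication: from receive events
  to send events for \<open>F\<close>, and conversely for \<open>B\<close>.\<close>

lemma fifo_before:
  assumes "(e, f) \<in> msg M" "(e', f') \<in> msg M" "fst e = fst e'" "fst f = fst f'"
  shows "before e e' \<longleftrightarrow> before f f'"
proof -
  have ev: "e \<in> E" "f \<in> E" "e' \<in> E" "f' \<in> E" "fst e \<noteq> fst f"
    using msg_events[OF msc] assms by blast+
  have "\<forall>p\<in>set_decode P. \<forall>q\<in>set_decode P - {p}.
        \<forall>(e, f)\<in>msg M \<inter> (events_of M p \<times> events_of M q).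
        \<forall>(e', f')\<in>msg M \<inter> (events_of M p \<times> events_of M q).
          (e, e') \<in> (proc_rel M)\<^sup>* \<longleftrightarrow> (f, f') \<in> (proc_rel M)\<^sup>*"
    using msc unfolding is_msc_def by (elim conjE)
  then have *: "\<forall>p\<in>set_decode P. \<forall>q\<in>set_decode P - {p}.
        \<forall>x\<in>msg M \<inter> (events_of M p \<times> events_of M q).
        \<forall>y\<in>msg M \<inter> (events_of M p \<times> events_of M q).
          (fst x, fst y) \<in> (proc_rel M)\<^sup>* \<longleftrightarrow> (snd x, snd y) \<in> (proc_rel M)\<^sup>*"
    unfolding case_prod_beta .
  have mem: "x \<in> events_of M (fst x)" if "x \<in> E" for x
    using that by (cases x) (auto simp: events_of_def in_E)
  have "(e, e') \<in> (proc_rel M)\<^sup>* \<longleftrightarrow> (f, f') \<in> (proc_rel M)\<^sup>*"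
    using *[rule_format, of "fst e" "fst f" "(e, f)" "(e', f')"] mem[of e] mem[of f] mem[of e'] mem[of f'] ev assms
    by (auto simp: in_E)
  moreover have "e = e' \<longleftrightarrow> f = f'" using msg_unique[OF msc assms(1,2)] by blast
  ultimately show ?thesis
    using proc_rel_rtrancl[of e e'] proc_rel_rtrancl[of f f'] ev assms(3,4)
    by (auto simp: before_def prod_eq_iff)
qed

lemma finite_E: "finite E"
  by (simp add: events_def events_of_def)

lemma edges_F: "{(prv e, e) | e. e \<in> E \<and> prv e \<in> E} \<union> msg M = proc_rel M \<union> msg M"
proof -
  have "(x, y) \<in> {(prv e, e) | e. e \<in> E \<and> prv e \<in> E} \<longleftrightarrow> (x, y) \<in> proc_rel M" for x y
    unfolding mem_Collect_eq proc_rel_iff prod.inject by blast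
  then have "{(prv e, e) | e. e \<in> E \<and> prv e \<in> E} = proc_rel M" by (intro equalityI subrelI) blast+
  then show ?thesis by simp
qed

lemma edges_B: "{(nxt e, e) | e. e \<in> E \<and> nxt e \<in> E} \<union> (msg M)\<inverse> = (proc_rel M \<union> msg M)\<inverse>"
proof -
  have "(x, y) \<in> {(nxt e, e) | e. e \<in> E \<and> nxt e \<in> E} \<longleftrightarrow> (x, y) \<in> (proc_rel M)\<inverse>" for x y
    unfolding mem_Collect_eq converse_iff proc_rel_nxt prod.inject by blast
  then have "{(nxt e, e) | e. e \<in> E \<and> nxt e \<in> E} = (proc_rel M)\<inverse>" by (intro equalityI subrelI) blast+
  then show ?thesis by (simp add: converse_Un)
qed

sublocale F: chart_order E fst before prv "msg M"
proof
  show "e \<in> E \<Longrightarrow> f \<in> E \<Longrightarrow> before f e \<longleftrightarrow> prv e \<in> E \<and> (f = prv e \<or> before f (prv e))" for e f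
    by (cases e; cases f) (auto simp: before_def prv_def in_E)
  show "acyclic ({(prv e, e) | e. e \<in> E \<and> prv e \<in> E} \<union> msg M)"
    unfolding edges_F by (rule acyclic_edges[OF msc])
  show "(z, y) \<in> msg M \<Longrightarrow> (z', y') \<in> msg M \<Longrightarrow> fst z = fst z' \<Longrightarrow> before y' y \<Longrightarrow> before z' z"
    for z y z' y'
    using fifo_before[of z' y' z y] by (auto simp: before_def)
  show "(z, y) \<in> msg M \<Longrightarrow> (z', y) \<in> msg M \<Longrightarrow> z = z'"
    "(z, y) \<in> msg M \<Longrightarrow> (z, y') \<in> msg M \<Longrightarrow> y = y'" for z y z' y'
    using msg_unique[OF msc] by blast+
qed (use finite_E msg_events[OF msc] in \<open>auto simp: before_def prod_eq_iff\<close>)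

text \<open>The time reversal of \<open>F\<close>, which turns every result about the past into one
  about the future.\<close>

sublocale B: chart_order E fst "\<lambda>e f. before f e" nxt "(msg M)\<inverse>"
proof
  show "e \<in> E \<Longrightarrow> f \<in> E \<Longrightarrow> before e f \<longleftrightarrow> nxt e \<in> E \<and> (f = nxt e \<or> before (nxt e) f)" for e f
    by (cases e; cases f) (auto simp: before_def nxt_def in_E)
  show "acyclic ({(nxt e, e) | e. e \<in> E \<and> nxt e \<in> E} \<union> (msg M)\<inverse>)"
    unfolding edges_B acyclic_converse by (rule acyclic_edges[OF msc])
  show "(z, y) \<in> (msg M)\<inverse> \<Longrightarrow> (z', y') \<in> (msg M)\<inverse> \<Longrightarrow> fst z = fst z' \<Longrightarrow> before y y' \<Longrightarrow> before z z'"
    for z y z' y'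
    using fifo_before[of y z y' z'] by (auto simp: before_def)
  show "(z, y) \<in> (msg M)\<inverse> \<Longrightarrow> (z', y) \<in> (msg M)\<inverse> \<Longrightarrow> z = z'"
    "(z, y) \<in> (msg M)\<inverse> \<Longrightarrow> (z, y') \<in> (msg M)\<inverse> \<Longrightarrow> y = y'" for z y z' y'
    using msg_unique[OF msc] by blast+
  show "(z, y) \<in> (msg M)\<inverse> \<Longrightarrow> z \<in> E \<and> y \<in> E \<and> fst z \<noteq> fst y" for z y
    using msg_events[OF msc, of y z] by auto
qed (use finite_E in \<open>auto simp: before_def prod_eq_iff\<close>)

lemma FD: "F.D = proc_rel M \<union> msg M"
  unfolding F.D_def edges_F ..

lemma BD: "B.D = F.D\<inverse>"
  unfolding B.D_def edges_B FD ..

lemma BD_iff [simp]: "(x, y) \<in> B.D \<longleftrightarrow> (y, x) \<in> F.D"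
  "(x, y) \<in> B.D\<^sup>* \<longleftrightarrow> (y, x) \<in> F.D\<^sup>*" "(x, y) \<in> B.D\<^sup>+ \<longleftrightarrow> (y, x) \<in> F.D\<^sup>+"
  by (simp_all add: BD rtrancl_converse trancl_converse)

lemma causal: "causal M = F.D\<^sup>*"
  by (simp add: causal_def FD)

lemma rel_iff:
  "rel M e f = 5 \<longleftrightarrow> (e, f) \<in> F.D\<^sup>+ \<and> (e, f) \<notin> F.D"
  "rel M e f = 6 \<longleftrightarrow> (f, e) \<in> F.D\<^sup>+ \<and> (f, e) \<notin> F.D"
  "rel M e f = 7 \<longleftrightarrow> (e, f) \<notin> F.D\<^sup>* \<and> (f, e) \<notin> F.D\<^sup>*"
proof -
  have 1: "(f, e) \<in> F.D \<Longrightarrow> (e, f) \<in> F.D\<^sup>+ \<Longrightarrow> False" "(e, f) \<in> F.D \<Longrightarrow> (f, e) \<in> F.D\<^sup>+ \<Longrightarrow> False"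
    "(e, e) \<in> F.D\<^sup>+ \<Longrightarrow> False" "(f, e) \<in> F.D\<^sup>+ \<Longrightarrow> (e, f) \<in> F.D\<^sup>+ \<Longrightarrow> False"
    using F.lt_irrefl by (meson r_into_trancl trancl_trans)+
  show "rel M e f = 5 \<longleftrightarrow> (e, f) \<in> F.D\<^sup>+ \<and> (e, f) \<notin> F.D"
    "rel M e f = 6 \<longleftrightarrow> (f, e) \<in> F.D\<^sup>+ \<and> (f, e) \<notin> F.D"
    "rel M e f = 7 \<longleftrightarrow> (e, f) \<notin> F.D\<^sup>* \<and> (f, e) \<notin> F.D\<^sup>*"
    unfolding rel_def causal rtrancl_eq_or_trancl using 1 r_into_trancl[of _ F.D]
    by (auto simp: FD)
qed

section \<open>The local bits and their intended meaning\<close>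

definition sem_pst :: "nat event set \<Rightarrow> nat \<Rightarrow> nat event \<Rightarrow> bool" where
  "sem_pst A k e \<longleftrightarrow> (\<exists>f\<in>A. (f, e) \<in> F.D\<^sup>* \<and>
     (k = 0 \<or> k = 1 \<and> (\<exists>g\<in>A. before g f) \<or> k = 2 \<and> \<not> (\<exists>g\<in>A. before f g)))"

definition sem_fut :: "nat event set \<Rightarrow> nat \<Rightarrow> nat event \<Rightarrow> bool" where
  "sem_fut A k e \<longleftrightarrow> (\<exists>f\<in>A. (e, f) \<in> F.D\<^sup>* \<and>
     (k = 0 \<or> k = 1 \<and> (\<exists>g\<in>A. before f g) \<or> k = 2 \<and> \<not> (\<exists>g\<in>A. before g f)))"

text \<open>A missing partner reads as label 0, where X fails, so inspecting the incoming label
  amounts to an existential statement about messages.\<close>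

lemma at_in_lab: "\<not> X 0 \<Longrightarrow> X (in_lab M L e) \<longleftrightarrow> (\<exists>z. (z, e) \<in> msg M \<and> X (L z))"
proof (cases "\<exists>z. (z, e) \<in> msg M")
  case True
  then obtain z where z: "(z, e) \<in> msg M" by blast
  then show ?thesis unfolding msg_labs(1)[OF msc z] using F.m_inj[OF z] by metis
qed (auto simp: in_lab_def)

lemma at_out_lab: "\<not> X 0 \<Longrightarrow> X (out_lab M L e) \<longleftrightarrow> (\<exists>z. (e, z) \<in> msg M \<and> X (L z))"
proof (cases "\<exists>z. (e, z) \<in> msg M")
  case True
  then obtain z where z: "(e, z) \<in> msg M" by blast
  then show ?thesis unfolding msg_labs(4)[OF msc z] using F.m_fun[OF z] by metis
qed (auto simp: out_lab_def)

lemma fields_0 [simp]: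
  "\<not> isA q \<tau> 0" "\<not> obs k q \<tau> 0" "\<not> pst k q \<tau> 0" "\<not> fut k q \<tau> 0" "\<not> bas k q \<tau> 0" "\<not> glob q \<tau> 0"
  "\<not> line d p q \<tau> 0" "\<not> tok c q \<tau> \<pi> \<pi>' \<rho> 0" "\<not> tok' c q \<tau> \<pi> \<pi>' \<rho> 0"
  by (simp_all add: field_defs)

text \<open>Relation 7 is absent because the local equations do not determine it; it is the subject
  of \<open>parallel_sound\<close> and \<open>parallel_complete\<close>.\<close>

definition sem_bits :: "(nat event \<Rightarrow> nat) \<Rightarrow> nat \<Rightarrow> nat \<Rightarrow> nat event set \<Rightarrow> nat event \<Rightarrow> bool" where
  "sem_bits L q \<tau> A e \<longleftrightarrow>
     (\<forall>k<3. (pst k q \<tau> (L e) \<longleftrightarrow> sem_pst A k e) \<and> (fut k q \<tau> (L e) \<longleftrightarrow> sem_fut A k e)) \<and>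
     (bas 0 q \<tau> (L e) \<longleftrightarrow> e \<in> A \<and> (\<exists>g\<in>A. before g e)) \<and>
     (bas 1 q \<tau> (L e) \<longleftrightarrow> e \<in> A \<and> (\<exists>g\<in>A. before e g)) \<and>
     (\<forall>k<7. obs k q \<tau> (L e) \<longleftrightarrow> (\<exists>f\<in>A. rel M e f = k))"

context
  fixes L :: "nat event \<Rightarrow> nat" and q \<tau> :: nat and A :: "nat event set"
  assumes L0: "\<And>e. e \<notin> E \<Longrightarrow> L e = 0"
    and A: "\<And>e. isA q \<tau> (L e) \<longleftrightarrow> e \<in> A" and AE: "A \<subseteq> E" and Aq: "\<And>e. e \<in> A \<Longrightarrow> fst e = q"
begin

lemma obs_iff:
  assumes e: "e \<in> E"
  shows "(\<exists>f\<in>A. rel M e f = 0) \<longleftrightarrow> e \<in> A"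
    "(\<exists>f\<in>A. rel M e f = Suc 0) \<longleftrightarrow> nxt e \<in> A"
    "(\<exists>f\<in>A. rel M e f = 2) \<longleftrightarrow> prv e \<in> A"
    "(\<exists>f\<in>A. rel M e f = 3) \<longleftrightarrow> (\<exists>z. (e, z) \<in> msg M \<and> z \<in> A)"
    "(\<exists>f\<in>A. rel M e f = 4) \<longleftrightarrow> (\<exists>z. (z, e) \<in> msg M \<and> z \<in> A)"
    "(\<exists>f\<in>A. rel M e f = 5) \<longleftrightarrow>
      ((\<exists>f\<in>A. nxt e \<in> E \<and> (nxt e, f) \<in> F.D\<^sup>* \<and> (\<exists>g\<in>A. before f g)) \<or>
       (\<exists>z. (e, z) \<in> msg M \<and> (\<exists>f\<in>A. (z, f) \<in> F.D\<^sup>* \<and> (\<exists>g\<in>A. before f g)))) \<or>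
      ((\<exists>f\<in>A. nxt e \<in> E \<and> (nxt e, f) \<in> F.D\<^sup>*) \<or> (\<exists>z. (e, z) \<in> msg M \<and> (\<exists>f\<in>A. (z, f) \<in> F.D\<^sup>*))) \<and>
      nxt e \<notin> A \<and> \<not> (\<exists>z. (e, z) \<in> msg M \<and> z \<in> A)"
    "(\<exists>f\<in>A. rel M e f = 6) \<longleftrightarrow>
      ((\<exists>f\<in>A. prv e \<in> E \<and> (f, prv e) \<in> F.D\<^sup>* \<and> (\<exists>g\<in>A. before g f)) \<or>
       (\<exists>z. (z, e) \<in> msg M \<and> (\<exists>f\<in>A. (f, z) \<in> F.D\<^sup>* \<and> (\<exists>g\<in>A. before g f)))) \<or>
      ((\<exists>f\<in>A. prv e \<in> E \<and> (f, prv e) \<in> F.D\<^sup>*) \<or> (\<exists>z. (z, e) \<in> msg M \<and> (\<exists>f\<in>A. (f, z) \<in> F.D\<^sup>*))) \<and>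
      prv e \<notin> A \<and> \<not> (\<exists>z. (z, e) \<in> msg M \<and> z \<in> A)"
proof -
  have "(\<exists>f\<in>A. (e, f) \<in> proc_rel M) \<longleftrightarrow> nxt e \<in> A"
    unfolding proc_rel_nxt using e AE by blast
  moreover have "(\<exists>f\<in>A. (f, e) \<in> proc_rel M) \<longleftrightarrow> prv e \<in> A"
    unfolding proc_rel_iff using e AE by blast
  ultimately show "(\<exists>f\<in>A. rel M e f = 0) \<longleftrightarrow> e \<in> A"
    "(\<exists>f\<in>A. rel M e f = Suc 0) \<longleftrightarrow> nxt e \<in> A"
    "(\<exists>f\<in>A. rel M e f = 2) \<longleftrightarrow> prv e \<in> A"
    "(\<exists>f\<in>A. rel M e f = 3) \<longleftrightarrow> (\<exists>z. (e, z) \<in> msg M \<and> z \<in> A)"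
    "(\<exists>f\<in>A. rel M e f = 4) \<longleftrightarrow> (\<exists>z. (z, e) \<in> msg M \<and> z \<in> A)"
    unfolding rel_simps[OF msc] by blast+
  have F: "(z, e) \<in> F.D \<longleftrightarrow> z = prv e \<and> prv e \<in> E \<or> (z, e) \<in> msg M"
    and B: "(e, z) \<in> F.D \<longleftrightarrow> z = nxt e \<and> nxt e \<in> E \<or> (e, z) \<in> msg M" for z
    using e F.D_iff[of z e] B.D_iff[of z e] by auto
  show "(\<exists>f\<in>A. rel M e f = 6) \<longleftrightarrow>
      ((\<exists>f\<in>A. prv e \<in> E \<and> (f, prv e) \<in> F.D\<^sup>* \<and> (\<exists>g\<in>A. before g f)) \<or>
       (\<exists>z. (z, e) \<in> msg M \<and> (\<exists>f\<in>A. (f, z) \<in> F.D\<^sup>* \<and> (\<exists>g\<in>A. before g f)))) \<or>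
      ((\<exists>f\<in>A. prv e \<in> E \<and> (f, prv e) \<in> F.D\<^sup>*) \<or> (\<exists>z. (z, e) \<in> msg M \<and> (\<exists>f\<in>A. (f, z) \<in> F.D\<^sup>*))) \<and>
      prv e \<notin> A \<and> \<not> (\<exists>z. (z, e) \<in> msg M \<and> z \<in> A)"
    unfolding rel_iff F by (rule trans[OF F.not_adjacent_iff[where q = q, OF AE Aq e, unfolded F]])
      (assumption | use AE in blast)+
  show "(\<exists>f\<in>A. rel M e f = 5) \<longleftrightarrow>
      ((\<exists>f\<in>A. nxt e \<in> E \<and> (nxt e, f) \<in> F.D\<^sup>* \<and> (\<exists>g\<in>A. before f g)) \<or>
       (\<exists>z. (e, z) \<in> msg M \<and> (\<exists>f\<in>A. (z, f) \<in> F.D\<^sup>* \<and> (\<exists>g\<in>A. before f g)))) \<or>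
      ((\<exists>f\<in>A. nxt e \<in> E \<and> (nxt e, f) \<in> F.D\<^sup>*) \<or> (\<exists>z. (e, z) \<in> msg M \<and> (\<exists>f\<in>A. (z, f) \<in> F.D\<^sup>*))) \<and>
      nxt e \<notin> A \<and> \<not> (\<exists>z. (e, z) \<in> msg M \<and> z \<in> A)"
    unfolding rel_iff B
    by (rule trans[OF B.not_adjacent_iff[where q = q, OF AE Aq e, unfolded BD_iff B]])
      (assumption | use AE in blast)+
qed

lemma fwd_bits_iff: "fwd_bits (L (prv e)) (L e) (in_lab M L e) q \<tau> \<longleftrightarrow>
     (pst 0 q \<tau> (L e) \<longleftrightarrow> e \<in> A \<or> pst 0 q \<tau> (L (prv e)) \<or> (\<exists>z. (z, e) \<in> msg M \<and> pst 0 q \<tau> (L z))) \<and>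
     (pst 1 q \<tau> (L e) \<longleftrightarrow> bas 0 q \<tau> (L e) \<or> pst 1 q \<tau> (L (prv e)) \<or> (\<exists>z. (z, e) \<in> msg M \<and> pst 1 q \<tau> (L z))) \<and>
     (pst 2 q \<tau> (L e) \<longleftrightarrow> e \<in> A \<and> \<not> bas 1 q \<tau> (L e) \<or> pst 2 q \<tau> (L (prv e)) \<or> (\<exists>z. (z, e) \<in> msg M \<and> pst 2 q \<tau> (L z))) \<and>
     (bas 0 q \<tau> (L e) \<longleftrightarrow> e \<in> A \<and> pst 0 q \<tau> (L (prv e))) \<and>
     (obs 0 q \<tau> (L e) \<longleftrightarrow> e \<in> A) \<and>
     (obs 2 q \<tau> (L e) \<longleftrightarrow> prv e \<in> A) \<and>
     (obs 4 q \<tau> (L e) \<longleftrightarrow> (\<exists>z. (z, e) \<in> msg M \<and> z \<in> A)) \<and>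
     (obs 6 q \<tau> (L e) \<longleftrightarrow> (pst 1 q \<tau> (L (prv e)) \<or> (\<exists>z. (z, e) \<in> msg M \<and> pst 1 q \<tau> (L z))) \<or>
        (pst 0 q \<tau> (L (prv e)) \<or> (\<exists>z. (z, e) \<in> msg M \<and> pst 0 q \<tau> (L z))) \<and> prv e \<notin> A \<and> \<not> (\<exists>z. (z, e) \<in> msg M \<and> z \<in> A))"
  unfolding fwd_bits_def by (simp add: at_in_lab[of "isA q \<tau>"] at_in_lab[of "pst _ q \<tau>"] A)

lemma bwd_bits_iff: "bwd_bits (L e) (out_lab M L e) (L (nxt e)) q \<tau> \<longleftrightarrow>
     (fut 0 q \<tau> (L e) \<longleftrightarrow> e \<in> A \<or> fut 0 q \<tau> (L (nxt e)) \<or> (\<exists>z. (e, z) \<in> msg M \<and> fut 0 q \<tau> (L z))) \<and>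
     (fut 1 q \<tau> (L e) \<longleftrightarrow> bas 1 q \<tau> (L e) \<or> fut 1 q \<tau> (L (nxt e)) \<or> (\<exists>z. (e, z) \<in> msg M \<and> fut 1 q \<tau> (L z))) \<and>
     (fut 2 q \<tau> (L e) \<longleftrightarrow> e \<in> A \<and> \<not> bas 0 q \<tau> (L e) \<or> fut 2 q \<tau> (L (nxt e)) \<or> (\<exists>z. (e, z) \<in> msg M \<and> fut 2 q \<tau> (L z))) \<and>
     (bas 1 q \<tau> (L e) \<longleftrightarrow> e \<in> A \<and> fut 0 q \<tau> (L (nxt e))) \<and>
     (obs 1 q \<tau> (L e) \<longleftrightarrow> nxt e \<in> A) \<and>
     (obs 3 q \<tau> (L e) \<longleftrightarrow> (\<exists>z. (e, z) \<in> msg M \<and> z \<in> A)) \<and>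
     (obs 5 q \<tau> (L e) \<longleftrightarrow> (fut 1 q \<tau> (L (nxt e)) \<or> (\<exists>z. (e, z) \<in> msg M \<and> fut 1 q \<tau> (L z))) \<or>
        (fut 0 q \<tau> (L (nxt e)) \<or> (\<exists>z. (e, z) \<in> msg M \<and> fut 0 q \<tau> (L z))) \<and> nxt e \<notin> A \<and> \<not> (\<exists>z. (e, z) \<in> msg M \<and> z \<in> A)) \<and>
     (L (nxt e) \<noteq> 0 \<longrightarrow> (glob q \<tau> (L e) \<longleftrightarrow> glob q \<tau> (L (nxt e))))"
  unfolding bwd_bits_def by (simp add: at_out_lab[of "isA q \<tau>"] at_out_lab[of "fut _ q \<tau>"] A)

lemma at_E: "pst k q \<tau> (L e) \<longleftrightarrow> e \<in> E \<and> pst k q \<tau> (L e)" "fut k q \<tau> (L e) \<longleftrightarrow> e \<in> E \<and> fut k q \<tau> (L e)"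
  by (cases "e \<in> E"; simp add: L0)+

lemma F_propagate:
  assumes "\<And>e. e \<in> E \<Longrightarrow> X (L e) \<longleftrightarrow> (e \<in> A \<and> B e) \<or> X (L (prv e)) \<or> (\<exists>z. (z, e) \<in> msg M \<and> X (L z))"
    and "\<not> X 0" "e \<in> E"
  shows "X (L e) \<longleftrightarrow> (\<exists>f\<in>A. (f, e) \<in> F.D\<^sup>* \<and> B f)"
proof -
  have "X (L e) \<longleftrightarrow> (\<exists>f\<in>E. (f, e) \<in> F.D\<^sup>* \<and> (f \<in> A \<and> B f))"
    by (rule F.propagate[OF _ assms(3)]) (use assms(1,2) L0 in metis)
  then show ?thesis using AE by blast
qed

lemma B_propagate:
  assumes "\<And>e. e \<in> E \<Longrightarrow> X (L e) \<longleftrightarrow> (e \<in> A \<and> B e) \<or> X (L (nxt e)) \<or> (\<exists>z. (e, z) \<in> msg M \<and> X (L z))"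
    and "\<not> X 0" "e \<in> E"
  shows "X (L e) \<longleftrightarrow> (\<exists>f\<in>A. (e, f) \<in> F.D\<^sup>* \<and> B f)"
proof -
  have "X (L e) \<longleftrightarrow> (\<exists>f\<in>E. (f, e) \<in> B.D\<^sup>* \<and> (f \<in> A \<and> B f))"
    by (rule B.propagate[OF _ assms(3)]) (unfold converse_iff, use assms(1,2) L0 in metis)
  then show ?thesis using AE by auto
qed

lemma nonfirst: "e \<in> A \<Longrightarrow> (\<exists>f\<in>A. prv e \<in> E \<and> (f, prv e) \<in> F.D\<^sup>*) \<longleftrightarrow> (\<exists>g\<in>A. before g e)"
  using F.nonfirst_iff[OF AE Aq] by blast

lemma nonlast: "e \<in> A \<Longrightarrow> (\<exists>f\<in>A. nxt e \<in> E \<and> (nxt e, f) \<in> F.D\<^sup>*) \<longleftrightarrow> (\<exists>g\<in>A. before e g)"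
  using B.nonfirst_iff[OF AE Aq] by auto

lemma bits_sound:
  assumes f: "\<And>e. e \<in> E \<Longrightarrow> fwd_bits (L (prv e)) (L e) (in_lab M L e) q \<tau>"
    and b: "\<And>e. e \<in> E \<Longrightarrow> bwd_bits (L e) (out_lab M L e) (L (nxt e)) q \<tau>"
    and e: "e \<in> E"
  shows "sem_bits L q \<tau> A e"
proof -
  note f = f[unfolded fwd_bits_iff] and b = b[unfolded bwd_bits_iff]
  have p0: "pst 0 q \<tau> (L e) \<longleftrightarrow> (\<exists>f\<in>A. (f, e) \<in> F.D\<^sup>*)" if "e \<in> E" for e
    using F_propagate[of "pst 0 q \<tau>" "\<lambda>_. True" e] f that by simp
  have f0: "fut 0 q \<tau> (L e) \<longleftrightarrow> (\<exists>f\<in>A. (e, f) \<in> F.D\<^sup>*)" if "e \<in> E" for e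
    using B_propagate[of "fut 0 q \<tau>" "\<lambda>_. True" e] b that by simp
  have b0: "bas 0 q \<tau> (L e) \<longleftrightarrow> e \<in> A \<and> (\<exists>g\<in>A. before g e)" if "e \<in> E" for e
  proof -
    have "bas 0 q \<tau> (L e) \<longleftrightarrow> e \<in> A \<and> pst 0 q \<tau> (L (prv e))" using f[OF that] by blast
    also have "\<dots> \<longleftrightarrow> e \<in> A \<and> (\<exists>f\<in>A. prv e \<in> E \<and> (f, prv e) \<in> F.D\<^sup>*)"
      using p0[of "prv e"] at_E(1)[of 0 "prv e"] by blast
    finally show ?thesis using nonfirst by blast
  qed
  have b1: "bas 1 q \<tau> (L e) \<longleftrightarrow> e \<in> A \<and> (\<exists>g\<in>A. before e g)" if "e \<in> E" for e
  proof -
    have "bas 1 q \<tau> (L e) \<longleftrightarrow> e \<in> A \<and> fut 0 q \<tau> (L (nxt e))" using b[OF that] by blast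
    also have "\<dots> \<longleftrightarrow> e \<in> A \<and> (\<exists>f\<in>A. nxt e \<in> E \<and> (nxt e, f) \<in> F.D\<^sup>*)"
      using f0[of "nxt e"] at_E(2)[of 0 "nxt e"] by blast
    finally show ?thesis using nonlast by blast
  qed
  have p1: "pst 1 q \<tau> (L e) \<longleftrightarrow> (\<exists>f\<in>A. (f, e) \<in> F.D\<^sup>* \<and> (\<exists>g\<in>A. before g f))" if "e \<in> E" for e
    by (rule F_propagate[of "pst 1 q \<tau>"]) (use f b0 that in auto)
  have p2: "pst 2 q \<tau> (L e) \<longleftrightarrow> (\<exists>f\<in>A. (f, e) \<in> F.D\<^sup>* \<and> \<not> (\<exists>g\<in>A. before f g))" if "e \<in> E" for e
    by (rule F_propagate[of "pst 2 q \<tau>"]) (use f b1 that in auto)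
  have f1: "fut 1 q \<tau> (L e) \<longleftrightarrow> (\<exists>f\<in>A. (e, f) \<in> F.D\<^sup>* \<and> (\<exists>g\<in>A. before f g))" if "e \<in> E" for e
    by (rule B_propagate[of "fut 1 q \<tau>"]) (use b b1 that in auto)
  have f2: "fut 2 q \<tau> (L e) \<longleftrightarrow> (\<exists>f\<in>A. (e, f) \<in> F.D\<^sup>* \<and> \<not> (\<exists>g\<in>A. before g f))" if "e \<in> E" for e
    by (rule B_propagate[of "fut 2 q \<tau>"]) (use b b0 that in auto)
  have m_E: "z \<in> E" if "(z, e) \<in> msg M \<or> (e, z) \<in> msg M" for z
    using that F.m_E by blast
  have ob6: "obs 6 q \<tau> (L e) \<longleftrightarrow> (\<exists>f\<in>A. rel M e f = 6)"
  proof -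
    have "pst 0 q \<tau> (L (prv e)) \<longleftrightarrow> (\<exists>f\<in>A. prv e \<in> E \<and> (f, prv e) \<in> F.D\<^sup>*)"
      "pst 1 q \<tau> (L (prv e)) \<longleftrightarrow> (\<exists>f\<in>A. prv e \<in> E \<and> (f, prv e) \<in> F.D\<^sup>* \<and> (\<exists>g\<in>A. before g f))"
      using p0[of "prv e"] p1[of "prv e"] at_E(1)[of _ "prv e"] by blast+
    moreover have "(\<exists>z. (z, e) \<in> msg M \<and> pst 0 q \<tau> (L z)) \<longleftrightarrow> (\<exists>z. (z, e) \<in> msg M \<and> (\<exists>f\<in>A. (f, z) \<in> F.D\<^sup>*))"
      "(\<exists>z. (z, e) \<in> msg M \<and> pst 1 q \<tau> (L z)) \<longleftrightarrow>
       (\<exists>z. (z, e) \<in> msg M \<and> (\<exists>f\<in>A. (f, z) \<in> F.D\<^sup>* \<and> (\<exists>g\<in>A. before g f)))"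
      using p0 p1 m_E by blast+
    ultimately show ?thesis using f[OF e] unfolding obs_iff[OF e] by (simp only:)
  qed
  have ob5: "obs 5 q \<tau> (L e) \<longleftrightarrow> (\<exists>f\<in>A. rel M e f = 5)"
  proof -
    have "fut 0 q \<tau> (L (nxt e)) \<longleftrightarrow> (\<exists>f\<in>A. nxt e \<in> E \<and> (nxt e, f) \<in> F.D\<^sup>*)"
      "fut 1 q \<tau> (L (nxt e)) \<longleftrightarrow> (\<exists>f\<in>A. nxt e \<in> E \<and> (nxt e, f) \<in> F.D\<^sup>* \<and> (\<exists>g\<in>A. before f g))"
      using f0[of "nxt e"] f1[of "nxt e"] at_E(2)[of _ "nxt e"] by blast+
    moreover have "(\<exists>z. (e, z) \<in> msg M \<and> fut 0 q \<tau> (L z)) \<longleftrightarrow> (\<exists>z. (e, z) \<in> msg M \<and> (\<exists>f\<in>A. (z, f) \<in> F.D\<^sup>*))"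
      "(\<exists>z. (e, z) \<in> msg M \<and> fut 1 q \<tau> (L z)) \<longleftrightarrow>
       (\<exists>z. (e, z) \<in> msg M \<and> (\<exists>f\<in>A. (z, f) \<in> F.D\<^sup>* \<and> (\<exists>g\<in>A. before f g)))"
      using f0 f1 m_E by blast+
    ultimately show ?thesis using b[OF e] unfolding obs_iff[OF e] by (simp only:)
  qed
  have "\<forall>k<7. obs k q \<tau> (L e) \<longleftrightarrow> (\<exists>f\<in>A. rel M e f = k)"
    using f[OF e] b[OF e] ob5 ob6 obs_iff[OF e] by (simp add: numeral_eq_Suc All_less_Suc)
  moreover have "\<forall>k<3. (pst k q \<tau> (L e) \<longleftrightarrow> sem_pst A k e) \<and> (fut k q \<tau> (L e) \<longleftrightarrow> sem_fut A k e)"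
    using p0[OF e] p1[OF e] p2[OF e] f0[OF e] f1[OF e] f2[OF e]
    by (simp add: numeral_eq_Suc All_less_Suc sem_pst_def sem_fut_def)
  ultimately show ?thesis using b0[OF e] b1[OF e] unfolding sem_bits_def by blast
qed

lemma bits_complete:
  assumes s: "\<And>e. e \<in> E \<Longrightarrow> sem_bits L q \<tau> A e"
    and g: "\<And>e f. e \<in> E \<Longrightarrow> f \<in> E \<Longrightarrow> glob q \<tau> (L e) \<longleftrightarrow> glob q \<tau> (L f)"
    and e: "e \<in> E"
  shows "fwd_bits (L (prv e)) (L e) (in_lab M L e) q \<tau>"
    "bwd_bits (L e) (out_lab M L e) (L (nxt e)) q \<tau>"
proof -
  note s = s[unfolded sem_bits_def]
  have k: "pst k q \<tau> (L e) \<longleftrightarrow> e \<in> E \<and> sem_pst A k e" "fut k q \<tau> (L e) \<longleftrightarrow> e \<in> E \<and> sem_fut A k e"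
    if "k < 3" for k e
    using s[of e] that at_E[of k e] by blast+
  have o: "obs k q \<tau> (L e) \<longleftrightarrow> (\<exists>f\<in>A. rel M e f = k)" if "k < 7" for k
    using s[OF e] that by blast
  have pst: "pst 0 q \<tau> (L e) \<longleftrightarrow> e \<in> E \<and> (\<exists>f\<in>A. (f, e) \<in> F.D\<^sup>*)"
    "pst 1 q \<tau> (L e) \<longleftrightarrow> e \<in> E \<and> (\<exists>f\<in>A. (f, e) \<in> F.D\<^sup>* \<and> (\<exists>g\<in>A. before g f))"
    "pst 2 q \<tau> (L e) \<longleftrightarrow> e \<in> E \<and> (\<exists>f\<in>A. (f, e) \<in> F.D\<^sup>* \<and> \<not> (\<exists>g\<in>A. before f g))" for e
    using k(1)[of 0 e] k(1)[of 1 e] k(1)[of 2 e] by (simp_all add: sem_pst_def)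
  have fut: "fut 0 q \<tau> (L e) \<longleftrightarrow> e \<in> E \<and> (\<exists>f\<in>A. (e, f) \<in> F.D\<^sup>*)"
    "fut 1 q \<tau> (L e) \<longleftrightarrow> e \<in> E \<and> (\<exists>f\<in>A. (e, f) \<in> F.D\<^sup>* \<and> (\<exists>g\<in>A. before f g))"
    "fut 2 q \<tau> (L e) \<longleftrightarrow> e \<in> E \<and> (\<exists>f\<in>A. (e, f) \<in> F.D\<^sup>* \<and> \<not> (\<exists>g\<in>A. before g f))" for e
    using k(2)[of 0 e] k(2)[of 1 e] k(2)[of 2 e] by (simp_all add: sem_fut_def)
  have bas: "bas 0 q \<tau> (L e) \<longleftrightarrow> e \<in> A \<and> (\<exists>g\<in>A. before g e)"
    "bas 1 q \<tau> (L e) \<longleftrightarrow> e \<in> A \<and> (\<exists>g\<in>A. before e g)" using s[OF e] by blast+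
  have mz: "(z, e) \<in> msg M \<and> z \<in> E \<and> R \<longleftrightarrow> (z, e) \<in> msg M \<and> R"
    "(e, z) \<in> msg M \<and> z \<in> E \<and> R \<longleftrightarrow> (e, z) \<in> msg M \<and> R" for z R
    using F.m_E by blast+
  show "fwd_bits (L (prv e)) (L e) (in_lab M L e) q \<tau>"
    unfolding fwd_bits_iff pst bas mz
  proof (intro conjI)
    show "obs 0 q \<tau> (L e) \<longleftrightarrow> e \<in> A" "obs 2 q \<tau> (L e) \<longleftrightarrow> prv e \<in> A"
      "obs 4 q \<tau> (L e) \<longleftrightarrow> (\<exists>z. (z, e) \<in> msg M \<and> z \<in> A)"
      by (simp_all add: o obs_iff[OF e])
  next
    show "e \<in> A \<and> (\<exists>g\<in>A. before g e) \<longleftrightarrow> e \<in> A \<and> prv e \<in> E \<and> (\<exists>f\<in>A. (f, prv e) \<in> F.D\<^sup>*)"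
      using nonfirst[of e] by blast
  next
    have "obs 6 q \<tau> (L e) \<longleftrightarrow> (\<exists>f\<in>A. rel M e f = 6)" using o by simp
    then show "obs 6 q \<tau> (L e) \<longleftrightarrow>
      ((prv e \<in> E \<and> (\<exists>f\<in>A. (f, prv e) \<in> F.D\<^sup>* \<and> (\<exists>g\<in>A. before g f))) \<or>
       (\<exists>z. (z, e) \<in> msg M \<and> (\<exists>f\<in>A. (f, z) \<in> F.D\<^sup>* \<and> (\<exists>g\<in>A. before g f)))) \<or>
      ((prv e \<in> E \<and> (\<exists>f\<in>A. (f, prv e) \<in> F.D\<^sup>*)) \<or> (\<exists>z. (z, e) \<in> msg M \<and> (\<exists>f\<in>A. (f, z) \<in> F.D\<^sup>*))) \<and>
      prv e \<notin> A \<and> \<not> (\<exists>z. (z, e) \<in> msg M \<and> z \<in> A)"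
      unfolding obs_iff[OF e] by blast
  next
    show "e \<in> E \<and> (\<exists>f\<in>A. (f, e) \<in> F.D\<^sup>*) \<longleftrightarrow> e \<in> A \<or> prv e \<in> E \<and> (\<exists>f\<in>A. (f, prv e) \<in> F.D\<^sup>*) \<or>
        (\<exists>z. (z, e) \<in> msg M \<and> (\<exists>f\<in>A. (f, z) \<in> F.D\<^sup>*))"
      using F.propagate_step[OF e, of A "\<lambda>_. True"] e by simp
    show "e \<in> E \<and> (\<exists>f\<in>A. (f, e) \<in> F.D\<^sup>* \<and> (\<exists>g\<in>A. before g f)) \<longleftrightarrow> e \<in> A \<and> (\<exists>g\<in>A. before g e) \<or>
        prv e \<in> E \<and> (\<exists>f\<in>A. (f, prv e) \<in> F.D\<^sup>* \<and> (\<exists>g\<in>A. before g f)) \<or>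
        (\<exists>z. (z, e) \<in> msg M \<and> (\<exists>f\<in>A. (f, z) \<in> F.D\<^sup>* \<and> (\<exists>g\<in>A. before g f)))"
      using F.propagate_step[OF e, of A "\<lambda>f. \<exists>g\<in>A. before g f"] e by simp
    show "e \<in> E \<and> (\<exists>f\<in>A. (f, e) \<in> F.D\<^sup>* \<and> \<not> (\<exists>g\<in>A. before f g)) \<longleftrightarrow>
        e \<in> A \<and> \<not> (e \<in> A \<and> (\<exists>g\<in>A. before e g)) \<or>
        prv e \<in> E \<and> (\<exists>f\<in>A. (f, prv e) \<in> F.D\<^sup>* \<and> \<not> (\<exists>g\<in>A. before f g)) \<or>
        (\<exists>z. (z, e) \<in> msg M \<and> (\<exists>f\<in>A. (f, z) \<in> F.D\<^sup>* \<and> \<not> (\<exists>g\<in>A. before f g)))"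
      using F.propagate_step[OF e, of A "\<lambda>f. \<not> (\<exists>g\<in>A. before f g)"] e by (simp cong: conj_cong)
  qed
  show "bwd_bits (L e) (out_lab M L e) (L (nxt e)) q \<tau>"
    unfolding bwd_bits_iff fut bas mz
  proof (intro conjI)
    show "obs 1 q \<tau> (L e) \<longleftrightarrow> nxt e \<in> A" "obs 3 q \<tau> (L e) \<longleftrightarrow> (\<exists>z. (e, z) \<in> msg M \<and> z \<in> A)"
      using o[of 1] o[of 3] by (simp_all add: obs_iff[OF e])
  next
    show "e \<in> A \<and> (\<exists>g\<in>A. before e g) \<longleftrightarrow> e \<in> A \<and> nxt e \<in> E \<and> (\<exists>f\<in>A. (nxt e, f) \<in> F.D\<^sup>*)"
      using nonlast[of e] by blast
  next
    have "obs 5 q \<tau> (L e) \<longleftrightarrow> (\<exists>f\<in>A. rel M e f = 5)" using o by simp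
    then show "obs 5 q \<tau> (L e) \<longleftrightarrow>
      ((nxt e \<in> E \<and> (\<exists>f\<in>A. (nxt e, f) \<in> F.D\<^sup>* \<and> (\<exists>g\<in>A. before f g))) \<or>
       (\<exists>z. (e, z) \<in> msg M \<and> (\<exists>f\<in>A. (z, f) \<in> F.D\<^sup>* \<and> (\<exists>g\<in>A. before f g)))) \<or>
      ((nxt e \<in> E \<and> (\<exists>f\<in>A. (nxt e, f) \<in> F.D\<^sup>*)) \<or> (\<exists>z. (e, z) \<in> msg M \<and> (\<exists>f\<in>A. (z, f) \<in> F.D\<^sup>*))) \<and>
      nxt e \<notin> A \<and> \<not> (\<exists>z. (e, z) \<in> msg M \<and> z \<in> A)"
      unfolding obs_iff[OF e] by blast
  next
    show "L (nxt e) \<noteq> 0 \<longrightarrow> (glob q \<tau> (L e) \<longleftrightarrow> glob q \<tau> (L (nxt e)))"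
      using g[of e "nxt e"] e L0[of "nxt e"] by (cases "nxt e \<in> E") simp_all
  next
    show "e \<in> E \<and> (\<exists>f\<in>A. (e, f) \<in> F.D\<^sup>*) \<longleftrightarrow> e \<in> A \<or> nxt e \<in> E \<and> (\<exists>f\<in>A. (nxt e, f) \<in> F.D\<^sup>*) \<or>
        (\<exists>z. (e, z) \<in> msg M \<and> (\<exists>f\<in>A. (z, f) \<in> F.D\<^sup>*))"
      using B.propagate_step[OF e, of A "\<lambda>_. True"] e by simp
    show "e \<in> E \<and> (\<exists>f\<in>A. (e, f) \<in> F.D\<^sup>* \<and> (\<exists>g\<in>A. before f g)) \<longleftrightarrow> e \<in> A \<and> (\<exists>g\<in>A. before e g) \<or>
        nxt e \<in> E \<and> (\<exists>f\<in>A. (nxt e, f) \<in> F.D\<^sup>* \<and> (\<exists>g\<in>A. before f g)) \<or>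
        (\<exists>z. (e, z) \<in> msg M \<and> (\<exists>f\<in>A. (z, f) \<in> F.D\<^sup>* \<and> (\<exists>g\<in>A. before f g)))"
      using B.propagate_step[OF e, of A "\<lambda>f. \<exists>g\<in>A. before f g"] e by simp
    show "e \<in> E \<and> (\<exists>f\<in>A. (e, f) \<in> F.D\<^sup>* \<and> \<not> (\<exists>g\<in>A. before g f)) \<longleftrightarrow>
        e \<in> A \<and> \<not> (e \<in> A \<and> (\<exists>g\<in>A. before g e)) \<or>
        nxt e \<in> E \<and> (\<exists>f\<in>A. (nxt e, f) \<in> F.D\<^sup>* \<and> \<not> (\<exists>g\<in>A. before g f)) \<or>
        (\<exists>z. (e, z) \<in> msg M \<and> (\<exists>f\<in>A. (z, f) \<in> F.D\<^sup>* \<and> \<not> (\<exists>g\<in>A. before g f)))"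
      using B.propagate_step[OF e, of A "\<lambda>f. \<not> (\<exists>g\<in>A. before g f)"] e by (simp cong: conj_cong)
  qed
qed

end

lemma in_lab_nonzero: "in_lab M L e \<noteq> 0 \<Longrightarrow> \<exists>z. (z, e) \<in> msg M"
  by (auto simp: in_lab_def split: if_splits)

lemma out_lab_nonzero: "out_lab M L e \<noteq> 0 \<Longrightarrow> \<exists>z. (e, z) \<in> msg M"
  by (auto simp: out_lab_def split: if_splits)

lemma obtain_first:
  assumes "A \<subseteq> E" "\<And>f. f \<in> A \<Longrightarrow> fst f = q" "A \<noteq> {}"
  obtains f where "f \<in> A" "\<And>g. g \<in> A \<Longrightarrow> g = f \<or> before f g"
  by (rule B.bef_max[OF assms(1,3,2)]) (use that in auto)

lemma obtain_last:
  assumes "A \<subseteq> E" "\<And>f. f \<in> A \<Longrightarrow> fst f = q" "A \<noteq> {}"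
  obtains f where "f \<in> A" "\<And>g. g \<in> A \<Longrightarrow> g = f \<or> before g f"
  by (rule F.bef_max[OF assms(1,3,2)]) (use that in auto)

lemma nxt_prv: "e \<in> E \<Longrightarrow> nxt (prv e) = e" "prv (nxt e) = e"
  by (auto simp: nxt_def prv_def in_E)

subsection \<open>Lines\<close>

text \<open>
  Followed backwards, a line can only end at the first element of \<open>A\<close>. As it does not branch,
  all lines are parts of a single path, which then contains \<open>A\<close>.
\<close>

lemma line_sound:
  assumes L0: "\<And>e. e \<notin> E \<Longrightarrow> L e = 0"
    and A: "\<And>e. isA q \<tau> (L e) \<longleftrightarrow> e \<in> A" and AE: "A \<subseteq> E" and Aq: "\<And>e. e \<in> A \<Longrightarrow> fst e = q"
    and b0: "\<And>e. e \<in> E \<Longrightarrow> bas 0 q \<tau> (L e) \<longleftrightarrow> e \<in> A \<and> (\<exists>g\<in>A. before g e)"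
    and fl: "\<And>e. e \<in> E \<Longrightarrow> fwd_line (L (prv e)) (L e) (in_lab M L e) q \<tau> p"
    and bl: "\<And>e. e \<in> E \<Longrightarrow> bwd_line (L e) (out_lab M L e) (L (nxt e)) q \<tau> p"
    and e: "e \<in> E" "line 0 p q \<tau> (L e) \<or> line 1 p q \<tau> (L e)" and f: "f \<in> A"
  shows "(f, e) \<in> F.D\<^sup>* \<or> (e, f) \<in> F.D\<^sup>*"
proof -
  let ?on = "\<lambda>e. line 0 p q \<tau> (L e) \<or> line 1 p q \<tau> (L e)"
  define R where "R = {(x, y). y \<in> E \<and> (x = prv y \<and> line 0 p q \<tau> (L y) \<or> (x, y) \<in> msg M \<and> line 1 p q \<tau> (L y))}"
  have RD: "R \<subseteq> F.D"
  proof (rule subrelI)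
    fix x y assume "(x, y) \<in> R"
    then have xy: "y \<in> E" "x = prv y \<and> line 0 p q \<tau> (L y) \<or> (x, y) \<in> msg M" by (auto simp: R_def)
    moreover have "line 0 p q \<tau> (L y) \<Longrightarrow> prv y \<in> E"
      using fl[OF xy(1)] L0[of "prv y"] by (auto simp: fwd_line_def)
    ultimately show "(x, y) \<in> F.D" using F.pv_D F.m_D by blast
  qed
  have out: "y = nxt x \<and> line 0 p q \<tau> (L (nxt x)) \<or> (x, y) \<in> msg M \<and> line 1 p q \<tau> (out_lab M L x)"
    if xy: "(x, y) \<in> R" for x y
  proof -
    from xy have "y \<in> E" "x = prv y \<and> line 0 p q \<tau> (L y) \<or> (x, y) \<in> msg M \<and> line 1 p q \<tau> (L y)"
      by (auto simp: R_def)
    then show ?thesis using nxt_prv(1)[of y] msg_labs(4)[OF msc, of x y L] by metis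
  qed
  have sv: "single_valued R"
  proof (rule single_valuedI)
    fix x y z assume xy: "(x, y) \<in> R" "(x, z) \<in> R"
    then have x: "x \<in> E" using RD F.D_E by blast
    note y = out[OF xy(1)] and z = out[OF xy(2)]
    show "y = z" using y z bl[OF x] F.m_fun[of x y z] unfolding bwd_line_def by blast
  qed
  obtain a where a: "a \<in> A" "\<And>g. g \<in> A \<Longrightarrow> g = a \<or> before a g"
    using obtain_first[OF AE Aq] f by blast
  have first: "x = a" if "x \<in> A" "\<not> (\<exists>g\<in>A. before g x)" for x
    using a that by blast
  have from_a: "(a, y) \<in> R\<^sup>*" if "y \<in> E" "?on y" for y
    using F.wf_D that
  proof (induction y rule: wf_induct_rule)
    case (less y)
    have "\<exists>x. (x, y) \<in> R"
      using less.prems fl[OF less.prems(1)] in_lab_nonzero[of L y]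
      unfolding R_def fwd_line_def by blast
    then obtain x where x: "(x, y) \<in> R" by blast
    then have xE: "x \<in> E" "(x, y) \<in> F.D" using RD F.D_E by blast+
    have "?on x \<or> x = a"
      using bl[OF xE(1)] out[OF x] A b0[OF xE(1)] first unfolding bwd_line_def by blast
    then have "(a, x) \<in> R\<^sup>*" using less.IH xE by blast
    then show ?case using x by (rule rtrancl.rtrancl_into_rtrancl)
  qed
  have "(a, f) \<in> R\<^sup>*"
  proof (cases "\<exists>g\<in>A. before g f")
    case True
    have fE: "f \<in> E" using f AE by blast
    then have "bas 0 q \<tau> (L f)" using True f b0 by blast
    then show ?thesis using fl[OF fE] from_a[OF fE] unfolding fwd_line_def by blast
  qed (use first f in blast)
  moreover have "(a, e) \<in> R\<^sup>*" using from_a e by blast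
  ultimately have "(f, e) \<in> R\<^sup>* \<or> (e, f) \<in> R\<^sup>*" by (rule single_valued_confluent[OF sv])
  then show ?thesis using rtrancl_mono[OF RD] by blast
qed

text \<open>The events to be covered belong to the single process p, since those of different
  processes need not form a chain. They have an element of \<open>A\<close> in their past, hence lie
  above the first element, where the line begins.\<close>

definition is_line :: "nat event set \<Rightarrow> nat \<Rightarrow> (nat event \<times> nat event) set \<Rightarrow> bool" where
  "is_line A p R \<longleftrightarrow> R \<subseteq> F.D \<and> single_valued R \<and>
    (\<forall>f\<in>A. (\<exists>g\<in>A. before g f) \<longrightarrow> (\<exists>w. (w, f) \<in> R)) \<and>
    (\<forall>x y. (x, y) \<in> R \<longrightarrow> (\<exists>w. (w, x) \<in> R) \<or> x \<in> A \<and> \<not> (\<exists>g\<in>A. before g x)) \<and>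
    (\<forall>e\<in>E. fst e = p \<and> e \<notin> A \<and> (\<exists>f\<in>A. (f, e) \<in> F.D\<^sup>*) \<and> (\<forall>f\<in>A. (f, e) \<in> F.D\<^sup>* \<or> (e, f) \<in> F.D\<^sup>*) \<longrightarrow>
      (\<exists>w. (w, e) \<in> R))"

text \<open>\<open>A\<close> and the events of p to be covered form a chain with least element a:
  events of the same process are comparable, and those to be covered are comparable with all of
  \<open>A\<close>. So \<open>chain_path\<close> applies.\<close>

lemma line_exists:
  assumes AE: "A \<subseteq> E" and Aq: "\<And>e. e \<in> A \<Longrightarrow> fst e = q"
  shows "\<exists>R. is_line A p R"
proof (cases "A = {}")
  case True
  then show ?thesis by (intro exI[of _ "{}"]) (simp add: is_line_def)
next
  case False
  then obtain a where a: "a \<in> A" "\<And>g. g \<in> A \<Longrightarrow> g = a \<or> before a g"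
    using obtain_first[OF AE Aq] by blast
  have cmp: "(x, y) \<in> F.D\<^sup>* \<or> (y, x) \<in> F.D\<^sup>*" if "x \<in> E" "y \<in> E" "fst x = fst y" for x y
    using F.bef_total[OF that] F.bef_le that by blast
  have aA: "(a, c) \<in> F.D\<^sup>*" if "c \<in> A" for c
    using a(1) a(2)[OF that] F.bef_le AE that by blast
  let ?N = "{e\<in>E. fst e = p \<and> (\<exists>f\<in>A. (f, e) \<in> F.D\<^sup>*) \<and> (\<forall>f\<in>A. (f, e) \<in> F.D\<^sup>* \<or> (e, f) \<in> F.D\<^sup>*)}"
  have "\<exists>R\<subseteq>F.D. single_valued R \<and> (\<forall>x y. (x, y) \<in> R \<longrightarrow> x = a \<or> (\<exists>w. (w, x) \<in> R)) \<and>
    (\<forall>c\<in>A \<union> ?N. c = a \<or> (\<exists>w. (w, c) \<in> R))"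
  proof (rule F.chain_path)
    show "A \<union> ?N \<subseteq> E" using AE by blast
    show "(x, y) \<in> F.D\<^sup>* \<or> (y, x) \<in> F.D\<^sup>*" if xy: "x \<in> A \<union> ?N" "y \<in> A \<union> ?N" for x y
    proof -
      consider "x \<in> A" "y \<in> A" | "x \<in> A" "y \<in> ?N" | "x \<in> ?N" "y \<in> A" | "x \<in> ?N" "y \<in> ?N" using xy by blast
      then show ?thesis using cmp[of x y] AE Aq[of x] Aq[of y] by cases auto
    qed
    show "(a, c) \<in> F.D\<^sup>*" if "c \<in> A \<union> ?N" for c
    proof -
      from that have "\<exists>f\<in>A. (f, c) \<in> F.D\<^sup>*" by blast
      then show ?thesis using aA by (meson rtrancl_trans)
    qed
  qed (use a in blast)
  then obtain R where R: "R \<subseteq> F.D" "single_valued R" "\<forall>x y. (x, y) \<in> R \<longrightarrow> x = a \<or> (\<exists>w. (w, x) \<in> R)"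
    "\<forall>c\<in>A \<union> ?N. c = a \<or> (\<exists>w. (w, c) \<in> R)" by blast
  have "\<not> before g a" if "g \<in> A" for g using a(2)[OF that] F.bef_asym F.bef_irrefl by blast
  then have na: "\<not> (\<exists>g\<in>A. before g a)" by blast
  show ?thesis
    unfolding is_line_def
  proof (intro exI[of _ R] conjI ballI allI impI)
    fix f assume "f \<in> A" "\<exists>g\<in>A. before g f"
    moreover from this na have "f \<noteq> a" by metis
    ultimately show "\<exists>w. (w, f) \<in> R" using bspec[OF R(4), of f] by simp
  next
    fix x y assume "(x, y) \<in> R"
    with R(3) na a(1) show "(\<exists>w. (w, x) \<in> R) \<or> x \<in> A \<and> \<not> (\<exists>g\<in>A. before g x)" by metis
  next
    fix e assume *: "e \<in> E" "fst e = p \<and> e \<notin> A \<and> (\<exists>f\<in>A. (f, e) \<in> F.D\<^sup>*) \<and>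
      (\<forall>f\<in>A. (f, e) \<in> F.D\<^sup>* \<or> (e, f) \<in> F.D\<^sup>*)"
    then have ne: "e \<noteq> a" using a(1) by blast
    have "e \<in> A \<union> ?N" using * by blast
    from bspec[OF R(4) this] ne show "\<exists>w. (w, e) \<in> R" by simp
  qed (rule R)+
qed

lemma line_complete:
  assumes A: "\<And>e. isA q \<tau> (L e) \<longleftrightarrow> e \<in> A" and Lnz: "\<And>e. e \<in> E \<Longrightarrow> L e \<noteq> 0"
    and b0: "\<And>e. e \<in> E \<Longrightarrow> bas 0 q \<tau> (L e) \<longleftrightarrow> e \<in> A \<and> (\<exists>g\<in>A. before g e)"
    and line: "is_line A p R"
    and l: "\<And>e. line 0 p q \<tau> (L e) \<longleftrightarrow> (prv e, e) \<in> R"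
      "\<And>e. line 1 p q \<tau> (L e) \<longleftrightarrow> (\<exists>z. (z, e) \<in> msg M \<and> (z, e) \<in> R)"
    and e: "e \<in> E"
  shows "fwd_line (L (prv e)) (L e) (in_lab M L e) q \<tau> p" "bwd_line (L e) (out_lab M L e) (L (nxt e)) q \<tau> p"
proof -
  have R: "R \<subseteq> F.D" "single_valued R" "\<forall>f\<in>A. (\<exists>g\<in>A. before g f) \<longrightarrow> (\<exists>w. (w, f) \<in> R)"
      "\<forall>x y. (x, y) \<in> R \<longrightarrow> (\<exists>w. (w, x) \<in> R) \<or> x \<in> A \<and> \<not> (\<exists>g\<in>A. before g x)"
    using line unfolding is_line_def by blast+
  have inn: "line 0 p q \<tau> (L e) \<or> line 1 p q \<tau> (L e) \<longleftrightarrow> (\<exists>w. (w, e) \<in> R)" for e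
  proof -
    have "w = prv e \<or> (w, e) \<in> msg M" if "(w, e) \<in> R" for w using that R(1) F.D_iff[of w e] by blast
    then show ?thesis unfolding l by blast
  qed
  have prv: "prv e \<in> E" if "(prv e, e) \<in> R" using that R(1) F.D_E by blast
  have in_nz: "in_lab M L e \<noteq> 0" if z: "(z, e) \<in> msg M" for z
    using msg_labs(1)[OF msc z] Lnz F.m_E[OF z] by simp
  show "fwd_line (L (prv e)) (L e) (in_lab M L e) q \<tau> p"
    unfolding fwd_line_def inn b0[OF e] using R(3) prv Lnz in_nz l by blast
  have lo: "line 1 p q \<tau> (out_lab M L e) \<longleftrightarrow> (\<exists>z. (e, z) \<in> msg M \<and> (e, z) \<in> R)"
    unfolding at_out_lab[of "line 1 p q \<tau>", OF fields_0(7)] l using F.m_inj by blast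
  have ln: "line 0 p q \<tau> (L (nxt e)) \<longleftrightarrow> (e, nxt e) \<in> R"
    unfolding l nxt_prv ..
  \<comment> \<open>Otherwise the message from e would go to \<open>nxt e\<close> on the same
    process.\<close>
  have "\<not> ((e, nxt e) \<in> R \<and> (\<exists>z. (e, z) \<in> msg M \<and> (e, z) \<in> R))"
  proof
    assume "(e, nxt e) \<in> R \<and> (\<exists>z. (e, z) \<in> msg M \<and> (e, z) \<in> R)"
    then have "(e, nxt e) \<in> msg M" using R(2) by (metis single_valuedD)
    then show False using F.m_E by (metis fst_conv nxt_def)
  qed
  then show "bwd_line (L e) (out_lab M L e) (L (nxt e)) q \<tau> p"
    unfolding bwd_line_def lo ln A b0[OF e] using R(4) inn[of e] by blast
qed

subsection \<open>Tokens\<close>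

lemma seqs_Cons: "r # s # \<rho> \<in> seqs Q \<Longrightarrow> s # \<rho> \<in> seqs Q"
  by (auto simp: seqs_def)

lemma seqs_single: "p \<in> set_decode P \<Longrightarrow> [p] \<in> seqs (set_decode P)"
  using card_gt_0_iff[of "set_decode P"] by (auto simp: seqs_def Suc_le_eq)

lemma list_encode_simps:
  "list_encode [p] = Suc (prod_encode (p, 0))"
  "list_encode (p # s # \<rho>) = Suc (prod_encode (p, list_encode (s # \<rho>)))"
  "tag (list_encode (s # \<rho>)) = s" "list_encode (s # \<rho>) \<noteq> 0"
  by (simp_all add: tag_def)

declare list_encode.simps [simp del]

lemma no_msg_peer:
  assumes "\<not> (\<exists>z. (z, e) \<in> msg M \<and> fst z = s)" shows "\<not> (in_lab M L e \<noteq> 0 \<and> peer M e = s)"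
proof
  assume *: "in_lab M L e \<noteq> 0 \<and> peer M e = s"
  then obtain z where z: "(z, e) \<in> msg M" using in_lab_nonzero by blast
  then show False using msg_labs(3)[OF msc z] assms * z by metis
qed

lemma no_msg_peer_out:
  assumes "\<not> (\<exists>z. (e, z) \<in> msg M \<and> fst z = s)" shows "\<not> (out_lab M L e \<noteq> 0 \<and> peer M e = s)"
proof
  assume *: "out_lab M L e \<noteq> 0 \<and> peer M e = s"
  then obtain z where z: "(e, z) \<in> msg M" using out_lab_nonzero by blast
  then show False using msg_labs(6)[OF msc z] assms * z by metis
qed

text \<open>Let f be the latest element of \<open>A\<close> in the past of e, and g the earliest one
  in the future. No element of \<open>A\<close> lies between them, so f is the predecessor of g.
  Along sequences connecting f and g with e, both tokens at e therefore consist of the colours of f.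
  This contradicts what \<open>fwd_par\<close> demands of a positive claim.\<close>

lemma tokens_meet:
  assumes L0: "\<And>e. e \<notin> E \<Longrightarrow> L e = 0" and Lnz: "\<And>e. e \<in> E \<Longrightarrow> L e \<noteq> 0"
    and A: "\<And>e. isA q \<tau> (L e) \<longleftrightarrow> e \<in> A" and AE: "A \<subseteq> E" and Aq: "\<And>e. e \<in> A \<Longrightarrow> fst e = q"
    and ft: "\<And>e \<pi> \<pi>'. e \<in> E \<Longrightarrow> \<pi> \<in> set_decode (seq_codes P) \<Longrightarrow> \<pi>' \<in> set_decode (seq_codes P) \<Longrightarrow>
      fwd_tok P (fst e) (L (prv e)) (L e) (in_lab M L e) (peer M e) q \<tau> \<pi> \<pi>'"
    and bt: "\<And>e \<pi> \<pi>'. e \<in> E \<Longrightarrow> \<pi> \<in> set_decode (seq_codes P) \<Longrightarrow> \<pi>' \<in> set_decode (seq_codes P) \<Longrightarrow>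
      bwd_tok P (fst e) (L e) (out_lab M L e) (peer M e) (L (nxt e)) q \<tau> \<pi> \<pi>'"
    and e: "e \<in> E" and past: "\<exists>f\<in>A. (f, e) \<in> F.D\<^sup>*" and fut: "\<exists>f\<in>A. (e, f) \<in> F.D\<^sup>*"
    and cmp: "\<And>f. f \<in> A \<Longrightarrow> (f, e) \<in> F.D\<^sup>* \<or> (e, f) \<in> F.D\<^sup>*" and eA: "e \<notin> A"
  shows "\<exists>\<pi>\<in>set_decode (seq_codes P). \<exists>\<pi>'\<in>set_decode (seq_codes P).
    \<exists>c<3. tok c q \<tau> \<pi> \<pi>' \<pi> (L e) \<and> tok' c q \<tau> \<pi> \<pi>' \<pi>' (L e)"
proof -
  have locE: "fst ` E \<subseteq> set_decode P" by (auto simp: in_E)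
  \<comment> \<open>Distinctness limits the length to the number of processes.\<close>
  have seq: "\<rho> \<in> seqs (set_decode P)" if "distinct \<rho>" "set \<rho> \<subseteq> fst ` E" for \<rho>
    using that locE card_mono[of "set_decode P" "set \<rho>"] distinct_card[of \<rho>] by (auto simp: seqs_def)
  obtain f where f: "f \<in> A" "(f, e) \<in> F.D\<^sup>*"
    and fmax: "\<And>g. g \<in> A \<Longrightarrow> (g, e) \<in> F.D\<^sup>* \<Longrightarrow> g = f \<or> before g f"
    using obtain_last[of "{f\<in>A. (f, e) \<in> F.D\<^sup>*}" q] AE Aq past by (smt (verit) empty_iff mem_Collect_eq subset_iff)
  obtain g where g: "g \<in> A" "(e, g) \<in> F.D\<^sup>*"
    and gmin: "\<And>h. h \<in> A \<Longrightarrow> (e, h) \<in> F.D\<^sup>* \<Longrightarrow> h = g \<or> before g h"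
    using obtain_first[of "{f\<in>A. (e, f) \<in> F.D\<^sup>*}" q] AE Aq fut by (smt (verit) empty_iff mem_Collect_eq subset_iff)
  obtain \<pi> where \<pi>: "distinct \<pi>" "set \<pi> \<subseteq> fst ` E" "F.reach \<pi> f e"
    using F.le_reach[OF f(2) e] by blast
  obtain \<pi>' where \<pi>': "distinct \<pi>'" "set \<pi>' \<subseteq> fst ` E" "B.reach \<pi>' g e"
    using B.le_reach[of g e] g(2) e by auto
  note S = seq[OF \<pi>(1,2)] seq[OF \<pi>'(1,2)]
  let ?k = "list_encode \<pi>" and ?k' = "list_encode \<pi>'"
  have K: "?k \<in> set_decode (seq_codes P)" "?k' \<in> set_decode (seq_codes P)"
    using S by (auto simp: set_decode_seq_codes)
  note ft = ft[OF _ K] and bt = bt[OF _ K]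
  define T where "T \<rho> e = {c. c < 3 \<and> tok c q \<tau> ?k ?k' (list_encode \<rho>) (L e)}" for \<rho> e
  define T' where "T' \<rho> e = {c. c < 3 \<and> tok' c q \<tau> ?k ?k' (list_encode \<rho>) (L e)}" for \<rho> e
  have inS: "list_encode \<rho> \<in> set_decode (seq_codes P) \<longleftrightarrow> \<rho> \<in> seqs (set_decode P)" for \<rho>
    by (auto simp: set_decode_seq_codes inj_image_mem_iff[OF inj_list_encode])
  have T0: "T \<rho> x = {}" "T' \<rho> x = {}" if "x \<notin> E" for \<rho> x
    using L0[OF that] by (simp_all add: T_def T'_def)
  have ft_step: "tok c q \<tau> ?k ?k' (list_encode (fst x # s # \<rho>)) (L x) \<longleftrightarrow>
      (if in_lab M L x \<noteq> 0 \<and> peer M x = s then tok c q \<tau> ?k ?k' (list_encode (s # \<rho>)) (in_lab M L x)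
       else tok c q \<tau> ?k ?k' (list_encode (fst x # s # \<rho>)) (L (prv x)))"
    and bt_step: "tok' c q \<tau> ?k ?k' (list_encode (fst x # s # \<rho>)) (L x) \<longleftrightarrow>
      (if out_lab M L x \<noteq> 0 \<and> peer M x = s then tok' c q \<tau> ?k ?k' (list_encode (s # \<rho>)) (out_lab M L x)
       else tok' c q \<tau> ?k ?k' (list_encode (fst x # s # \<rho>)) (L (nxt x)))"
    if x: "x \<in> E" "fst x # s # \<rho> \<in> seqs (set_decode P)" "c < 3" for x s \<rho> c
  proof -
    have S: "list_encode (s # \<rho>) \<in> set_decode (seq_codes P)" "list_encode (fst x # s # \<rho>) \<in> set_decode (seq_codes P)"
      using x(2) seqs_Cons[OF x(2)] inS by blast+
    show "tok c q \<tau> ?k ?k' (list_encode (fst x # s # \<rho>)) (L x) \<longleftrightarrow>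
      (if in_lab M L x \<noteq> 0 \<and> peer M x = s then tok c q \<tau> ?k ?k' (list_encode (s # \<rho>)) (in_lab M L x)
       else tok c q \<tau> ?k ?k' (list_encode (fst x # s # \<rho>)) (L (prv x)))"
      using conjunct2[OF ft[OF x(1), unfolded fwd_tok_def], rule_format, of "list_encode (s # \<rho>)" c] S x(3)
      unfolding list_encode_simps(2)[symmetric] list_encode_simps(3) using list_encode_simps(4)[of s \<rho>] by blast
    show "tok' c q \<tau> ?k ?k' (list_encode (fst x # s # \<rho>)) (L x) \<longleftrightarrow>
      (if out_lab M L x \<noteq> 0 \<and> peer M x = s then tok' c q \<tau> ?k ?k' (list_encode (s # \<rho>)) (out_lab M L x)
       else tok' c q \<tau> ?k ?k' (list_encode (fst x # s # \<rho>)) (L (nxt x)))"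
      using conjunct2[OF bt[OF x(1), unfolded bwd_tok_def], rule_format, of "list_encode (s # \<rho>)" c] S x(3)
      unfolding list_encode_simps(2)[symmetric] list_encode_simps(3) using list_encode_simps(4)[of s \<rho>] by blast
  qed
  have F_tok: "(\<forall>f\<in>A. \<not> F.reach \<rho> f x) \<and> T \<rho> x = {} \<or>
    (\<exists>f\<in>A. F.reach \<rho> f x \<and> (\<forall>g\<in>A. F.reach \<rho> g x \<longrightarrow> g = f \<or> before g f) \<and> T \<rho> x = T [q] f)"
    if "\<rho> \<in> seqs (set_decode P)" "\<rho> \<noteq> []" "hd \<rho> = fst x" "x \<in> E" for \<rho> x
    using AE Aq seqs_Cons _ _ _ that
  proof (rule F.token)
    fix x assume x: "x \<in> E" "x \<notin> A"
    then show "T [fst x] x = (if prv x \<in> E then T [fst x] (prv x) else {})"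
      using ft[OF x(1)] T0[of "prv x" "[fst x]"] A by (auto simp: fwd_tok_def T_def)
  next
    fix x s \<rho> z assume x: "x \<in> E" "fst x # s # \<rho> \<in> seqs (set_decode P)" "(z, x) \<in> msg M" "fst z = s"
    have "\<forall>c<3. tok c q \<tau> ?k ?k' (list_encode (fst x # s # \<rho>)) (L x) \<longleftrightarrow>
        tok c q \<tau> ?k ?k' (list_encode (s # \<rho>)) (L z)"
      using ft_step[OF x(1,2)] x(4) msg_labs(1,3)[OF msc x(3)] Lnz[of z] F.m_E[OF x(3)] by simp
    then show "T (fst x # s # \<rho>) x = T (s # \<rho>) z" by (auto simp: T_def)
  next
    fix x s \<rho> assume x: "x \<in> E" "fst x # s # \<rho> \<in> seqs (set_decode P)" "\<not> (\<exists>z. (z, x) \<in> msg M \<and> fst z = s)"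
    have "\<forall>c<3. tok c q \<tau> ?k ?k' (list_encode (fst x # s # \<rho>)) (L x) \<longleftrightarrow>
        tok c q \<tau> ?k ?k' (list_encode (fst x # s # \<rho>)) (L (prv x))"
      using ft_step[OF x(1,2), unfolded if_not_P[OF no_msg_peer[OF x(3)]]] by blast
    then show "T (fst x # s # \<rho>) x = (if prv x \<in> E then T (fst x # s # \<rho>) (prv x) else {})"
      using T0(1)[of "prv x"] by (auto simp: T_def)
  qed
  have B_tok: "(\<forall>f\<in>A. \<not> B.reach \<rho> f x) \<and> T' \<rho> x = {} \<or>
    (\<exists>f\<in>A. B.reach \<rho> f x \<and> (\<forall>g\<in>A. B.reach \<rho> g x \<longrightarrow> g = f \<or> before f g) \<and> T' \<rho> x = T' [q] f)"
    if "\<rho> \<in> seqs (set_decode P)" "\<rho> \<noteq> []" "hd \<rho> = fst x" "x \<in> E" for \<rho> x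
    using AE Aq seqs_Cons _ _ _ that
  proof (rule B.token)
    fix x assume x: "x \<in> E" "x \<notin> A"
    then show "T' [fst x] x = (if nxt x \<in> E then T' [fst x] (nxt x) else {})"
      using bt[OF x(1)] T0[of "nxt x" "[fst x]"] A by (auto simp: bwd_tok_def T'_def)
  next
    fix x s \<rho> z assume x: "x \<in> E" "fst x # s # \<rho> \<in> seqs (set_decode P)" "(z, x) \<in> (msg M)\<inverse>" "fst z = s"
    then have xz: "(x, z) \<in> msg M" by simp
    have "\<forall>c<3. tok' c q \<tau> ?k ?k' (list_encode (fst x # s # \<rho>)) (L x) \<longleftrightarrow>
        tok' c q \<tau> ?k ?k' (list_encode (s # \<rho>)) (L z)"
      using bt_step[OF x(1,2)] x(4) msg_labs(4,6)[OF msc xz] Lnz[of z] F.m_E[OF xz] by simp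
    then show "T' (fst x # s # \<rho>) x = T' (s # \<rho>) z" by (auto simp: T'_def)
  next
    fix x s \<rho> assume x: "x \<in> E" "fst x # s # \<rho> \<in> seqs (set_decode P)" "\<not> (\<exists>z. (z, x) \<in> (msg M)\<inverse> \<and> fst z = s)"
    then have no: "\<not> (\<exists>z. (x, z) \<in> msg M \<and> fst z = s)" by simp
    have "\<forall>c<3. tok' c q \<tau> ?k ?k' (list_encode (fst x # s # \<rho>)) (L x) \<longleftrightarrow>
        tok' c q \<tau> ?k ?k' (list_encode (fst x # s # \<rho>)) (L (nxt x))"
      using bt_step[OF x(1,2), unfolded if_not_P[OF no_msg_peer_out[OF no]]] by blast
    then show "T' (fst x # s # \<rho>) x = (if nxt x \<in> E then T' (fst x # s # \<rho>) (nxt x) else {})"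
      using T0(2)[of "nxt x"] by (auto simp: T'_def)
  qed
  have fE: "f \<in> E" and gE: "g \<in> E" using f g AE by blast+
  have fg: "before f g"
  proof (rule F.lt_imp_bef)
    have "f \<noteq> e" using f eA by blast
    then show "(f, g) \<in> F.D\<^sup>+" using f(2) g(2) by (metis rtranclD trancl_rtrancl_trancl)
  qed (use f g Aq in simp)
  have nobetween: "h = f \<or> before h f \<or> h = g \<or> before g h" if "h \<in> A" for h
    using cmp[OF that] fmax[OF that] gmin[OF that] by blast
  have "T \<pi> e = T [q] f"
  proof -
    have "\<pi> \<noteq> []" "hd \<pi> = fst e" using F.reach_loc[OF \<pi>(3)] by auto
    from F_tok[OF S(1) this e] obtain h where h: "h \<in> A" "F.reach \<pi> h e" "f = h \<or> before f h" "T \<pi> e = T [q] h"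
      using \<pi>(3) f(1) by blast
    \<comment> \<open>The token along \<pi> belongs to the latest element arriving along \<pi>. This
      is f, which itself arrives along \<pi> and is the latest in the whole past.\<close>
    then have "h = f" using fmax[OF h(1) F.reach_le[OF h(2)]] F.bef_asym by blast
    with h show ?thesis by simp
  qed
  moreover have "T' \<pi>' e = T' [q] g"
  proof -
    have "\<pi>' \<noteq> []" "hd \<pi>' = fst e" using B.reach_loc[OF \<pi>'(3)] by auto
    from B_tok[OF S(2) this e] obtain h where h: "h \<in> A" "B.reach \<pi>' h e" "g = h \<or> before h g" "T' \<pi>' e = T' [q] h"
      using \<pi>'(3) g(1) by blast
    moreover have "(e, h) \<in> F.D\<^sup>*" using B.reach_le[OF h(2)] by simp
    ultimately have "h = g" using gmin[OF h(1)] F.bef_asym by blast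
    with h show ?thesis by simp
  qed
  \<comment> \<open>The token that starts backwards at g takes its colours from the label before g,
    where they are those of f by the next step.\<close>
  moreover have "T' [q] g = T [q] (prv g)"
    using ft[OF gE] g(1) A Aq[OF g(1)] by (auto simp: fwd_tok_def T_def T'_def)
  moreover have "T [q] (prv g) = T [q] f"
  proof -
    have pg: "prv g \<in> E" "f = prv g \<or> before f (prv g)" using F.bef_pv gE fE fg by blast+
    have loc: "fst (prv g) = q" using Aq[OF g(1)] by (simp add: prv_def)
    have "q \<in> set_decode P" using gE Aq[OF g(1)] by (auto simp: in_E)
    then have "[q] \<in> seqs (set_decode P)" by (rule seqs_single)
    moreover have "F.reach [q] f (prv g)" using pg loc fE by simp
    ultimately obtain h where h: "h \<in> A" "F.reach [q] h (prv g)" "f = h \<or> before f h" "T [q] (prv g) = T [q] h"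
      using F_tok[of "[q]" "prv g"] pg(1) loc f(1) by auto
    then have "h = prv g \<or> before h (prv g)" by simp
    then have "before h g" using F.bef_pv[OF gE, of h] pg(1) h(1) AE by blast
    then have "h = f" using nobetween[OF h(1)] h(3) F.bef_asym F.bef_irrefl by blast
    with h show ?thesis by simp
  qed
  moreover have "T [q] f \<noteq> {}"
    using ft[OF fE] f(1) A Aq[OF f(1)] by (auto simp: fwd_tok_def T_def)
  ultimately obtain c where "c \<in> T \<pi> e" "c \<in> T' \<pi>' e" by blast
  then show ?thesis using K by (auto simp: T_def T'_def)
qed

text \<open>Since \<open>A\<close> lies on one process, positions identify its elements, and the
  colouring can be one of numbers as in \<open>chain_colouring\<close>.\<close>

definition sem_tok :: "nat event set \<Rightarrow> (nat \<Rightarrow> nat) \<Rightarrow> nat list \<Rightarrow> nat event \<Rightarrow> nat \<Rightarrow> bool" where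
  "sem_tok A \<chi> \<rho> e c \<longleftrightarrow> (\<exists>f. F.latest A \<rho> e f \<and> c = \<chi> (snd f))"

definition sem_tok' :: "nat event set \<Rightarrow> (nat \<Rightarrow> nat) \<Rightarrow> nat list \<Rightarrow> nat event \<Rightarrow> nat \<Rightarrow> bool" where
  "sem_tok' A \<chi> \<rho> e c \<longleftrightarrow> (\<exists>g h. B.latest A \<rho> e g \<and> prv g \<in> E \<and> F.latest A [fst g] (prv g) h \<and> c = \<chi> (snd h))"

lemma tokens_complete:
  assumes L0: "\<And>e. e \<notin> E \<Longrightarrow> L e = 0" and Lnz: "\<And>e. e \<in> E \<Longrightarrow> L e \<noteq> 0"
    and A: "\<And>e. isA q \<tau> (L e) \<longleftrightarrow> e \<in> A" and AE: "A \<subseteq> E" and Aq: "\<And>e. e \<in> A \<Longrightarrow> fst e = q"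
    and \<chi>: "\<And>u. \<chi> u < 3"
    and t: "\<And>c \<rho> e. c < 3 \<Longrightarrow> \<rho> \<in> seqs (set_decode P) \<Longrightarrow>
      tok c q \<tau> \<pi> \<pi>' (list_encode \<rho>) (L e) \<longleftrightarrow> e \<in> E \<and> sem_tok A \<chi> \<rho> e c"
    and t': "\<And>c \<rho> e. c < 3 \<Longrightarrow> \<rho> \<in> seqs (set_decode P) \<Longrightarrow>
      tok' c q \<tau> \<pi> \<pi>' (list_encode \<rho>) (L e) \<longleftrightarrow> e \<in> E \<and> sem_tok' A \<chi> \<rho> e c"
    and e: "e \<in> E"
  shows "fwd_tok P (fst e) (L (prv e)) (L e) (in_lab M L e) (peer M e) q \<tau> \<pi> \<pi>'"
    "bwd_tok P (fst e) (L e) (out_lab M L e) (peer M e) (L (nxt e)) q \<tau> \<pi> \<pi>'"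
proof -
  have p: "[fst e] \<in> seqs (set_decode P)" by (rule seqs_single) (use e in \<open>simp add: in_E\<close>)
  have dec: "\<exists>s \<rho>'. \<rho> = list_encode (s # \<rho>') \<and> s # \<rho>' \<in> seqs (set_decode P)"
    if \<rho>: "\<rho> \<in> set_decode (seq_codes P)" "\<rho> \<noteq> 0" for \<rho>
  proof -
    obtain xs where xs: "\<rho> = list_encode xs" "xs \<in> seqs (set_decode P)" using \<rho>(1) by (auto simp: set_decode_seq_codes)
    then show ?thesis using \<rho>(2) by (cases xs) (auto simp: list_encode.simps(1))
  qed
  have inS: "list_encode \<rho> \<in> set_decode (seq_codes P) \<longleftrightarrow> \<rho> \<in> seqs (set_decode P)" for \<rho>
    by (auto simp: set_decode_seq_codes inj_image_mem_iff[OF inj_list_encode])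
  show "fwd_tok P (fst e) (L (prv e)) (L e) (in_lab M L e) (peer M e) q \<tau> \<pi> \<pi>'"
    unfolding fwd_tok_def
  proof (intro conjI ballI impI)
    show "if isA q \<tau> (L e)
      then (\<exists>c<3. tok c q \<tau> \<pi> \<pi>' (list_encode [fst e]) (L e)) \<and>
        (\<forall>c<3. tok' c q \<tau> \<pi> \<pi>' (list_encode [fst e]) (L e) \<longleftrightarrow> tok c q \<tau> \<pi> \<pi>' (list_encode [fst e]) (L (prv e)))
      else \<forall>c<3. tok c q \<tau> \<pi> \<pi>' (list_encode [fst e]) (L e) \<longleftrightarrow> tok c q \<tau> \<pi> \<pi>' (list_encode [fst e]) (L (prv e))"
    proof (cases "e \<in> A")
      case True
      then have "sem_tok A \<chi> [fst e] e (\<chi> (snd e))"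
        unfolding sem_tok_def F.latest_self[OF True AE] by blast
      then have "\<exists>c<3. tok c q \<tau> \<pi> \<pi>' (list_encode [fst e]) (L e)" using t[OF \<chi> p] e \<chi> by blast
      moreover have "sem_tok' A \<chi> [fst e] e c \<longleftrightarrow> prv e \<in> E \<and> sem_tok A \<chi> [fst e] (prv e) c" for c
        unfolding sem_tok'_def sem_tok_def B.latest_self[OF True AE] by blast
      ultimately show ?thesis using t t' p e True A by simp
    next
      case False
      have "sem_tok A \<chi> [fst e] e c \<longleftrightarrow> prv e \<in> E \<and> sem_tok A \<chi> [fst e] (prv e) c" for c
        unfolding sem_tok_def F.latest_pv[OF e False] by blast
      then show ?thesis using t p e False A by simp
    qed
  next
    fix \<rho> assume \<rho>: "\<rho> \<in> set_decode (seq_codes P)" "\<rho> \<noteq> 0 \<and> Suc (prod_encode (fst e, \<rho>)) \<in> set_decode (seq_codes P)"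
    obtain s \<rho>' where s: "\<rho> = list_encode (s # \<rho>')" "s # \<rho>' \<in> seqs (set_decode P)" using dec \<rho> by blast
    have c: "Suc (prod_encode (fst e, \<rho>)) = list_encode (fst e # s # \<rho>')" unfolding s(1) list_encode_simps ..
    then have S: "fst e # s # \<rho>' \<in> seqs (set_decode P)" using \<rho> inS by metis
    have tg: "tag \<rho> = s" unfolding s(1) list_encode_simps ..
    show "\<forall>c<3. tok c q \<tau> \<pi> \<pi>' (Suc (prod_encode (fst e, \<rho>))) (L e) \<longleftrightarrow>
         (if in_lab M L e \<noteq> 0 \<and> peer M e = tag \<rho> then tok c q \<tau> \<pi> \<pi>' \<rho> (in_lab M L e)
          else tok c q \<tau> \<pi> \<pi>' (Suc (prod_encode (fst e, \<rho>))) (L (prv e)))"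
    proof (cases "\<exists>z. (z, e) \<in> msg M \<and> fst z = s")
      case True
      then obtain z where z: "(z, e) \<in> msg M" "fst z = s" by blast
      have "in_lab M L e = L z" "peer M e = s" "L z \<noteq> 0" "z \<in> E"
        using msg_labs(1,3)[OF msc z(1)] z(2) Lnz F.m_E[OF z(1)] by auto
      moreover have "sem_tok A \<chi> (fst e # s # \<rho>') e c \<longleftrightarrow> sem_tok A \<chi> (s # \<rho>') z c" for c
        unfolding sem_tok_def F.latest_m[OF z] ..
      ultimately show ?thesis unfolding c tg using t[OF _ S] t[OF _ s(2)] e s(1) by simp
    next
      case False
      have "sem_tok A \<chi> (fst e # s # \<rho>') e c \<longleftrightarrow> prv e \<in> E \<and> sem_tok A \<chi> (fst e # s # \<rho>') (prv e) c" for c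
        unfolding sem_tok_def F.latest_other[OF e False] by blast
      then show ?thesis unfolding c tg if_not_P[OF no_msg_peer[OF False]] using t[OF _ S] e by simp
    qed
  qed
  show "bwd_tok P (fst e) (L e) (out_lab M L e) (peer M e) (L (nxt e)) q \<tau> \<pi> \<pi>'"
    unfolding bwd_tok_def
  proof (intro conjI ballI impI)
    assume "\<not> isA q \<tau> (L e)"
    then have False: "e \<notin> A" using A by blast
    have "sem_tok' A \<chi> [fst e] e c \<longleftrightarrow> nxt e \<in> E \<and> sem_tok' A \<chi> [fst e] (nxt e) c" for c
      unfolding sem_tok'_def B.latest_pv[OF e False] by blast
    then show "\<forall>c<3. tok' c q \<tau> \<pi> \<pi>' (list_encode [fst e]) (L e) \<longleftrightarrow> tok' c q \<tau> \<pi> \<pi>' (list_encode [fst e]) (L (nxt e))"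
      using t' p e by simp
  next
    fix \<rho> assume \<rho>: "\<rho> \<in> set_decode (seq_codes P)" "\<rho> \<noteq> 0 \<and> Suc (prod_encode (fst e, \<rho>)) \<in> set_decode (seq_codes P)"
    obtain s \<rho>' where s: "\<rho> = list_encode (s # \<rho>')" "s # \<rho>' \<in> seqs (set_decode P)" using dec \<rho> by blast
    have c: "Suc (prod_encode (fst e, \<rho>)) = list_encode (fst e # s # \<rho>')" unfolding s(1) list_encode_simps ..
    then have S: "fst e # s # \<rho>' \<in> seqs (set_decode P)" using \<rho> inS by metis
    have tg: "tag \<rho> = s" unfolding s(1) list_encode_simps ..
    show "\<forall>c<3. tok' c q \<tau> \<pi> \<pi>' (Suc (prod_encode (fst e, \<rho>))) (L e) \<longleftrightarrow>
         (if out_lab M L e \<noteq> 0 \<and> peer M e = tag \<rho> then tok' c q \<tau> \<pi> \<pi>' \<rho> (out_lab M L e)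
          else tok' c q \<tau> \<pi> \<pi>' (Suc (prod_encode (fst e, \<rho>))) (L (nxt e)))"
    proof (cases "\<exists>z. (e, z) \<in> msg M \<and> fst z = s")
      case True
      then obtain z where z: "(e, z) \<in> msg M" "fst z = s" by blast
      have "out_lab M L e = L z" "peer M e = s" "L z \<noteq> 0" "z \<in> E"
        using msg_labs(4,6)[OF msc z(1)] z(2) Lnz F.m_E[OF z(1)] by auto
      moreover have "sem_tok' A \<chi> (fst e # s # \<rho>') e c \<longleftrightarrow> sem_tok' A \<chi> (s # \<rho>') z c" for c
        unfolding sem_tok'_def B.latest_m[OF converseI[OF z(1)] z(2)] ..
      ultimately show ?thesis unfolding c tg using t'[OF _ S] t'[OF _ s(2)] e s(1) by simp
    next
      case False
      then have F': "\<not> (\<exists>z. (z, e) \<in> (msg M)\<inverse> \<and> fst z = s)" by simp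
      have "sem_tok' A \<chi> (fst e # s # \<rho>') e c \<longleftrightarrow> nxt e \<in> E \<and> sem_tok' A \<chi> (fst e # s # \<rho>') (nxt e) c" for c
        unfolding sem_tok'_def B.latest_other[OF e F'] by blast
      then show ?thesis unfolding c tg if_not_P[OF no_msg_peer_out[OF False]] using t'[OF _ S] e by simp
    qed
  qed
qed

definition is_colouring :: "nat event set \<Rightarrow> nat list \<Rightarrow> nat list \<Rightarrow> (nat \<Rightarrow> nat) \<Rightarrow> bool" where
  "is_colouring A \<pi> \<pi>' \<chi> \<longleftrightarrow> (\<forall>u. \<chi> u < 3) \<and> (\<forall>e\<in>E. (\<exists>w\<in>A. rel M e w = 7) \<longrightarrow>
    (\<forall>c. \<not> (sem_tok A \<chi> \<pi> e c \<and> sem_tok' A \<chi> \<pi>' e c)))"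

text \<open>The colours to be separated are those of f, the latest element below e along \<pi>, and
  of h, the predecessor in \<open>A\<close> of the earliest element g above e along \<pi>'. A
  parallel element lies strictly between f and g, so h is strictly after f. For fixed sequences, all
  such e lie on the process at the head of \<pi>, and f, g and h move monotonically with e. Hence
  the pairs of f and h satisfy the assumptions of \<open>chain_colouring\<close>.\<close>

lemma colouring_exists:
  assumes AE: "A \<subseteq> E" and Aq: "\<And>e. e \<in> A \<Longrightarrow> fst e = q"
  shows "\<exists>\<chi>. is_colouring A \<pi> \<pi>' \<chi>"
proof -
  let ?W = "\<lambda>e f g h. e \<in> E \<and> (\<exists>w\<in>A. rel M e w = 7) \<and> F.latest A \<pi> e f \<and> B.latest A \<pi>' e g \<and>
    prv g \<in> E \<and> F.latest A [fst g] (prv g) h"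
  define R where "R = {(snd f, snd h) |f h. \<exists>e g. ?W e f g h}"
  have inA: "f \<in> A \<and> g \<in> A \<and> h \<in> A \<and> before h g \<and> (f, e) \<in> F.D\<^sup>* \<and> (e, g) \<in> F.D\<^sup>*" if "?W e f g h" for e f g h
  proof -
    have A: "f \<in> A" "g \<in> A" "h \<in> A" using that by (auto simp: F.latest_def B.latest_def)
    have "F.reach [fst g] h (prv g)" using that by (simp add: F.latest_def)
    then have "h = prv g \<or> before h (prv g)" by simp
    then have "before h g" using F.bef_pv[of g h] A AE that by blast
    moreover have "F.reach \<pi> f e" "B.reach \<pi>' g e"
      using that by (simp_all add: F.latest_def B.latest_def)
    note F.reach_le[OF this(1)] B.reach_le[OF this(2)]
    ultimately show ?thesis using A by simp
  qed
  have pred: "k = h \<or> before k h" if "?W e f g h" "k \<in> A" "before k g" for e f g h k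
  proof -
    have "g \<in> E" "k \<in> E" using inA[OF that(1)] that AE by blast+
    then have "prv g \<in> E \<and> (k = prv g \<or> before k (prv g))" using F.bef_pv that by blast
    then have "F.reach [fst g] k (prv g)" using \<open>k \<in> E\<close> by (auto simp: prv_def)
    then show ?thesis using that by (auto simp: F.latest_def)
  qed
  have "\<exists>\<chi>. (\<forall>u. \<chi> u < (3::nat)) \<and> (\<forall>(u, v)\<in>R. \<chi> u \<noteq> \<chi> v)"
  proof (rule chain_colouring)
    have "R \<subseteq> snd ` E \<times> snd ` E"
    proof
      fix x assume "x \<in> R"
      then obtain e f g h where W: "?W e f g h" "x = (snd f, snd h)" unfolding R_def by blast
      have "f \<in> E" "h \<in> E" using inA[OF W(1)] AE by blast+
      then show "x \<in> snd ` E \<times> snd ` E" using W(2) by simp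
    qed
    then show "finite R" using finite_E by (meson finite_SigmaI finite_imageI finite_subset)
  next
    fix u v assume "(u, v) \<in> R"
    then obtain e f g h where W: "?W e f g h" "u = snd f" "v = snd h" unfolding R_def by blast
    note i = inA[OF W(1)]
    \<comment> \<open>An element parallel to e can neither precede f nor follow g on their process,
      nor equal one of them, so it lies strictly between.\<close>
    obtain w where w: "w \<in> A" "(e, w) \<notin> F.D\<^sup>*" "(w, e) \<notin> F.D\<^sup>*" using W(1) rel_iff(3) by blast
    have wE: "w \<in> E" "f \<in> E" "g \<in> E" using w i AE by blast+
    have q: "fst w = fst f" "fst w = fst g" "fst f = q" using w(1) i Aq by simp_all
    have "(w, f) \<notin> F.D\<^sup>*" "(g, w) \<notin> F.D\<^sup>*" using w i by (meson rtrancl_trans)+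
    then have "before f w" "before w g"
      using F.bef_total[OF wE(1,2) q(1)] F.bef_total[OF wE(1,3) q(2)] F.bef_le wE by blast+
    then have "w = h \<or> before w h" using pred[OF W(1) w(1)] by blast
    then show "u < v" using \<open>before f w\<close> W(2,3) by (auto simp: before_def)
  next
    fix u v u' v' assume uv: "(u, v) \<in> R" "(u', v') \<in> R" and lt: "u < u'"
    from uv(1) obtain e f g h where W: "?W e f g h" "u = snd f" "v = snd h" unfolding R_def by blast
    from uv(2) obtain e' f' g' h' where W': "?W e' f' g' h'" "u' = snd f'" "v' = snd h'"
      unfolding R_def by blast
    have "F.reach \<pi> f e" "F.reach \<pi> f' e'" using W(1) W'(1) by (simp_all add: F.latest_def)
    then have loc: "fst e = fst e'" using F.reach_loc[of \<pi> f e] F.reach_loc[of \<pi> f' e'] by simp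
    \<comment> \<open>An event e' not after e would have its latest element f' not after f.\<close>
    have "\<not> (e' = e \<or> before e' e)"
    proof
      assume "e' = e \<or> before e' e"
      then have "f' = f \<or> before f' f" using F.latest_mono[of A \<pi> e' f' e f] W(1) W'(1) by blast
      then show False using lt W(2) W'(2) by (auto simp: before_def)
    qed
    then have "before e e'" using F.bef_total[of e e'] loc W(1) W'(1) by blast
    then have "g' = g \<or> before g g'" using B.latest_mono[of A \<pi>' e' g' e g] W(1) W'(1) by blast
    then have "before h g'" using inA[OF W(1)] F.bef_trans by blast
    then have "h = h' \<or> before h h'" using pred[OF W'(1)] inA[OF W(1)] by blast
    then show "v \<le> v'" using W(3) W'(3) by (auto simp: before_def)
  qed
  then obtain \<chi> where \<chi>: "\<forall>u. \<chi> u < (3::nat)" "\<forall>(u, v)\<in>R. \<chi> u \<noteq> \<chi> v" by blast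
  have "\<not> (sem_tok A \<chi> \<pi> e c \<and> sem_tok' A \<chi> \<pi>' e c)" if e: "e \<in> E" "\<exists>w\<in>A. rel M e w = 7" for e c
  proof
    assume "sem_tok A \<chi> \<pi> e c \<and> sem_tok' A \<chi> \<pi>' e c"
    then obtain f g h where W: "?W e f g h" "c = \<chi> (snd f)" "c = \<chi> (snd h)"
      using e unfolding sem_tok_def sem_tok'_def by blast
    then have "(snd f, snd h) \<in> R" unfolding R_def by blast
    then show False using \<chi>(2) W(2,3) by auto
  qed
  then show ?thesis using \<chi>(1) unfolding is_colouring_def by (intro exI[of _ \<chi>]) blast
qed

subsection \<open>Parallel events\<close>

text \<open>If the first element of \<open>A\<close> is above e, then so are all the others, and
  dually for the last one. If \<open>A\<close> does not meet the past of e and its first element is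
  not in the future either, then this element is parallel to e, and dually.\<close>

lemma parallel_bits:
  assumes AE: "A \<subseteq> E" and Aq: "\<And>e. e \<in> A \<Longrightarrow> fst e = q" and e: "e \<in> E"
  shows "fst e = q \<or> sem_fut A 2 e \<or> sem_pst A 2 e \<Longrightarrow> \<not> (\<exists>f\<in>A. rel M e f = 7)"
    "\<not> sem_fut A 2 e \<Longrightarrow> \<not> sem_pst A 2 e \<Longrightarrow> \<not> sem_pst A 0 e \<or> \<not> sem_fut A 0 e \<Longrightarrow>
      (\<exists>f\<in>A. rel M e f = 7) \<longleftrightarrow> A \<noteq> {}"
proof -
  have cmp: "x = y \<or> before x y \<or> before y x" if "x \<in> A" "y \<in> A" for x y
    using that AE Aq by (intro F.bef_total) auto
  have le: "(x, y) \<in> F.D\<^sup>*" if "x \<in> E" "y \<in> E" "x = y \<or> before x y" for x y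
    using that F.bef_le by blast
  assume *: "fst e = q \<or> sem_fut A 2 e \<or> sem_pst A 2 e"
  show "\<not> (\<exists>f\<in>A. rel M e f = 7)"
  proof
    assume "\<exists>f\<in>A. rel M e f = 7"
    then obtain f where f: "f \<in> A" "(e, f) \<notin> F.D\<^sup>*" "(f, e) \<notin> F.D\<^sup>*" unfolding rel_iff by blast
    have fE: "f \<in> E" using f AE by blast
    from * show False
    proof (elim disjE)
      assume "fst e = q"
      then show False using F.bef_total[OF e fE] le[OF e fE] le[OF fE e] f Aq[OF f(1)] by metis
    next
      assume "sem_fut A 2 e"
      then obtain g where g: "g \<in> A" "(e, g) \<in> F.D\<^sup>*" "\<not> before f g" using f by (auto simp: sem_fut_def)
      then have "(g, f) \<in> F.D\<^sup>*" using cmp[OF f(1) g(1)] le[of g f] AE fE by blast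
      then show False using g f by (meson rtrancl_trans)
    next
      assume "sem_pst A 2 e"
      then obtain g where g: "g \<in> A" "(g, e) \<in> F.D\<^sup>*" "\<not> before g f" using f by (auto simp: sem_pst_def)
      then have "(f, g) \<in> F.D\<^sup>*" using cmp[OF f(1) g(1)] le[of f g] AE fE by blast
      then show False using g f by (meson rtrancl_trans)
    qed
  qed
next
  assume n: "\<not> sem_fut A 2 e" "\<not> sem_pst A 2 e" "\<not> sem_pst A 0 e \<or> \<not> sem_fut A 0 e"
  have "\<exists>f\<in>A. rel M e f = 7" if ne: "A \<noteq> {}"
    using n(3)
  proof
    assume p: "\<not> sem_pst A 0 e"
    obtain f where f: "f \<in> A" "\<And>g. g \<in> A \<Longrightarrow> g = f \<or> before f g" using obtain_first[OF AE Aq ne] by blast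
    have "\<not> (\<exists>g\<in>A. before g f)" using f F.bef_asym F.bef_irrefl by blast
    then have "(e, f) \<notin> F.D\<^sup>*" using n(1) f(1) by (auto simp: sem_fut_def)
    moreover have "(f, e) \<notin> F.D\<^sup>*" using p f(1) by (auto simp: sem_pst_def)
    ultimately show ?thesis using f(1) rel_iff(3) by blast
  next
    assume p: "\<not> sem_fut A 0 e"
    obtain f where f: "f \<in> A" "\<And>g. g \<in> A \<Longrightarrow> g = f \<or> before g f" using obtain_last[OF AE Aq ne] by blast
    have "\<not> (\<exists>g\<in>A. before f g)" using f F.bef_asym F.bef_irrefl by blast
    then have "(f, e) \<notin> F.D\<^sup>*" using n(2) f(1) by (auto simp: sem_pst_def)
    moreover have "(e, f) \<notin> F.D\<^sup>*" using p f(1) by (auto simp: sem_fut_def)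
    ultimately show ?thesis using f(1) rel_iff(3) by blast
  qed
  then show "(\<exists>f\<in>A. rel M e f = 7) \<longleftrightarrow> A \<noteq> {}" by blast
qed

text \<open>In the case that needs a certificate, a false positive claim is refuted by
  \<open>tokens_meet\<close> and a false negative one by \<open>line_sound\<close>.\<close>

lemma parallel_sound:
  assumes L0: "\<And>e. e \<notin> E \<Longrightarrow> L e = 0" and Lnz: "\<And>e. e \<in> E \<Longrightarrow> L e \<noteq> 0"
    and A: "\<And>e. isA q \<tau> (L e) \<longleftrightarrow> e \<in> A" and AE: "A \<subseteq> E" and Aq: "\<And>e. e \<in> A \<Longrightarrow> fst e = q"
    and bits: "\<And>e. e \<in> E \<Longrightarrow> sem_bits L q \<tau> A e"
    and fl: "\<And>x. x \<in> E \<Longrightarrow> fwd_line (L (prv x)) (L x) (in_lab M L x) q \<tau> (fst e)"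
    and bl: "\<And>x. x \<in> E \<Longrightarrow> bwd_line (L x) (out_lab M L x) (L (nxt x)) q \<tau> (fst e)"
    and ft: "\<And>e \<pi> \<pi>'. e \<in> E \<Longrightarrow> \<pi> \<in> set_decode (seq_codes P) \<Longrightarrow> \<pi>' \<in> set_decode (seq_codes P) \<Longrightarrow>
      fwd_tok P (fst e) (L (prv e)) (L e) (in_lab M L e) (peer M e) q \<tau> \<pi> \<pi>'"
    and bt: "\<And>e \<pi> \<pi>'. e \<in> E \<Longrightarrow> \<pi> \<in> set_decode (seq_codes P) \<Longrightarrow> \<pi>' \<in> set_decode (seq_codes P) \<Longrightarrow>
      bwd_tok P (fst e) (L e) (out_lab M L e) (peer M e) (L (nxt e)) q \<tau> \<pi> \<pi>'"
    and gl: "glob q \<tau> (L e) \<longleftrightarrow> A \<noteq> {}"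
    and par: "fwd_par P (fst e) (L e) q \<tau>" and e: "e \<in> E"
  shows "obs 7 q \<tau> (L e) \<longleftrightarrow> (\<exists>f\<in>A. rel M e f = 7)"
proof -
  have b: "pst 0 q \<tau> (L e) \<longleftrightarrow> sem_pst A 0 e" "pst 2 q \<tau> (L e) \<longleftrightarrow> sem_pst A 2 e"
    "fut 0 q \<tau> (L e) \<longleftrightarrow> sem_fut A 0 e" "fut 2 q \<tau> (L e) \<longleftrightarrow> sem_fut A 2 e"
    using bits[OF e] by (simp_all add: sem_bits_def)
  have b0: "bas 0 q \<tau> (L x) \<longleftrightarrow> x \<in> A \<and> (\<exists>g\<in>A. before g x)" if "x \<in> E" for x
    using bits[OF that] by (simp add: sem_bits_def)
  note par = par[unfolded fwd_par_def b]
  consider (none) "q = fst e \<or> sem_fut A 2 e \<or> sem_pst A 2 e"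
    | (some) "\<not> (q = fst e \<or> sem_fut A 2 e \<or> sem_pst A 2 e)" "\<not> sem_pst A 0 e \<or> \<not> sem_fut A 0 e"
    | (both) "\<not> (q = fst e \<or> sem_fut A 2 e \<or> sem_pst A 2 e)" "sem_pst A 0 e" "sem_fut A 0 e"
    by blast
  then show ?thesis
  proof cases
    case none
    then show ?thesis using par parallel_bits(1)[OF AE Aq e] by auto
  next
    case some
    then show ?thesis using par parallel_bits(2)[OF AE Aq e] gl by auto
  next
    case both
    then have pf: "\<exists>f\<in>A. (f, e) \<in> F.D\<^sup>*" "\<exists>f\<in>A. (e, f) \<in> F.D\<^sup>*" "e \<notin> A"
      using Aq[of e] by (simp add: sem_pst_def, simp add: sem_fut_def, blast)
    show ?thesis
    proof
      assume o: "obs 7 q \<tau> (L e)"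
      show "\<exists>f\<in>A. rel M e f = 7"
      proof (rule ccontr)
        assume "\<not> ?thesis"
        then have cmp: "\<And>f. f \<in> A \<Longrightarrow> (f, e) \<in> F.D\<^sup>* \<or> (e, f) \<in> F.D\<^sup>*" using rel_iff(3) by blast
        have "\<exists>\<pi>\<in>set_decode (seq_codes P). \<exists>\<pi>'\<in>set_decode (seq_codes P).
            \<exists>c<3. tok c q \<tau> \<pi> \<pi>' \<pi> (L e) \<and> tok' c q \<tau> \<pi> \<pi>' \<pi>' (L e)"
          by (rule tokens_meet[where A = A]; fact L0 Lnz A AE Aq ft bt e pf cmp)
        then show False using par both o by auto
      qed
    next
      assume r: "\<exists>f\<in>A. rel M e f = 7"
      show "obs 7 q \<tau> (L e)"
      proof (rule ccontr)
        assume "\<not> obs 7 q \<tau> (L e)"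
        then have "line 0 (fst e) q \<tau> (L e) \<or> line 1 (fst e) q \<tau> (L e)" using par both by auto
        then have ln: "line 0 (fst e) q \<tau> (L e) \<or> line 1 (fst e) q \<tau> (L e)" .
        have "(f, e) \<in> F.D\<^sup>* \<or> (e, f) \<in> F.D\<^sup>*" if f: "f \<in> A" for f
          by (rule line_sound[where A = A and p = "fst e"]; fact L0 A AE Aq b0 fl bl e ln f)
        then show False using r rel_iff(3) by blast
      qed
    qed
  qed
qed

lemma parallel_complete:
  assumes AE: "A \<subseteq> E" and Aq: "\<And>e. e \<in> A \<Longrightarrow> fst e = q"
    and bits: "sem_bits L q \<tau> A e"
    and ob: "obs 7 q \<tau> (L e) \<longleftrightarrow> (\<exists>f\<in>A. rel M e f = 7)" and gl: "glob q \<tau> (L e) \<longleftrightarrow> A \<noteq> {}"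
    and ln: "e \<notin> A \<Longrightarrow> \<exists>f\<in>A. (f, e) \<in> F.D\<^sup>* \<Longrightarrow> \<forall>f\<in>A. (f, e) \<in> F.D\<^sup>* \<or> (e, f) \<in> F.D\<^sup>* \<Longrightarrow>
      line 0 (fst e) q \<tau> (L e) \<or> line 1 (fst e) q \<tau> (L e)"
    and tk: "\<And>\<pi> \<pi>' c. \<pi> \<in> set_decode (seq_codes P) \<Longrightarrow> \<pi>' \<in> set_decode (seq_codes P) \<Longrightarrow> c < 3 \<Longrightarrow>
      \<exists>w\<in>A. rel M e w = 7 \<Longrightarrow> \<not> (tok c q \<tau> \<pi> \<pi>' \<pi> (L e) \<and> tok' c q \<tau> \<pi> \<pi>' \<pi>' (L e))"
    and e: "e \<in> E"
  shows "fwd_par P (fst e) (L e) q \<tau>"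
proof -
  have b: "pst 0 q \<tau> (L e) \<longleftrightarrow> sem_pst A 0 e" "pst 2 q \<tau> (L e) \<longleftrightarrow> sem_pst A 2 e"
    "fut 0 q \<tau> (L e) \<longleftrightarrow> sem_fut A 0 e" "fut 2 q \<tau> (L e) \<longleftrightarrow> sem_fut A 2 e"
    using bits by (simp_all add: sem_bits_def)
  note n = parallel_bits[OF AE Aq e]
  show ?thesis
  proof (cases "q = fst e \<or> sem_fut A 2 e \<or> sem_pst A 2 e")
    case True
    then show ?thesis unfolding fwd_par_def b using n(1) ob by auto
  next
    case F: False
    show ?thesis
    proof (cases "\<not> sem_pst A 0 e \<or> \<not> sem_fut A 0 e")
      case True
      then show ?thesis unfolding fwd_par_def b using n(2) F ob gl by auto
    next
      case False
      show ?thesis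
      proof (cases "obs 7 q \<tau> (L e)")
        case True
        then show ?thesis unfolding fwd_par_def b using F False tk ob by auto
      next
        case no: False
        have "\<forall>f\<in>A. (f, e) \<in> F.D\<^sup>* \<or> (e, f) \<in> F.D\<^sup>*" using no ob rel_iff(3) by blast
        moreover have "\<exists>f\<in>A. (f, e) \<in> F.D\<^sup>*" using False by (auto simp: sem_pst_def)
        ultimately have "line 0 (fst e) q \<tau> (L e) \<or> line 1 (fst e) q \<tau> (L e)" using ln F Aq by blast
        then show ?thesis unfolding fwd_par_def b using F False no by auto
      qed
    qed
  qed
qed

subsection \<open>Labellings and types\<close>

lemma last_in_E: "e \<in> E \<Longrightarrow> (fst e, length (word M (fst e))) \<in> E"
  by (auto simp: in_E)

text \<open>Acceptance fixes the global bit at the last event of each process, and the backward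
  conditions carry it to all earlier ones.\<close>

lemma good_glob:
  assumes L: "good P \<phi> M L" and e: "e \<in> E" and q: "q \<in> set_decode P" "\<tau> \<in> set_decode (type_codes \<phi>)"
  shows "glob q \<tau> (L e) \<longleftrightarrow> pst 0 q \<tau> (L (q, length (word M q)))"
proof -
  have "glob q \<tau> (L (fst e, length (word M (fst e)) - k)) \<longleftrightarrow> pst 0 q \<tau> (L (q, length (word M q)))"
    if "k < length (word M (fst e))" for k
    using that
  proof (induction k)
    case 0
    then show ?case using L q e unfolding good_def by (auto simp: in_E)
  next
    case (Suc k)
    let ?x = "(fst e, length (word M (fst e)) - Suc k)"
    have x: "?x \<in> E" "nxt ?x = (fst e, length (word M (fst e)) - k)" "nxt ?x \<in> E"
      using Suc.prems e by (auto simp: in_E nxt_def)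
    have "bwd_bits (L ?x) (out_lab M L ?x) (L (nxt ?x)) q \<tau>" "L (nxt ?x) \<noteq> 0"
      using L x(1,3) q unfolding good_def bwd_def by blast+
    then have "glob q \<tau> (L ?x) \<longleftrightarrow> glob q \<tau> (L (nxt ?x))" by (simp add: bwd_bits_def)
    then show ?case using Suc x(2) by simp
  qed
  moreover have "length (word M (fst e)) - snd e < length (word M (fst e))" using e by (auto simp: in_E)
  ultimately have "glob q \<tau> (L (fst e, length (word M (fst e)) - (length (word M (fst e)) - snd e))) \<longleftrightarrow>
      pst 0 q \<tau> (L (q, length (word M q)))" by blast
  then show ?thesis using e by (simp add: in_E)
qed

lemma in_last_past: "(\<exists>f\<in>E. fst f = q \<and> R f \<and> (f, (q, length (word M q))) \<in> F.D\<^sup>*) \<longleftrightarrow> (\<exists>f\<in>E. fst f = q \<and> R f)"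
proof -
  have "(f, (q, length (word M q))) \<in> F.D\<^sup>*" if "f \<in> E" "fst f = q" for f
  proof (cases "snd f = length (word M q)")
    case True
    then have "f = (q, length (word M q))" using that by (simp add: prod_eq_iff)
    then show ?thesis by simp
  next
    case False
    then show ?thesis using F.bef_le[of "(q, length (word M q))" f] that last_in_E[of f]
      by (auto simp: before_def in_E)
  qed
  then show ?thesis by blast
qed

definition typed :: "(nat, nat) fm \<Rightarrow> (nat event \<Rightarrow> nat) \<Rightarrow> nat event \<Rightarrow> bool" where
  "typed \<phi> t e \<longleftrightarrow> set_decode (t e) \<subseteq> cl \<phi> \<and>
    (\<forall>p. fm_code (Proc p 0) \<in> cl \<phi> \<longrightarrow> (fm_code (Proc p 0) \<in> set_decode (t e) \<longleftrightarrow> p = fst e)) \<and>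
    (\<forall>a. fm_code (Letter a 0) \<in> cl \<phi> \<longrightarrow>
      (fm_code (Letter a 0) \<in> set_decode (t e) \<longleftrightarrow> a = letter M e)) \<and>
    (\<forall>u \<chi>. fm_code (Ex u \<chi>) \<in> cl \<phi> \<longrightarrow>
      (fm_code (Ex u \<chi>) \<in> set_decode (t e) \<longleftrightarrow> (\<exists>f\<in>E. ev \<chi> u (t e) (t f) (rel M e f)))) \<and>
    ev \<phi> 0 (t e) (t e) 0"

text \<open>The types are read off the labels. As each label claims exactly one process and one
  type, \<open>isA\<close> describes the sets \<open>A\<close> of events of a given type, and the
  soundness lemmas show that \<open>obs\<close> records exactly the relations realised by other
  events.\<close>

lemma types_if_good:
  assumes L: "good P (fm_code \<phi>) M L"
  shows "\<exists>t. \<forall>e\<in>E. typed \<phi> t e"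
proof -
  let ?T = "set_decode (type_codes (fm_code \<phi>))" and ?P = "set_decode P"
  have L0: "L e = 0" if "e \<notin> E" for e using L that unfolding good_def by blast
  have Lnz: "L e \<noteq> 0" if "e \<in> E" for e using L that unfolding good_def by blast
  have fwd: "fwd P (fm_code \<phi>) (fst e) (letter M e) (L (prv e)) (L e) (in_lab M L e) (peer M e)"
    and bwd: "bwd P (fm_code \<phi>) (fst e) (L e) (out_lab M L e) (peer M e) (L (nxt e))" if "e \<in> E" for e
    using L that unfolding good_def by blast+
  define T where "T e \<tau> \<longleftrightarrow> \<tau> \<in> ?T \<and> isA (fst e) \<tau> (L e) \<and>
     (\<forall>q\<in>?P. \<forall>\<tau>'\<in>?T. isA q \<tau>' (L e) \<longrightarrow> q = fst e \<and> \<tau>' = \<tau>) \<and>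
     (\<forall>c\<in>cl \<phi>.
       (tag c = 0 \<longrightarrow> (c \<in> set_decode \<tau> \<longleftrightarrow> ar1 c = fst e)) \<and>
       (tag c = 1 \<longrightarrow> (c \<in> set_decode \<tau> \<longleftrightarrow> ar1 c = letter M e)) \<and>
       (tag c = 9 \<longrightarrow> (c \<in> set_decode \<tau> \<longleftrightarrow> (\<exists>\<eta><8. \<exists>q\<in>?P. \<exists>\<tau>'\<in>?T.
          obs \<eta> q \<tau>' (L e) \<and> ev_code (ar2 c) (ar1 c) \<tau> \<tau>' \<eta>)))) \<and>
     ev_code (fm_code \<phi>) 0 \<tau> \<tau> 0" for e \<tau>
  have "\<forall>e\<in>E. \<exists>\<tau>. T e \<tau>"
    using fwd unfolding fwd_def fwd_type_def set_decode_cl_code T_def Bex_def by blast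
  then obtain t where "\<forall>e\<in>E. T e (t e)" using bchoice by metis
  note t = this[unfolded T_def]
  have obs: "obs k q \<tau> (L e) \<longleftrightarrow> (\<exists>f\<in>E. fst f = q \<and> t f = \<tau> \<and> rel M e f = k)"
    if q: "q \<in> ?P" "\<tau> \<in> ?T" and e: "e \<in> E" and k: "k < 8" for q \<tau> e k
  proof -
    define A where "A = {f\<in>E. fst f = q \<and> t f = \<tau>}"
    have AE: "A \<subseteq> E" and Aq: "\<And>f. f \<in> A \<Longrightarrow> fst f = q" by (auto simp: A_def)
    have A: "isA q \<tau> (L x) \<longleftrightarrow> x \<in> A" for x
    proof (cases "x \<in> E")
      case True
      then show ?thesis using t q unfolding A_def by blast
    next
      case False
      then show ?thesis using L0[OF False] AE by auto
    qed
    have bits: "sem_bits L q \<tau> A x" if x: "x \<in> E" for x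
      by (rule bits_sound[OF L0 A AE Aq _ _ x]) (use fwd bwd q in \<open>auto simp: fwd_def bwd_def\<close>)
    show ?thesis
    proof (cases "k = 7")
      case False
      then have "k < 7" using k by simp
      then have "obs k q \<tau> (L e) \<longleftrightarrow> (\<exists>f\<in>A. rel M e f = k)" using bits[OF e] by (simp add: sem_bits_def)
      then show ?thesis by (auto simp: A_def)
    next
      case True
      have "glob q \<tau> (L e) \<longleftrightarrow> A \<noteq> {}"
      proof -
        let ?x = "(q, length (word M q))"
        have "pst 0 q \<tau> (L ?x) \<longleftrightarrow> A \<noteq> {}"
        proof (cases "?x \<in> E")
          case True
          then have "pst 0 q \<tau> (L ?x) \<longleftrightarrow> sem_pst A 0 ?x" using bits by (simp add: sem_bits_def)
          then show ?thesis using in_last_past[of q "\<lambda>f. t f = \<tau>"] by (auto simp: sem_pst_def A_def)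
        next
          case False
          then have "A = {}" using last_in_E AE Aq by (metis ex_in_conv subsetD)
          then show ?thesis using L0[OF False] by simp
        qed
        then show ?thesis using good_glob[OF L e q] by simp
      qed
      moreover have pe: "fst e \<in> ?P" using e by (simp add: in_E)
      ultimately have "obs 7 q \<tau> (L e) \<longleftrightarrow> (\<exists>f\<in>A. rel M e f = 7)"
        using fwd bwd q e
        by (intro parallel_sound[OF L0 Lnz A AE Aq bits]) (auto simp: fwd_def bwd_def)
      then show ?thesis using True by (auto simp: A_def)
    qed
  qed
  show ?thesis
    unfolding typed_def
  proof (intro exI[of _ t] ballI conjI allI impI)
    fix e assume e: "e \<in> E"
    show "set_decode (t e) \<subseteq> cl \<phi>" using t e by (auto simp: set_decode_type_codes)
    have c: "(tag c = 0 \<longrightarrow> (c \<in> set_decode (t e) \<longleftrightarrow> ar1 c = fst e)) \<and>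
       (tag c = 1 \<longrightarrow> (c \<in> set_decode (t e) \<longleftrightarrow> ar1 c = letter M e)) \<and>
       (tag c = 9 \<longrightarrow> (c \<in> set_decode (t e) \<longleftrightarrow> (\<exists>\<eta><8. \<exists>q\<in>?P. \<exists>\<tau>'\<in>?T.
          obs \<eta> q \<tau>' (L e) \<and> ev_code (ar2 c) (ar1 c) (t e) \<tau>' \<eta>)))" if "c \<in> cl \<phi>" for c
      using t e that by blast
    show "fm_code (Proc p 0) \<in> set_decode (t e) \<longleftrightarrow> p = fst e" if "fm_code (Proc p 0) \<in> cl \<phi>" for p
      using c[OF that] by (simp del: list_encode.simps)
    show "fm_code (Letter a 0) \<in> set_decode (t e) \<longleftrightarrow> a = letter M e" if "fm_code (Letter a 0) \<in> cl \<phi>" for a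
      using c[OF that] by (simp del: list_encode.simps)
    show "fm_code (Ex u \<chi>) \<in> set_decode (t e) \<longleftrightarrow> (\<exists>f\<in>E. ev \<chi> u (t e) (t f) (rel M e f))"
      if "fm_code (Ex u \<chi>) \<in> cl \<phi>" for u \<chi>
    proof -
      have "fm_code (Ex u \<chi>) \<in> set_decode (t e) \<longleftrightarrow> (\<exists>\<eta><8. \<exists>q\<in>?P. \<exists>\<tau>'\<in>?T.
          obs \<eta> q \<tau>' (L e) \<and> ev \<chi> u (t e) \<tau>' \<eta>)"
        using c[OF that] by (simp add: ev_code del: list_encode.simps)
      also have "\<dots> \<longleftrightarrow> (\<exists>f\<in>E. ev \<chi> u (t e) (t f) (rel M e f))"
      proof
        assume "\<exists>\<eta><8. \<exists>q\<in>?P. \<exists>\<tau>'\<in>?T. obs \<eta> q \<tau>' (L e) \<and> ev \<chi> u (t e) \<tau>' \<eta>"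
        then obtain \<eta> q \<tau>' where *: "\<eta> < 8" "q \<in> ?P" "\<tau>' \<in> ?T" "obs \<eta> q \<tau>' (L e)" "ev \<chi> u (t e) \<tau>' \<eta>" by blast
        then obtain f where "f \<in> E" "t f = \<tau>'" "rel M e f = \<eta>" using obs[OF *(2,3) e *(1)] by blast
        then show "\<exists>f\<in>E. ev \<chi> u (t e) (t f) (rel M e f)" using *(5) by blast
      next
        assume "\<exists>f\<in>E. ev \<chi> u (t e) (t f) (rel M e f)"
        then obtain f where f: "f \<in> E" "ev \<chi> u (t e) (t f) (rel M e f)" by blast
        have T: "t f \<in> ?T" "fst f \<in> ?P" using conjunct1[OF bspec[OF t f(1)]] f(1) by (simp_all add: in_E)
        have "obs (rel M e f) (fst f) (t f) (L e)"
          unfolding obs[OF T(2,1) e rel_less] using f(1) by blast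
        with T show "\<exists>\<eta><8. \<exists>q\<in>?P. \<exists>\<tau>'\<in>?T. obs \<eta> q \<tau>' (L e) \<and> ev \<chi> u (t e) \<tau>' \<eta>"
          using f(2) rel_less by blast
      qed
      finally show ?thesis .
    qed
    show "ev \<phi> 0 (t e) (t e) 0" using t e by (simp add: ev_code)
  qed
qed

lemma cl_cases:
  "c \<in> cl \<phi> \<Longrightarrow> (\<exists>p. c = fm_code (Proc p 0)) \<or> (\<exists>a. c = fm_code (Letter a 0)) \<or>
    (\<exists>X. c = fm_code (Mem 0 X)) \<or> (\<exists>u \<chi>. c = fm_code (Ex u \<chi>))"
  by (induction \<phi>) (auto simp del: fm_code.simps)

lemma fld_eq_iff: "fld g k q \<tau> \<pi> \<pi>' \<rho> = fld g' k' q' \<tau>' \<kappa> \<kappa>' \<sigma> \<longleftrightarrow>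
    g = g' \<and> k = k' \<and> q = q' \<and> \<tau> = \<tau>' \<and> \<pi> = \<kappa> \<and> \<pi>' = \<kappa>' \<and> \<rho> = \<sigma>"
  by (simp add: fld_def list_encode_eq)

text \<open>The label of an event is the set of all statements true at it, relative to a line chosen
  for each q, \<tau> and p and to a colouring chosen for each q, \<tau>, \<pi> and \<pi>'.\<close>

lemma good_if_types:
  assumes t: "\<forall>e\<in>E. typed \<phi> t e"
  shows "\<exists>L. good P (fm_code \<phi>) M L"
proof -
  note t = assms[unfolded typed_def]
  let ?T = "set_decode (type_codes (fm_code \<phi>))" and ?P = "set_decode P" and ?S = "set_decode (seq_codes P)"
  define A where "A q \<tau> = {f\<in>E. fst f = q \<and> t f = \<tau>}" for q \<tau>
  have AE: "A q \<tau> \<subseteq> E" and Aq: "\<And>f. f \<in> A q \<tau> \<Longrightarrow> fst f = q" for q \<tau> by (auto simp: A_def)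
  define R where "R q \<tau> p = (SOME R. is_line (A q \<tau>) p R)" for q \<tau> p
  have R: "is_line (A q \<tau>) p (R q \<tau> p)" for q \<tau> p
    unfolding R_def by (rule someI_ex[OF line_exists[OF AE Aq]])
  define X where "X q \<tau> \<pi> \<pi>' = (SOME \<chi>. is_colouring (A q \<tau>) \<pi> \<pi>' \<chi>)" for q \<tau> \<pi> \<pi>'
  have X: "is_colouring (A q \<tau>) \<pi> \<pi>' (X q \<tau> \<pi> \<pi>')" for q \<tau> \<pi> \<pi>'
    unfolding X_def by (rule someI_ex[OF colouring_exists[OF AE Aq]])
  \<comment> \<open>The intended meaning of the nine kinds of statements.
    \<open>hd (list_decode \<pi>)\<close> recovers the process that \<open>line\<close> stores as a
    sequence of length one.\<close>
  define Sem where "Sem g k q \<tau> \<pi> \<pi>' \<rho> e \<longleftrightarrow>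
    g = 0 \<and> e \<in> A q \<tau> \<or>
    g = 1 \<and> (\<exists>f\<in>A q \<tau>. rel M e f = k) \<or>
    g = 2 \<and> sem_pst (A q \<tau>) k e \<or>
    g = 3 \<and> sem_fut (A q \<tau>) k e \<or>
    g = 4 \<and> e \<in> A q \<tau> \<and> (k = 0 \<and> (\<exists>g\<in>A q \<tau>. before g e) \<or> k = 1 \<and> (\<exists>g\<in>A q \<tau>. before e g)) \<or>
    g = 5 \<and> A q \<tau> \<noteq> {} \<or>
    g = 6 \<and> (k = 0 \<and> (prv e, e) \<in> R q \<tau> (hd (list_decode \<pi>)) \<or>
      k = 1 \<and> (\<exists>z. (z, e) \<in> msg M \<and> (z, e) \<in> R q \<tau> (hd (list_decode \<pi>)))) \<or>
    g = 7 \<and> sem_tok (A q \<tau>) (X q \<tau> (list_decode \<pi>) (list_decode \<pi>')) (list_decode \<rho>) e k \<or>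
    g = 8 \<and> sem_tok' (A q \<tau>) (X q \<tau> (list_decode \<pi>) (list_decode \<pi>')) (list_decode \<rho>) e k"
    for g k q \<tau> \<pi> \<pi>' \<rho> :: nat and e
  define Lset where "Lset e = {fld g k q \<tau> \<pi> \<pi>' \<rho> |g k q \<tau> \<pi> \<pi>' \<rho>. (g < 9 \<and> k < 8 \<and> q \<in> ?P \<and>
    \<tau> \<in> ?T \<and> \<pi> \<in> ?S \<and> \<pi>' \<in> ?S \<and> \<rho> \<in> ?S) \<and> Sem g k q \<tau> \<pi> \<pi>' \<rho> e}" for e
  have sub: "Lset e \<subseteq> set_decode (field_codes P (fm_code \<phi>))" for e
    unfolding Lset_def set_decode_field_codes by blast
  then have fin: "finite (Lset e)" for e using finite_set_decode finite_subset by blast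
  define L where "L e = (if e \<in> E then set_encode (Lset e) else 0)" for e
  have L0: "L e = 0" if "e \<notin> E" for e using that by (simp add: L_def)
  have mem: "fld g k q \<tau> \<pi> \<pi>' \<rho> \<in> set_decode (L e) \<longleftrightarrow> e \<in> E \<and> Sem g k q \<tau> \<pi> \<pi>' \<rho> e"
    if "g < 9" "k < 8" "q \<in> ?P" "\<tau> \<in> ?T" "\<pi> \<in> ?S" "\<pi>' \<in> ?S" "\<rho> \<in> ?S" for g k q \<tau> \<pi> \<pi>' \<rho> e
  proof -
    have "set_decode (L e) = (if e \<in> E then Lset e else {})" by (simp add: L_def fin)
    moreover have "fld g k q \<tau> \<pi> \<pi>' \<rho> \<in> Lset e \<longleftrightarrow> Sem g k q \<tau> \<pi> \<pi>' \<rho> e"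
      using that unfolding Lset_def mem_Collect_eq fld_eq_iff by blast
    ultimately show ?thesis by simp
  qed
  have S0: "0 \<in> ?S"
    using image_eqI[of 0 list_encode "[]" "seqs ?P"]
    by (simp add: set_decode_seq_codes seqs_def list_encode.simps(1))
  have Sp: "list_encode [p] \<in> ?S" if "p \<in> ?P" for p
    using seqs_single[OF that] by (auto simp: set_decode_seq_codes)
  have F: "isA q \<tau> (L e) \<longleftrightarrow> e \<in> A q \<tau>" "k < 8 \<Longrightarrow> obs k q \<tau> (L e) \<longleftrightarrow> e \<in> E \<and> (\<exists>f\<in>A q \<tau>. rel M e f = k)"
    "k < 8 \<Longrightarrow> pst k q \<tau> (L e) \<longleftrightarrow> e \<in> E \<and> sem_pst (A q \<tau>) k e"
    "k < 8 \<Longrightarrow> fut k q \<tau> (L e) \<longleftrightarrow> e \<in> E \<and> sem_fut (A q \<tau>) k e"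
    "bas 0 q \<tau> (L e) \<longleftrightarrow> e \<in> A q \<tau> \<and> (\<exists>g\<in>A q \<tau>. before g e)"
    "bas 1 q \<tau> (L e) \<longleftrightarrow> e \<in> A q \<tau> \<and> (\<exists>g\<in>A q \<tau>. before e g)"
    "glob q \<tau> (L e) \<longleftrightarrow> e \<in> E \<and> A q \<tau> \<noteq> {}"
    if "q \<in> ?P" "\<tau> \<in> ?T" for q \<tau> e k
    unfolding field_defs using mem[OF _ _ that S0 S0 S0] AE[of q \<tau>] by (auto simp: Sem_def)
  have FL: "line 0 p q \<tau> (L e) \<longleftrightarrow> (prv e, e) \<in> R q \<tau> p"
    "line 1 p q \<tau> (L e) \<longleftrightarrow> (\<exists>z. (z, e) \<in> msg M \<and> (z, e) \<in> R q \<tau> p)"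
    if q: "q \<in> ?P" "\<tau> \<in> ?T" "p \<in> ?P" for p q \<tau> e
  proof -
    have nR: "(x, e) \<notin> R q \<tau> p" if "e \<notin> E" for x
      using that R[of q \<tau> p] F.D_E unfolding is_line_def by blast
    show "line 0 p q \<tau> (L e) \<longleftrightarrow> (prv e, e) \<in> R q \<tau> p"
      "line 1 p q \<tau> (L e) \<longleftrightarrow> (\<exists>z. (z, e) \<in> msg M \<and> (z, e) \<in> R q \<tau> p)"
      using mem[OF _ _ q(1,2) Sp[OF q(3)] S0 S0, of 6 0 e] mem[OF _ _ q(1,2) Sp[OF q(3)] S0 S0, of 6 1 e]
      by (cases "e \<in> E"; simp add: Sem_def line_def nR)+
  qed
  have FT: "tok c q \<tau> \<pi> \<pi>' (list_encode \<rho>) (L e) \<longleftrightarrow>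
      e \<in> E \<and> sem_tok (A q \<tau>) (X q \<tau> (list_decode \<pi>) (list_decode \<pi>')) \<rho> e c"
    "tok' c q \<tau> \<pi> \<pi>' (list_encode \<rho>) (L e) \<longleftrightarrow>
      e \<in> E \<and> sem_tok' (A q \<tau>) (X q \<tau> (list_decode \<pi>) (list_decode \<pi>')) \<rho> e c"
    if q: "q \<in> ?P" "\<tau> \<in> ?T" "\<pi> \<in> ?S" "\<pi>' \<in> ?S" "c < 3" "\<rho> \<in> seqs ?P" for c q \<tau> \<pi> \<pi>' \<rho> e
  proof -
    have "list_encode \<rho> \<in> ?S" using q(6) by (auto simp: set_decode_seq_codes)
    then show "tok c q \<tau> \<pi> \<pi>' (list_encode \<rho>) (L e) \<longleftrightarrow>
      e \<in> E \<and> sem_tok (A q \<tau>) (X q \<tau> (list_decode \<pi>) (list_decode \<pi>')) \<rho> e c"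
    "tok' c q \<tau> \<pi> \<pi>' (list_encode \<rho>) (L e) \<longleftrightarrow>
      e \<in> E \<and> sem_tok' (A q \<tau>) (X q \<tau> (list_decode \<pi>) (list_decode \<pi>')) \<rho> e c"
      unfolding field_defs using mem[OF _ _ q(1-4)] q(5) by (auto simp: Sem_def)
  qed
  have tT: "t e \<in> ?T" if "e \<in> E" for e using t that by (simp add: set_decode_type_codes)
  have Lnz: "L e \<noteq> 0" if e: "e \<in> E" for e
  proof -
    \<comment> \<open>Every event has a type, so no label is empty and 0 is reserved for missing
      events.\<close>
    have "isA (fst e) (t e) (L e)" using F(1)[OF _ tT[OF e], of "fst e"] e by (auto simp: A_def in_E)
    then show ?thesis by (metis fields_0(1))
  qed
  have bits: "sem_bits L q \<tau> (A q \<tau>) e" if "q \<in> ?P" "\<tau> \<in> ?T" "e \<in> E" for q \<tau> e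
    unfolding sem_bits_def using F[OF that(1,2)] that(3) by auto
  have "good P (fm_code \<phi>) M L"
    unfolding good_def
  proof (intro conjI allI ballI impI)
    fix e assume e: "e \<in> E"
    have p: "fst e \<in> ?P" using e by (simp add: in_E)
    show "set_decode (L e) \<subseteq> set_decode (field_codes P (fm_code \<phi>))" using sub[of e] fin[of e] e by (simp add: L_def)
    have ty: "fwd_type P (fm_code \<phi>) (fst e) (letter M e) (L e)"
      unfolding fwd_type_def set_decode_cl_code
    proof (intro bexI[OF _ tT[OF e]] conjI ballI impI)
      show "isA (fst e) (t e) (L e)" using F(1)[OF p tT[OF e]] e by (simp add: A_def)
      show "ev_code (fm_code \<phi>) 0 (t e) (t e) 0" using t e by (simp add: ev_code)
    next
      fix q \<tau> assume "q \<in> ?P" "\<tau> \<in> ?T" "isA q \<tau> (L e)"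
      then show "q = fst e" "\<tau> = t e" using F(1) by (auto simp: A_def)
    next
      fix c assume c: "c \<in> cl \<phi>"
      have te: "set_decode (t e) \<subseteq> cl \<phi>"
        "\<And>p. fm_code (Proc p 0) \<in> cl \<phi> \<Longrightarrow> fm_code (Proc p 0) \<in> set_decode (t e) \<longleftrightarrow> p = fst e"
        "\<And>a. fm_code (Letter a 0) \<in> cl \<phi> \<Longrightarrow> fm_code (Letter a 0) \<in> set_decode (t e) \<longleftrightarrow> a = letter M e"
        "\<And>u \<chi>. fm_code (Ex u \<chi>) \<in> cl \<phi> \<Longrightarrow>
          fm_code (Ex u \<chi>) \<in> set_decode (t e) \<longleftrightarrow> (\<exists>f\<in>E. ev \<chi> u (t e) (t f) (rel M e f))"
        using t e by blast+
      {
        assume "tag c = 0"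
        then obtain p where "c = fm_code (Proc p 0)" using cl_cases[OF c] by auto
        then show "c \<in> set_decode (t e) \<longleftrightarrow> ar1 c = fst e" using te(2)[of p] c by simp
      }
      {
        assume "tag c = 1"
        then obtain a where "c = fm_code (Letter a 0)" using cl_cases[OF c] by auto
        then show "c \<in> set_decode (t e) \<longleftrightarrow> ar1 c = letter M e" using te(3)[of a] c by simp
      }
      assume "tag c = 9"
      then obtain u \<chi> where c': "c = fm_code (Ex u \<chi>)" using cl_cases[OF c] by auto
      then have "c \<in> set_decode (t e) \<longleftrightarrow> (\<exists>f\<in>E. ev \<chi> u (t e) (t f) (rel M e f))" using te(4) c by blast
      also have "\<dots> \<longleftrightarrow> (\<exists>\<eta><8. \<exists>q\<in>?P. \<exists>\<tau>'\<in>?T. obs \<eta> q \<tau>' (L e) \<and> ev \<chi> u (t e) \<tau>' \<eta>)"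
      proof
        assume "\<exists>f\<in>E. ev \<chi> u (t e) (t f) (rel M e f)"
        then obtain f where f: "f \<in> E" "ev \<chi> u (t e) (t f) (rel M e f)" by blast
        have fp: "fst f \<in> ?P" using f(1) by (simp add: in_E)
        have "f \<in> A (fst f) (t f)" using f(1) by (simp add: A_def)
        then have "obs (rel M e f) (fst f) (t f) (L e)" using F(2)[OF fp tT[OF f(1)] rel_less] e by blast
        then show "\<exists>\<eta><8. \<exists>q\<in>?P. \<exists>\<tau>'\<in>?T. obs \<eta> q \<tau>' (L e) \<and> ev \<chi> u (t e) \<tau>' \<eta>"
          using f fp tT[OF f(1)] rel_less by blast
      next
        assume "\<exists>\<eta><8. \<exists>q\<in>?P. \<exists>\<tau>'\<in>?T. obs \<eta> q \<tau>' (L e) \<and> ev \<chi> u (t e) \<tau>' \<eta>"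
        then obtain \<eta> q \<tau>' where *: "\<eta> < 8" "q \<in> ?P" "\<tau>' \<in> ?T" "obs \<eta> q \<tau>' (L e)" "ev \<chi> u (t e) \<tau>' \<eta>" by blast
        then obtain f where "f \<in> E" "t f = \<tau>'" "rel M e f = \<eta>" using F(2)[OF *(2,3,1)] by (auto simp: A_def)
        then show "\<exists>f\<in>E. ev \<chi> u (t e) (t f) (rel M e f)" using *(5) by blast
      qed
      finally show "c \<in> set_decode (t e) \<longleftrightarrow> (\<exists>\<eta><8. \<exists>q\<in>?P. \<exists>\<tau>'\<in>?T.
          obs \<eta> q \<tau>' (L e) \<and> ev_code (ar2 c) (ar1 c) (t e) \<tau>' \<eta>)"
        using c' by (simp add: ev_code)
    qed
    have par: "fwd_par P (fst e) (L e) q \<tau>" if q: "q \<in> ?P" "\<tau> \<in> ?T" for q \<tau>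
    proof (rule parallel_complete[OF AE Aq[of _ q \<tau>] bits[OF q e]])
      show "obs 7 q \<tau> (L e) \<longleftrightarrow> (\<exists>f\<in>A q \<tau>. rel M e f = 7)" using F(2)[OF q, of 7 e] e by simp
      show "glob q \<tau> (L e) \<longleftrightarrow> A q \<tau> \<noteq> {}" using F(7)[OF q] e by blast
      assume *: "e \<notin> A q \<tau>" "\<exists>f\<in>A q \<tau>. (f, e) \<in> F.D\<^sup>*" "\<forall>f\<in>A q \<tau>. (f, e) \<in> F.D\<^sup>* \<or> (e, f) \<in> F.D\<^sup>*"
      then obtain w where w: "(w, e) \<in> R q \<tau> (fst e)" using R[of q \<tau> "fst e"] e unfolding is_line_def by blast
      then have "w = prv e \<or> (w, e) \<in> msg M" using R[of q \<tau> "fst e"] F.D_iff[of w e] unfolding is_line_def by blast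
      then show "line 0 (fst e) q \<tau> (L e) \<or> line 1 (fst e) q \<tau> (L e)" using FL[OF q p] w by blast
    next
      fix \<pi> \<pi>' c :: nat assume *: "\<pi> \<in> ?S" "\<pi>' \<in> ?S" "c < 3" "\<exists>w\<in>A q \<tau>. rel M e w = 7"
      obtain \<kappa> \<kappa>' where k: "\<pi> = list_encode \<kappa>" "\<kappa> \<in> seqs ?P" "\<pi>' = list_encode \<kappa>'" "\<kappa>' \<in> seqs ?P"
        using *(1,2) unfolding set_decode_seq_codes by blast
      show "\<not> (tok c q \<tau> \<pi> \<pi>' \<pi> (L e) \<and> tok' c q \<tau> \<pi> \<pi>' \<pi>' (L e))"
        using FT(1)[OF q *(1-3) k(2), of e] FT(2)[OF q *(1-3) k(4), of e] X[of q \<tau> \<kappa> \<kappa>', unfolded is_colouring_def] e *(4)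
        by (auto simp: k)
    qed (assumption | rule e)+
    have gl: "glob q \<tau> (L x) \<longleftrightarrow> glob q \<tau> (L y)" if "q \<in> ?P" "\<tau> \<in> ?T" "x \<in> E" "y \<in> E" for q \<tau> x y
      using F(7)[OF that(1,2)] that(3,4) by blast
    have bt: "fwd_bits (L (prv e)) (L e) (in_lab M L e) q \<tau>" "bwd_bits (L e) (out_lab M L e) (L (nxt e)) q \<tau>"
      if q: "q \<in> ?P" "\<tau> \<in> ?T" for q \<tau>
      by (rule bits_complete[where A = "A q \<tau>"]; fact L0 F(1)[OF q] AE Aq bits[OF q] gl[OF q] e)+
    have ln: "fwd_line (L (prv e)) (L e) (in_lab M L e) q \<tau> p" "bwd_line (L e) (out_lab M L e) (L (nxt e)) q \<tau> p"
      if q: "q \<in> ?P" "\<tau> \<in> ?T" "p \<in> ?P" for q \<tau> p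
    proof -
      have b0: "\<And>e. e \<in> E \<Longrightarrow> bas 0 q \<tau> (L e) \<longleftrightarrow> e \<in> A q \<tau> \<and> (\<exists>g\<in>A q \<tau>. before g e)"
        by (rule F(5)[OF q(1,2)])
      show "fwd_line (L (prv e)) (L e) (in_lab M L e) q \<tau> p" "bwd_line (L e) (out_lab M L e) (L (nxt e)) q \<tau> p"
        by (rule line_complete[where A = "A q \<tau>" and R = "R q \<tau> p"];
          fact F(1)[OF q(1,2)] Lnz b0 R FL[OF q] e)+
    qed
    have tk: "fwd_tok P (fst e) (L (prv e)) (L e) (in_lab M L e) (peer M e) q \<tau> \<pi> \<pi>'"
      "bwd_tok P (fst e) (L e) (out_lab M L e) (peer M e) (L (nxt e)) q \<tau> \<pi> \<pi>'"
      if q: "q \<in> ?P" "\<tau> \<in> ?T" "\<pi> \<in> ?S" "\<pi>' \<in> ?S" for q \<tau> \<pi> \<pi>'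
    proof -
      have \<chi>: "X q \<tau> (list_decode \<pi>) (list_decode \<pi>') u < 3" for u
        using X unfolding is_colouring_def by blast
      show "fwd_tok P (fst e) (L (prv e)) (L e) (in_lab M L e) (peer M e) q \<tau> \<pi> \<pi>'"
        "bwd_tok P (fst e) (L e) (out_lab M L e) (peer M e) (L (nxt e)) q \<tau> \<pi> \<pi>'"
        by (rule tokens_complete[where A = "A q \<tau>" and \<chi> = "X q \<tau> (list_decode \<pi>) (list_decode \<pi>')"];
          fact L0 Lnz F(1)[OF q(1,2)] AE Aq \<chi> FT(1)[OF q] FT(2)[OF q] e)+
    qed
    show "fwd P (fm_code \<phi>) (fst e) (letter M e) (L (prv e)) (L e) (in_lab M L e) (peer M e)"
      unfolding fwd_def using ty par bt ln tk by blast
    show "bwd P (fm_code \<phi>) (fst e) (L e) (out_lab M L e) (peer M e) (L (nxt e))"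
      unfolding bwd_def using bt ln tk by blast
  next
    fix p q \<tau> assume p: "p \<in> ?P" "word M p \<noteq> []" and q: "q \<in> ?P" "\<tau> \<in> ?T"
    have "(p, length (word M p)) \<in> E" using p by (auto simp: in_E Suc_le_eq)
    then have "glob q \<tau> (L (p, length (word M p))) \<longleftrightarrow> A q \<tau> \<noteq> {}" using F(7)[OF q] by blast
    moreover have "pst 0 q \<tau> (L (q, length (word M q))) \<longleftrightarrow> A q \<tau> \<noteq> {}"
    proof (cases "(q, length (word M q)) \<in> E")
      case True
      then show ?thesis using F(3)[OF q, of 0] in_last_past[of q "\<lambda>f. t f = \<tau>"] by (auto simp: sem_pst_def A_def)
    next
      case False
      then have "A q \<tau> = {}" using last_in_E by (auto simp: A_def)
      then show ?thesis using L0[OF False] by simp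
    qed
    ultimately show "glob q \<tau> (L (p, length (word M p))) \<longleftrightarrow> pst 0 q \<tau> (L (q, length (word M q)))" by blast
  qed (use L0 Lnz in blast)+
  then show ?thesis by blast
qed

end

lemma cfm_lang_eq_fm_lang:
  assumes "sentence \<phi>" "emso2 \<phi>"
  shows "cfm_lang (set_decode P) (set_decode \<Sigma>) (cfm P \<Sigma> (fm_code \<phi>)) = fm_lang (set_decode P) (set_decode \<Sigma>) \<phi>"
proof (intro set_eqI)
  fix M
  show "M \<in> cfm_lang (set_decode P) (set_decode \<Sigma>) (cfm P \<Sigma> (fm_code \<phi>)) \<longleftrightarrow>
    M \<in> fm_lang (set_decode P) (set_decode \<Sigma>) \<phi>"
  proof (cases "is_msc (set_decode P) (set_decode \<Sigma>) M")
    case True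
    interpret chart P "set_decode \<Sigma>" M by unfold_locales (rule True)
    have "M \<in> fm_lang (set_decode P) (set_decode \<Sigma>) \<phi> \<longleftrightarrow> (\<exists>t. \<forall>e\<in>E. typed \<phi> t e)"
      unfolding typed_def by (rule fm_lang_iff_types[OF True assms])
    also have "\<dots> \<longleftrightarrow> (\<exists>L. good P (fm_code \<phi>) M L)"
      using types_if_good[where \<phi> = \<phi>] good_if_types[where \<phi> = \<phi>] by blast
    also have "\<dots> \<longleftrightarrow> M \<in> cfm_lang (set_decode P) (set_decode \<Sigma>) (cfm P \<Sigma> (fm_code \<phi>))"
      using good_if_lang[OF True] lang_if_good[OF True _ refl] by blast
    finally show ?thesis ..
  qed (auto simp: cfm_lang_def fm_lang_def)
qed

section \<open>The number of states\<close>

lemma card_set_decode_subset: "finite S \<Longrightarrow> card {n. set_decode n \<subseteq> S} = 2 ^ card S"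
proof -
  assume S: "finite S"
  have "bij_betw set_encode (Pow S) {n. set_decode n \<subseteq> S}"
  proof (rule bij_betwI[where g = set_decode])
    have *: "finite A" if "A \<subseteq> S" for A using that S by (rule finite_subset)
    show "set_encode \<in> Pow S \<rightarrow> {n. set_decode n \<subseteq> S}" "\<And>x. x \<in> Pow S \<Longrightarrow> set_decode (set_encode x) = x"
      by (simp_all add: * )
  qed auto
  then show ?thesis using bij_betw_same_card card_Pow[OF S] by metis
qed

text \<open>The factor 72 is 9 * 8, for the kinds of statements and their second parameter; the cube
  is due to the three sequences.\<close>

lemma card_field_codes:
  "card (set_decode (field_codes P (fm_code \<phi>))) \<le>
    72 * card (set_decode P) * 2 ^ fm_length \<phi> * card (seqs (set_decode P)) ^ 3"
proof -
  let ?P = "set_decode P" and ?T = "set_decode (type_codes (fm_code \<phi>))" and ?S = "set_decode (seq_codes P)"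
  have S: "card ?S = card (seqs ?P)"
    unfolding set_decode_seq_codes by (rule card_image[OF inj_list_encode])
  have T: "card ?T \<le> 2 ^ fm_length \<phi>"
    unfolding set_decode_type_codes card_set_decode_subset[OF finite_cl]
    by (intro power_increasing card_cl) simp
  let ?f = "\<lambda>(g, k, q, \<tau>, \<pi>, \<pi>', \<rho>). fld g k q \<tau> \<pi> \<pi>' \<rho>"
  have "set_decode (field_codes P (fm_code \<phi>)) \<subseteq> ?f ` ({..<9} \<times> {..<8} \<times> ?P \<times> ?T \<times> ?S \<times> ?S \<times> ?S)"
  proof
    fix x assume "x \<in> set_decode (field_codes P (fm_code \<phi>))"
    then obtain g k q \<tau> \<pi> \<pi>' \<rho> where "x = fld g k q \<tau> \<pi> \<pi>' \<rho>" "g < 9" "k < 8" "q \<in> ?P" "\<tau> \<in> ?T" "\<pi> \<in> ?S" "\<pi>' \<in> ?S" "\<rho> \<in> ?S"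
      unfolding set_decode_field_codes by blast
    then show "x \<in> ?f ` ({..<9} \<times> {..<8} \<times> ?P \<times> ?T \<times> ?S \<times> ?S \<times> ?S)"
      by (intro image_eqI[of _ _ "(g, k, q, \<tau>, \<pi>, \<pi>', \<rho>)"]) auto
  qed
  then have "card (set_decode (field_codes P (fm_code \<phi>))) \<le>
      card ({..<9::nat} \<times> {..<8::nat} \<times> ?P \<times> ?T \<times> ?S \<times> ?S \<times> ?S)"
    by (intro surj_card_le) auto
  also have "\<dots> = 72 * card ?P * card ?T * card (seqs ?P) ^ 3"
    by (simp add: card_cartesian_product S power3_eq_cube)
  also have "\<dots> \<le> 72 * card ?P * 2 ^ fm_length \<phi> * card (seqs ?P) ^ 3"
    using T by (intro mult_le_mono) auto
  finally show ?thesis .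
qed

lemma card_seqs: "finite Q \<Longrightarrow> Q \<noteq> {} \<Longrightarrow> card (seqs Q) \<le> Suc (card Q) * card Q ^ card Q"
proof -
  assume Q: "finite Q" "Q \<noteq> {}"
  then have "card (seqs Q) = (\<Sum>i\<le>card Q. card Q ^ i)"
    unfolding seqs_def by (intro card_lists_length_le)
  also have "\<dots> \<le> (\<Sum>i\<le>card Q. card Q ^ card Q)"
    using Q by (intro sum_mono power_increasing) (auto simp: card_gt_0_iff Suc_le_eq)
  finally show ?thesis by simp
qed

lemma card_states_code:
  "card (set_decode (states_code P \<phi>)) \<le> 1 + 3 * card (set_decode P) * (2 ^ card (set_decode (field_codes P \<phi>))) ^ 2"
proof -
  let ?W = "{n. set_decode n \<subseteq> set_decode (field_codes P \<phi>)}"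
  let ?f = "\<lambda>(g, r, L, R). state_code g r L R"
  have W: "finite ?W" "card ?W = 2 ^ card (set_decode (field_codes P \<phi>))"
    using card_set_decode_subset[of "set_decode (field_codes P \<phi>)"] by (auto intro: card_ge_0_finite)
  have "set_decode (states_code P \<phi>) \<subseteq> insert 0 (?f ` ({..<3} \<times> set_decode P \<times> ?W \<times> ?W))"
  proof
    fix x assume "x \<in> set_decode (states_code P \<phi>)"
    then consider "x = 0" | g r L R where "x = state_code g r L R" "g < 3" "r \<in> set_decode P" "L \<in> ?W" "R \<in> ?W"
      unfolding set_decode_states_code by blast
    then show "x \<in> insert 0 (?f ` ({..<3} \<times> set_decode P \<times> ?W \<times> ?W))"
    proof cases
      case (2 g r L R)
      then show ?thesis by (intro insertI2 image_eqI[of _ _ "(g, r, L, R)"]) auto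
    qed simp
  qed
  then have "card (set_decode (states_code P \<phi>)) \<le> card (insert 0 (?f ` ({..<3} \<times> set_decode P \<times> ?W \<times> ?W)))"
    using W by (intro card_mono) auto
  also have "\<dots> \<le> Suc (card (?f ` ({..<3} \<times> set_decode P \<times> ?W \<times> ?W)))"
    by (rule card_insert_le_m1[THEN le_trans]) (auto simp: card_insert_if)
  also have "\<dots> \<le> Suc (card ({..<3::nat} \<times> set_decode P \<times> ?W \<times> ?W))"
    using W by (intro Suc_le_mono[THEN iffD2] card_image_le) auto
  also have "\<dots> = 1 + 3 * card (set_decode P) * (2 ^ card (set_decode (field_codes P \<phi>))) ^ 2"
    by (simp add: card_cartesian_product W power2_eq_square)
  finally show ?thesis .
qed

lemma fm_length_pos: "1 \<le> fm_length \<phi>"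
  by (induction \<phi>) auto

text \<open>X = |\<phi>| + |P| log |P| is at least 1, as formulas are nonempty, and 2 powr X bounds
  |P|, |P|^|P| and 2^|\<phi>|. So all constants can be absorbed into multiples of X.\<close>

lemma states_bound:
  assumes p: "p \<in> set_decode P"
  shows "real (card (set_decode (states_code P (fm_code \<phi>)))) \<le>
    2 powr (2 powr (21 * (real (fm_length \<phi>) + real (card (set_decode P)) * log 2 (real (card (set_decode P))))))"
proof -
  define n where "n = card (set_decode P)"
  define u where "u = card (set_decode (field_codes P (fm_code \<phi>)))"
  define s where "s = card (seqs (set_decode P))"
  define l where "l = fm_length \<phi>"
  define X where "X = real l + real n * log 2 (real n)"
  have n1: "1 \<le> n" using p card_gt_0_iff[of "set_decode P"] by (auto simp: n_def Suc_le_eq)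
  have lg: "0 \<le> log 2 (real n)" using n1 by simp
  have "log 2 (real n) \<le> real n * log 2 (real n)" using mult_right_mono[OF _ lg, of 1 "real n"] n1 by simp
  moreover have l1: "1 \<le> real l" using fm_length_pos[of \<phi>] by (simp add: l_def)
  moreover have "0 \<le> real n * log 2 (real n)" by (rule mult_nonneg_nonneg[OF _ lg]) simp
  ultimately have X: "1 \<le> X" "real l \<le> X" "real n * log 2 (real n) \<le> X" "log 2 (real n) \<le> X"
    unfolding X_def by linarith+
  have np: "real n = 2 powr log 2 (real n)" using n1 by simp
  have nX: "real n \<le> 2 powr X" by (subst np) (simp add: X)
  have nn: "real n ^ n \<le> 2 powr X"
  proof -
    have "real n ^ n = real n powr real n" using n1 by (simp add: powr_realpow)
    also have "\<dots> = 2 powr (real n * log 2 (real n))"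
      by (subst np) (simp add: powr_powr mult.commute)
    finally show ?thesis using X by simp
  qed
  have lX: "2 ^ l \<le> 2 powr X" using X(2) by (simp add: powr_realpow[symmetric])
  \<comment> \<open>The three summands come from n + 1 \<le> 2 n, n and n^n.\<close>
  have s: "real s \<le> 2 powr (3 * X)"
  proof -
    have "s \<le> Suc n * n ^ n" unfolding s_def n_def using p by (intro card_seqs) auto
    then have "real s \<le> real (Suc n * n ^ n)" by (rule of_nat_mono)
    also have "\<dots> \<le> (2 * real n) * real n ^ n" using n1 by (simp add: mult_right_mono)
    also have "\<dots> \<le> (2 * 2 powr X) * 2 powr X" using nX nn by (intro mult_mono) auto
    also have "\<dots> = 2 powr (1 + X + X)" unfolding powr_add by simp
    also have "\<dots> \<le> 2 powr (3 * X)" using X(1) by simp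
    finally show ?thesis .
  qed
  \<comment> \<open>18 = 7 + 1 + 1 + 9, for 72 \<le> 2^7, for n, for the types and for the cube of
    the number of sequences.\<close>
  have u: "real u \<le> 2 powr (18 * X)"
  proof -
    have "u \<le> 72 * n * 2 ^ l * s ^ 3" unfolding u_def n_def l_def s_def by (rule card_field_codes)
    then have "real u \<le> real (72 * n * 2 ^ l * s ^ 3)" by (rule of_nat_mono)
    also have "\<dots> = 72 * real n * 2 ^ l * real s ^ 3" by simp
    also have "\<dots> \<le> 2 powr (7 * X) * 2 powr X * 2 powr X * (2 powr (3 * X)) ^ 3"
    proof (intro mult_mono power_mono nX lX s)
      have "(72::real) \<le> 2 powr 7" by simp
      also have "\<dots> \<le> 2 powr (7 * X)" using X(1) by (intro powr_mono) auto
      finally show "(72::real) \<le> 2 powr (7 * X)" .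
    qed auto
    also have "(2 powr (3 * X)) ^ 3 = 2 powr (9 * X)"
      by (simp add: power3_eq_cube powr_add[symmetric])
    also have "2 powr (7 * X) * 2 powr X * 2 powr X * 2 powr (9 * X) = 2 powr (18 * X)"
      by (simp add: powr_add[symmetric])
    finally show ?thesis .
  qed
  have "real (card (set_decode (states_code P (fm_code \<phi>)))) \<le> real (1 + 3 * n * (2 ^ u) ^ 2)"
    unfolding n_def u_def by (rule of_nat_mono[OF card_states_code])
  also have "\<dots> \<le> 4 * real n * (2 ^ u) ^ 2"
  proof -
    have "1 \<le> real n * (2 ^ u) ^ 2" using mult_mono[of 1 "real n" 1 "(2 ^ u) ^ 2"] n1 by simp
    then show ?thesis by simp
  qed
  also have "\<dots> = 2 powr (2 + log 2 (real n) + 2 * real u)"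
  proof -
    have "4 * real n * (2 ^ u) ^ 2 = 2 powr 2 * 2 powr log 2 (real n) * (2 powr real u * 2 powr real u)"
      using n1 by (simp add: powr_realpow power2_eq_square)
    then show ?thesis by (simp only: powr_add mult_2)
  qed
  \<comment> \<open>Each summand of the exponent is bounded by a multiple of 2 powr (19 * X).
    Together they are at most four times this quantity, which accounts for the remaining 2 of 21
    because X is at least 1.\<close>
  also have "\<dots> \<le> 2 powr (2 powr (21 * X))"
  proof -
    have "2 powr 1 \<le> 2 powr (19 * X)" using X(1) by (intro powr_mono) auto
    moreover have "log 2 (real n) \<le> 2 powr (19 * X)"
    proof -
      have "real n \<le> 2 powr real n" using less_exp[of n] by (simp add: powr_realpow)
      then have "log 2 (real n) \<le> real n" using n1 by (simp add: log_le_iff)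
      also have "\<dots> \<le> 2 powr X" by (rule nX)
      also have "\<dots> \<le> 2 powr (19 * X)" using X(1) by (intro powr_mono) auto
      finally show ?thesis .
    qed
    moreover have "2 * real u \<le> 2 powr (19 * X)"
    proof -
      have "2 * real u \<le> 2 * 2 powr (18 * X)" using u by simp
      also have "\<dots> = 2 powr (1 + 18 * X)" unfolding powr_add by simp
      also have "\<dots> \<le> 2 powr (19 * X)" using X(1) by (intro powr_mono) auto
      finally show ?thesis .
    qed
    ultimately have "2 + log 2 (real n) + 2 * real u \<le> 4 * 2 powr (19 * X)"
      using powr_ge_zero[of 2 "19 * X"] by simp
    also have "\<dots> = 2 powr (2 + 19 * X)" unfolding powr_add by simp
    also have "\<dots> \<le> 2 powr (21 * X)" using X(1) by (intro powr_mono) auto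
    finally show ?thesis by simp
  qed
  finally show ?thesis unfolding X_def n_def l_def .
qed

theorem theorem8:
  "\<exists>(C::real) construct.
     recursive 3 construct \<and>
     (\<forall>(P::nat set) (\<Sigma>::nat set) (\<phi>::(nat, nat) fm).
        finite P \<longrightarrow> finite \<Sigma> \<longrightarrow>
        fm_over P \<Sigma> \<phi> \<longrightarrow> sentence \<phi> \<longrightarrow> emso2 \<phi> \<longrightarrow>
        (\<exists>A::(nat, nat, nat, nat) cfm.
           is_cfm P \<Sigma> A \<and>
           construct [set_encode P, set_encode \<Sigma>, fm_code \<phi>] = cfm_code P A \<and>
           (\<forall>p\<in>P. real (card (states A p)) \<le>
              2 powr (2 powr (C * (real (fm_length \<phi>) + real (card P) * log 2 (real (card P)))))) \<and>
           cfm_lang P \<Sigma> A = fm_lang P \<Sigma> \<phi>))"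
proof (intro exI conjI allI impI)
  show "recursive 3 (\<lambda>xs. machine_code (xs ! 0) (xs ! 1) (xs ! 2))" by (rule recursive_machine_code)
  fix P \<Sigma> :: "nat set" and \<phi> :: "(nat, nat) fm"
  assume fin: "finite P" "finite \<Sigma>" and \<phi>: "sentence \<phi>" "emso2 \<phi>"
  let ?A = "cfm (set_encode P) (set_encode \<Sigma>) (fm_code \<phi>)"
  have dec: "set_decode (set_encode P) = P" "set_decode (set_encode \<Sigma>) = \<Sigma>" using fin by simp_all
  show "is_cfm P \<Sigma> ?A" using is_cfm[of "set_encode P" "set_encode \<Sigma>"] unfolding dec .
  show "machine_code ([set_encode P, set_encode \<Sigma>, fm_code \<phi>] ! 0) ([set_encode P, set_encode \<Sigma>, fm_code \<phi>] ! 1)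
      ([set_encode P, set_encode \<Sigma>, fm_code \<phi>] ! 2) = cfm_code P ?A"
    using cfm_code_cfm[of "set_encode P" "set_encode \<Sigma>" "fm_code \<phi>"] unfolding dec by simp
  show "\<forall>p\<in>P. real (card (states ?A p)) \<le>
      2 powr (2 powr (21 * (real (fm_length \<phi>) + real (card P) * log 2 (real (card P)))))"
    using states_bound[of _ "set_encode P" \<phi>] unfolding dec by (simp add: cfm_def)
  show "cfm_lang P \<Sigma> ?A = fm_lang P \<Sigma> \<phi>"
    using cfm_lang_eq_fm_lang[OF \<phi>, of "set_encode P" "set_encode \<Sigma>"] unfolding dec .
qed

end
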